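(* (a) For every complex $\nu$ with $\operatorname{Re}\nu>-1$, the following integral identities hold: $$\int_{-1}^1\frac{[P_{\nu}(x)]^2P_{\nu}(-x)}{(1-x^{2})^{(1-\nu)/2}}\,dx=-\frac{8}{3}\int_{-1}^1\frac{x[P_{\nu+1}(x)]^2P_{\nu+1}(-x)}{(1-x^{2})^{(1-\nu)/2}}\,dx,$$ $$\int_{-1}^1\frac{[P_{\nu}(x)]^3}{(1-x^{2})^{(1-\nu)/2}}\,dx=\frac{8}{3}\int_{-1}^1\frac{x[P_{\nu+1}(x)]^3}{(1-x^{2})^{(1-\nu)/2}}\,dx,$$ as well as the recursion relation $$\int_{-1}^1\frac{[P_{\nu}(x)]^2P_{\nu}(-x)}{(1-x^{2})^{(1-\nu)/2}}\,dx=-\frac{64(\nu+2)^{4}}{(\nu+1)^{4}}\int_{-1}^1\frac{[P_{\nu+2}(x)]^2P_{\nu+2}(-x)}{(1-x^{2})^{-(1+\nu)/2}}\,dx.$$ (b) For every complex $\nu$ with $\operatorname{Re}\nu>-1$, $$\int_{-1}^1\frac{[P_{\nu}(x)]^2P_{\nu}(-x)}{(1-x^{2})^{(1-\nu)/2}}\,dx=\frac{1}{\pi}\left(\frac{\cos\frac{\nu\pi}{2}}{2^{\nu}}\right)^3\left[ \frac{\Gamma(\frac{1+\nu}{2})}{\Gamma(1+\frac{\nu}{2})} \right]^{4}.$$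
   Context: For $\mu\in\mathbb C$, $P_\mu$ denotes the Legendre function of the first kind of degree $\mu$, defined on $(-1,1]$ by $P_{\mu}(1-2z)={}_2F_1(-\mu,\mu+1;1;z)$, where ${}_2F_1$ is the Gauss hypergeometric function. $\Gamma$ is the Euler gamma function. *)

theory Defs
  imports "HOL-Analysis.Analysis"
begin

text \<open>The third argument of \<^const>\<open>fps_hypergeo\<close> rescales the variable; with value 1 it gives the
  coefficients \<open>(a)_n (b)_n / ((c)_n n!)\<close>. The sum is meaningful for \<open>norm z < 1\<close>.\<close>

definition gauss_2F1 :: "complex \<Rightarrow> complex \<Rightarrow> complex \<Rightarrow> complex \<Rightarrow> complex" where
  "gauss_2F1 a b c z = eval_fps (fps_hypergeo [a, b] [c] 1) z"

text \<open>With \<open>x = 1 - 2 z\<close>, the range \<open>-1 < x \<le> 1\<close> is \<open>0 \<le> z < 1\<close>, where the hypergeometric series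
  converges. Values at other \<open>x\<close> carry no meaning.\<close>

definition legendre_P :: "complex \<Rightarrow> real \<Rightarrow> complex" where
  "legendre_P \<mu> x = gauss_2F1 (- \<mu>) (\<mu> + 1) 1 (of_real ((1 - x) / 2))"

end

theory Submission
  imports Defs "HOL-Complex_Analysis.Complex_Analysis" "HOL-Real_Asymp.Real_Asymp"
begin

text \<open>Write \<open>p = 1 - x\<^sup>2\<close>. A solution \<open>f\<close> of Legendre's equation of degree \<open>\<mu>\<close> and its flux
\<open>g = p f'\<close> satisfy the first-order system \<open>p f' = g\<close>, \<open>g' = - \<mu> (\<mu> + 1) f\<close>. The raising operator
\<open>f \<mapsto> x f - g / (\<mu> + 1)\<close> sends \<open>P\<^sub>\<mu>(x)\<close> to \<open>P\<^sub>\<mu>\<^sub>+\<^sub>1(x)\<close> and \<open>P\<^sub>\<mu>(-x)\<close> to \<open>- P\<^sub>\<mu>\<^sub>+\<^sub>1(-x)\<close>.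

The integral identities hold for trilinear forms in arbitrary solutions. If \<open>Q\<close> is a cubic form in
\<open>f\<close> and \<open>g\<close> with polynomial coefficients in \<open>x\<close>, then the derivative of \<open>p\<^sup>s Q\<close> is \<open>p\<^sup>s\<^sup>-\<^sup>1\<close> times another such
form, and \<open>p\<^sup>s Q\<close> vanishes at both endpoints because \<open>f\<close> is at most logarithmic there and \<open>g\<close> is bounded.
For suitable \<open>Q\<close> the derivative is exactly the difference of the two integrands: the lemmas
\<open>cubic_form_eq_raised_moment\<close> and \<open>cubic_moment_eq_raised_form\<close> exhibit such \<open>Q\<close> for the two steps
\<open>\<nu> \<mapsto> \<nu> + 1\<close> and \<open>\<nu> + 1 \<mapsto> \<nu> + 2\<close>, and together the steps give the recursion.

For the closed form, divide the integral by the right-hand side without its factor \<open>cos\<^sup>3(\<pi>\<nu>/2)\<close>. The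
quotient \<open>C\<close> is holomorphic for \<open>Re \<nu> > -1\<close>, and the recursion becomes \<open>C(\<nu> + 2) = - C(\<nu>)\<close>, so \<open>C\<close> extends
to an entire function. Three facts identify it with \<open>cos\<^sup>3(\<pi>\<nu>/2)\<close> (lemma \<open>cos_cube_rigidity\<close>). First,
\<open>C(0) = 1\<close>, an arcsine integral. Second, \<open>C\<close> has a triple zero at \<open>-1\<close>, hence at every odd integer: as
\<open>\<nu> = t - 1\<close> with \<open>t \<rightarrow> 0\<close>, the integral is \<open>O(1/t)\<close> while the Gamma factor in \<open>C\<close> is \<open>O(t\<^sup>4)\<close>. Third,
\<open>C\<close> grows at most like a polynomial times \<open>exp(2\<pi>\<bar>Im \<nu>\<bar>)\<close> on vertical strips. Therefore
\<open>(C - cos\<^sup>3) / (cos\<^sup>3 sin)\<close>, all at \<open>\<pi>\<nu>/2\<close>, is entire, antiperiodic and of polynomial growth, which forces it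
to vanish.

The growth bound is sharp enough because of \<open>\<bar>P\<^sub>\<nu>(cos \<theta>)\<bar> sin \<theta> \<le> exp((\<bar>\<nu>\<bar> + 1) \<theta>)\<close>
(\<open>norm_legendre_P_cos_le\<close>): the two factors at \<open>x = cos \<theta>\<close> and the one at \<open>-x = cos (\<pi> - \<theta>)\<close> contribute
the exponent \<open>2 \<theta> + (\<pi> - \<theta>) \<le> 2 \<pi>\<close>, and \<open>2 \<pi>\<close> is precisely the exponential type of \<open>cos\<^sup>3 sin\<close>.\<close>

section \<open>Coefficients of the hypergeometric series\<close>

definition legendre_fps :: "complex \<Rightarrow> complex fps" where
  "legendre_fps \<mu> = fps_hypergeo [- \<mu>, \<mu> + 1] [1] 1"

lemma legendre_P_eval: "legendre_P \<mu> x = eval_fps (legendre_fps \<mu>) (of_real ((1 - x) / 2))"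
  by (simp add: legendre_P_def gauss_2F1_def legendre_fps_def)

lemma legendre_fps_0 [simp]: "legendre_fps \<mu> $ 0 = 1"
  by (simp only: legendre_fps_def fps_hypergeo_0)

lemma legendre_fps_Suc:
  "of_nat (Suc n) ^ 2 * legendre_fps \<mu> $ Suc n
     = (of_nat n * of_nat (Suc n) - \<mu> * (\<mu> + 1)) * legendre_fps \<mu> $ n"
proof -
  have [simp]: "(1 + of_nat n :: complex) \<noteq> 0"
    by (metis of_nat_Suc of_nat_neq_0)
  show ?thesis
    unfolding legendre_fps_def fps_hypergeo_rec
    by (simp add: divide_simps power2_eq_square del: fps_hypergeo_nth)
      (simp add: algebra_simps del: fps_hypergeo_nth)
qed

lemma legendre_fps_Suc':
  "legendre_fps \<mu> $ Suc n
     = (of_nat n * of_nat (Suc n) - \<mu> * (\<mu> + 1)) * legendre_fps \<mu> $ n / of_nat (Suc n) ^ 2"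
  using legendre_fps_Suc[of n \<mu>] by (simp add: field_simps del: of_nat_Suc)

text \<open>Write \<open>l = \<mu> (\<mu> + 1)\<close>. The recurrence multiplies \<open>n a\<^sub>n\<close> by \<open>1 - l / (n (n + 1))\<close>, which is at most
\<open>exp(\<bar>l\<bar> / (n (n + 1)))\<close> in modulus; the sum of the \<open>1 / (n (n + 1))\<close> telescopes to \<open>1 - 1 / n\<close>.\<close>

lemma norm_legendre_fps_aux:
  assumes "n > 0"
  shows "of_nat n * norm (legendre_fps \<mu> $ n)
           \<le> norm (\<mu> * (\<mu> + 1)) * exp (norm (\<mu> * (\<mu> + 1)) * (1 - 1 / real n))"
  using assms
proof (induction n rule: nat_induct_non_zero)
  case 1
  show ?case using legendre_fps_Suc'[of \<mu> 0] by (simp add: norm_mult)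
next
  case (Suc n)
  define L where "L = norm (\<mu> * (\<mu> + 1))"
  have L: "L \<ge> 0" by (simp add: L_def)
  have n: "real n > 0" using Suc by simp
  have "norm (of_nat n * of_nat (Suc n) - \<mu> * (\<mu> + 1)) \<le> real n * real (Suc n) + L"
    unfolding L_def by (rule order_trans[OF norm_triangle_ineq4]) (simp add: norm_mult del: of_nat_Suc)
  hence "real (Suc n) * norm (legendre_fps \<mu> $ Suc n)
      \<le> (real n * real (Suc n) + L) * norm (legendre_fps \<mu> $ n) / real (Suc n)"
    unfolding legendre_fps_Suc'
    by (simp add: norm_mult norm_divide norm_power power2_eq_square mult_right_mono divide_right_mono del: of_nat_Suc)
  also have "\<dots> = (1 + L / (real n * real (Suc n))) * (real n * norm (legendre_fps \<mu> $ n))"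
    using n by (simp add: divide_simps del: of_nat_Suc)
  also have "\<dots> \<le> exp (L / (real n * real (Suc n))) * (L * exp (L * (1 - 1 / real n)))"
    using Suc.IH L by (intro mult_mono[of _ _ "real n * norm (legendre_fps \<mu> $ n)"]) (auto simp: L_def)
  also have "\<dots> = L * exp (L / (real n * real (Suc n)) + L * (1 - 1 / real n))"
    by (simp add: exp_add)
  also have "L / (real n * real (Suc n)) + L * (1 - 1 / real n) = L * (1 - 1 / real (Suc n))"
    using n by (simp add: divide_simps) (simp add: algebra_simps)
  finally show ?case by (simp add: L_def)
qed

text \<open>This single constant controls the logarithmic growth of \<open>P\<^sub>\<mu>\<close> at \<open>-1\<close> and the size of its flux. The factor
\<open>\<mu> (\<mu> + 1)\<close> matters: it makes the constant small near \<open>\<mu> = -1\<close>, where the integral must be estimated up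
to a constant factor.\<close>

definition legendre_bound :: "complex \<Rightarrow> real" where
  "legendre_bound \<mu> = norm (\<mu> * (\<mu> + 1)) * exp (norm (\<mu> * (\<mu> + 1)))"

lemma legendre_bound_nonneg [simp]: "legendre_bound \<mu> \<ge> 0"
  by (simp add: legendre_bound_def)

lemma norm_legendre_fps:
  "real n * norm (legendre_fps \<mu> $ n) \<le> legendre_bound \<mu>"
proof (cases "n = 0")
  case False
  have "norm (\<mu> * (\<mu> + 1)) * (1 - 1 / real n) \<le> norm (\<mu> * (\<mu> + 1)) * 1"
    by (intro mult_left_mono) auto
  hence "norm (\<mu> * (\<mu> + 1)) * exp (norm (\<mu> * (\<mu> + 1)) * (1 - 1 / real n)) \<le> legendre_bound \<mu>"
    unfolding legendre_bound_def by (intro mult_left_mono) auto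
  with norm_legendre_fps_aux[of n \<mu>] False show ?thesis by simp
qed auto

lemma norm_legendre_fps':
  "norm (legendre_fps \<mu> $ n) \<le> 1 + legendre_bound \<mu>"
proof (cases "n = 0")
  case False
  have "norm (legendre_fps \<mu> $ n) = 1 * norm (legendre_fps \<mu> $ n)" by simp
  also have "\<dots> \<le> real n * norm (legendre_fps \<mu> $ n)"
    using False by (intro mult_right_mono) auto
  also have "\<dots> \<le> 1 + legendre_bound \<mu>" using norm_legendre_fps[of n \<mu>] by simp
  finally show ?thesis .
qed simp

lemma legendre_conv_radius: "fps_conv_radius (legendre_fps \<mu>) \<ge> 1"
  unfolding fps_conv_radius_def
proof (rule conv_radius_geI_ex)
  fix r :: real assume r: "0 < r" "ereal r < 1"
  have "summable (\<lambda>n. legendre_fps \<mu> $ n * of_real r ^ n)"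
  proof (rule summable_comparison_test')
    show "summable (\<lambda>n. (1 + legendre_bound \<mu>) * r ^ n)"
      using r by (intro summable_mult summable_geometric) auto
    show "norm (legendre_fps \<mu> $ n * of_real r ^ n) \<le> (1 + legendre_bound \<mu>) * r ^ n" for n
      using r norm_legendre_fps'[of \<mu> n] by (simp add: norm_mult norm_power mult_right_mono)
  qed
  thus "\<exists>z. norm z = r \<and> summable (\<lambda>n. legendre_fps \<mu> $ n * z ^ n)"
    using r by (intro exI[of _ "of_real r"]) auto
qed

lemma less_legendre_conv_radius [simp]:
  "norm z < 1 \<Longrightarrow> ereal (norm z) < fps_conv_radius (legendre_fps \<mu>)"
  using legendre_conv_radius[of \<mu>] by (meson ereal_less(3) less_le_trans)

lemma less_legendre_deriv_conv_radius [simp]: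
  "norm z < 1 \<Longrightarrow> ereal (norm z) < fps_conv_radius (fps_deriv (legendre_fps \<mu>))"
  using less_legendre_conv_radius[of z \<mu>] fps_conv_radius_deriv[of "legendre_fps \<mu>"]
  by (meson less_le_trans)

text \<open>In the variable \<open>z = (1 - x) / 2\<close> one has \<open>p = 4 z (1 - z)\<close>, so this is the flux up to a constant
factor; with it Legendre's equation takes the first-order form of \<open>legendre_flux_fps_deriv\<close>.\<close>

definition legendre_flux_fps :: "complex \<Rightarrow> complex fps" where
  "legendre_flux_fps \<mu> = fps_X * (1 - fps_X) * fps_deriv (legendre_fps \<mu>)"

lemma legendre_flux_fps_conv_radius [simp]:
  assumes "norm z < 1"
  shows "ereal (norm z) < fps_conv_radius (legendre_flux_fps \<mu>)"
proof -
  have "fps_conv_radius (fps_X - fps_X ^ 2 :: complex fps) = \<infinity>"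
    using fps_conv_radius_diff[of "fps_X" "fps_X ^ 2 :: complex fps"] by simp
  hence "fps_conv_radius (legendre_flux_fps \<mu>) \<ge> fps_conv_radius (fps_deriv (legendre_fps \<mu>))"
    using fps_conv_radius_mult[of "fps_X - fps_X ^ 2" "fps_deriv (legendre_fps \<mu>)"]
    unfolding legendre_flux_fps_def by (simp add: algebra_simps power2_eq_square)
  with assms show ?thesis
    by (meson less_le_trans less_legendre_deriv_conv_radius)
qed

lemma legendre_flux_fps_0 [simp]: "legendre_flux_fps \<mu> $ 0 = 0"
  by (simp add: legendre_flux_fps_def)

lemma legendre_flux_fps_Suc:
  "legendre_flux_fps \<mu> $ Suc n
     = of_nat (Suc n) * legendre_fps \<mu> $ Suc n - of_nat n * legendre_fps \<mu> $ n"
  by (cases n) (simp_all add: legendre_flux_fps_def algebra_simps)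

lemma legendre_flux_fps_deriv:
  "fps_deriv (legendre_flux_fps \<mu>) = fps_const (- \<mu> * (\<mu> + 1)) * legendre_fps \<mu>"
proof (rule fps_ext)
  fix n
  show "fps_deriv (legendre_flux_fps \<mu>) $ n = (fps_const (- \<mu> * (\<mu> + 1)) * legendre_fps \<mu>) $ n"
    using legendre_fps_Suc[of n \<mu>]
    by (simp add: legendre_flux_fps_Suc algebra_simps power2_eq_square)
qed

lemma eval_legendre_flux_fps:
  assumes "norm z < 1"
  shows "eval_fps (legendre_flux_fps \<mu>) z = z * (1 - z) * eval_fps (fps_deriv (legendre_fps \<mu>)) z"
proof -
  have "legendre_flux_fps \<mu> = fps_of_poly [:0, 1, -1:] * fps_deriv (legendre_fps \<mu>)"
    by (simp add: legendre_flux_fps_def fps_of_poly_pCons algebra_simps flip: fps_const_neg)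
  thus ?thesis
    using assms by (simp add: eval_fps_mult algebra_simps)
qed

text \<open>Both series have hypergeometric coefficients, and raising the degree shifts \<open>(-\<nu>)\<^sub>n\<close> against \<open>(\<nu> + 1)\<^sub>n\<close>:
a coefficient of the raised series is a rational multiple of the preceding coefficient of the original one.\<close>

lemma legendre_fps_ladder_coeff:
  "of_nat (Suc n) ^ 2 * legendre_fps (\<nu> + 1) $ Suc n
     = - (\<nu> + 2 + of_nat n) * (\<nu> + 1 + of_nat n) * legendre_fps \<nu> $ n"
proof (induction n)
  case 0
  show ?case using legendre_fps_Suc[of 0 "\<nu> + 1"] by (simp add: algebra_simps)
next
  case (Suc n)
  define N where "N = (of_nat (Suc n) :: complex)"
  have N: "N \<noteq> 0" unfolding N_def by (simp del: of_nat_Suc)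
  have n: "of_nat n = N - 1" "of_nat (Suc n) = N" by (simp_all add: N_def)
  have s: "of_nat (Suc (Suc n)) = N + 1" by (simp add: N_def)
  have "N ^ 2 * (of_nat (Suc (Suc n)) ^ 2 * legendre_fps (\<nu> + 1) $ Suc (Suc n))
      = (N * (N + 1) - (\<nu> + 1) * (\<nu> + 2)) * (N ^ 2 * legendre_fps (\<nu> + 1) $ Suc n)"
    using legendre_fps_Suc[of "Suc n" "\<nu> + 1"] unfolding n s by algebra
  also have "\<dots> = (N * (N + 1) - (\<nu> + 1) * (\<nu> + 2)) * (- (\<nu> + 1 + N) * (\<nu> + N) * legendre_fps \<nu> $ n)"
    using Suc.IH unfolding n by algebra
  also have "\<dots> = - (\<nu> + 2 + N) * (\<nu> + 1 + N) * (((N - 1) * N - \<nu> * (\<nu> + 1)) * legendre_fps \<nu> $ n)"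
    by (simp add: algebra_simps)
  also have "\<dots> = - (\<nu> + 2 + N) * (\<nu> + 1 + N) * (N ^ 2 * legendre_fps \<nu> $ Suc n)"
    using legendre_fps_Suc[of n \<nu>] unfolding n by simp
  finally have "N ^ 2 * (of_nat (Suc (Suc n)) ^ 2 * legendre_fps (\<nu> + 1) $ Suc (Suc n))
      = N ^ 2 * (- (\<nu> + 2 + N) * (\<nu> + 1 + N) * legendre_fps \<nu> $ Suc n)"
    by (simp only: mult_ac)
  thus ?case using N unfolding n by simp
qed

lemma legendre_fps_ladder:
  "fps_const (\<nu> + 1) * legendre_fps (\<nu> + 1)
       = fps_const (\<nu> + 1) * (1 - 2 * fps_X) * legendre_fps \<nu> + 2 * legendre_flux_fps \<nu>"
proof (rule fps_ext)
  fix n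
  show "(fps_const (\<nu> + 1) * legendre_fps (\<nu> + 1)) $ n
      = (fps_const (\<nu> + 1) * (1 - 2 * fps_X) * legendre_fps \<nu> + 2 * legendre_flux_fps \<nu>) $ n"
  proof (cases n)
    case (Suc m)
    define N where "N = (of_nat (Suc m) :: complex)"
    have N: "N \<noteq> 0" unfolding N_def by (simp del: of_nat_Suc)
    have n: "of_nat m = N - 1" "of_nat (Suc m) = N" by (simp_all add: N_def)
    have A: "N ^ 2 * legendre_fps (\<nu> + 1) $ Suc m = - (\<nu> + 1 + N) * (\<nu> + N) * legendre_fps \<nu> $ m"
      using legendre_fps_ladder_coeff[of m \<nu>] unfolding n by (simp add: algebra_simps)
    have B: "N ^ 2 * legendre_fps \<nu> $ Suc m = ((N - 1) * N - \<nu> * (\<nu> + 1)) * legendre_fps \<nu> $ m"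
      using legendre_fps_Suc[of m \<nu>] unfolding n .
    have "N ^ 2 * ((\<nu> + 1) * legendre_fps (\<nu> + 1) $ Suc m)
        = N ^ 2 * ((\<nu> + 1) * (legendre_fps \<nu> $ Suc m - 2 * legendre_fps \<nu> $ m)
            + 2 * (N * legendre_fps \<nu> $ Suc m - (N - 1) * legendre_fps \<nu> $ m))"
      using A B by algebra
    hence "(\<nu> + 1) * legendre_fps (\<nu> + 1) $ Suc m
        = (\<nu> + 1) * (legendre_fps \<nu> $ Suc m - 2 * legendre_fps \<nu> $ m)
            + 2 * (N * legendre_fps \<nu> $ Suc m - (N - 1) * legendre_fps \<nu> $ m)"
      using N by simp
    moreover have "((1 - 2 * fps_X) * legendre_fps \<nu>) $ Suc m
        = legendre_fps \<nu> $ Suc m - 2 * legendre_fps \<nu> $ m"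
      by (simp add: algebra_simps numeral_fps_const)
    moreover have "(2 * legendre_flux_fps \<nu>) $ Suc m = 2 * legendre_flux_fps \<nu> $ Suc m"
      by (simp add: numeral_fps_const)
    moreover have "legendre_flux_fps \<nu> $ Suc m = N * legendre_fps \<nu> $ Suc m - (N - 1) * legendre_fps \<nu> $ m"
      by (simp add: legendre_flux_fps_Suc N_def)
    ultimately show ?thesis
      by (simp add: Suc mult.assoc del: fps_mult_nth)
  qed simp
qed

section \<open>Legendre functions on the open interval\<close>

text \<open>The factor \<open>-2\<close> makes this equal to \<open>(1 - x\<^sup>2) P\<^sub>\<mu>'(x)\<close>, as \<open>legendre_P_deriv\<close> shows.\<close>

definition legendre_flux :: "complex \<Rightarrow> real \<Rightarrow> complex" where
  "legendre_flux \<mu> x = - 2 * eval_fps (legendre_flux_fps \<mu>) (of_real ((1 - x) / 2))"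

lemma norm_half_less_1: "\<bar>x\<bar> < 1 \<Longrightarrow> norm (complex_of_real ((1 - x) / 2)) < 1"
  by (simp only: norm_of_real) auto

lemma legendre_P_deriv:
  assumes "\<bar>x\<bar> < 1"
  shows "(legendre_P \<mu> has_vector_derivative legendre_flux \<mu> x / of_real (1 - x\<^sup>2)) (at x)"
proof -
  define z where "z = complex_of_real ((1 - x) / 2)"
  have z: "norm z < 1" using norm_half_less_1[OF assms] by (simp add: z_def)
  have "x\<^sup>2 < 1" using assms by (simp add: abs_square_less_1)
  hence p: "complex_of_real (1 - x\<^sup>2) \<noteq> 0" by (simp only: of_real_eq_0_iff)
  have pz: "complex_of_real (1 - x\<^sup>2) = 4 * z * (1 - z)"
    by (simp add: z_def power2_eq_square algebra_simps add_divide_distrib diff_divide_distrib)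
  have "((eval_fps (legendre_fps \<mu>) \<circ> (\<lambda>x. complex_of_real ((1 - x) / 2)))
          has_vector_derivative (of_real (-1/2) * eval_fps (fps_deriv (legendre_fps \<mu>)) z)) (at x)"
  proof (rule field_vector_diff_chain_at)
    show "(eval_fps (legendre_fps \<mu>) has_field_derivative eval_fps (fps_deriv (legendre_fps \<mu>)) z)
            (at (complex_of_real ((1 - x) / 2)))"
      unfolding z_def[symmetric] using z by (intro has_field_derivative_eval_fps) simp
  qed (auto intro!: derivative_eq_intros has_vector_derivative_of_real)
  moreover have "eval_fps (legendre_fps \<mu>) \<circ> (\<lambda>x. complex_of_real ((1 - x) / 2)) = legendre_P \<mu>"
    by (auto simp: legendre_P_eval)
  moreover have "of_real (-1/2) * eval_fps (fps_deriv (legendre_fps \<mu>)) z = legendre_flux \<mu> x / of_real (1 - x\<^sup>2)"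
    using p unfolding legendre_flux_def z_def[symmetric] eval_legendre_flux_fps[OF z] pz by (simp add: field_simps)
  ultimately show ?thesis by simp
qed

lemma legendre_flux_deriv:
  assumes "\<bar>x\<bar> < 1"
  shows "(legendre_flux \<mu> has_vector_derivative - (\<mu> * (\<mu> + 1)) * legendre_P \<mu> x) (at x)"
proof -
  define z where "z = complex_of_real ((1 - x) / 2)"
  have z: "norm z < 1" using norm_half_less_1[OF assms] by (simp add: z_def)
  have "((eval_fps (legendre_flux_fps \<mu>) \<circ> (\<lambda>x. complex_of_real ((1 - x) / 2)))
          has_vector_derivative (of_real (-1/2) * eval_fps (fps_deriv (legendre_flux_fps \<mu>)) z)) (at x)"
  proof (rule field_vector_diff_chain_at)
    show "(eval_fps (legendre_flux_fps \<mu>) has_field_derivative eval_fps (fps_deriv (legendre_flux_fps \<mu>)) z)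
            (at (complex_of_real ((1 - x) / 2)))"
      unfolding z_def[symmetric] using z by (intro has_field_derivative_eval_fps) simp
  qed (auto intro!: derivative_eq_intros has_vector_derivative_of_real)
  hence "((\<lambda>x. -2 * eval_fps (legendre_flux_fps \<mu>) (complex_of_real ((1 - x) / 2)))
          has_vector_derivative (-2 * (of_real (-1/2) * eval_fps (fps_deriv (legendre_flux_fps \<mu>)) z))) (at x)"
    unfolding o_def by (rule has_vector_derivative_mult_right)
  moreover have "eval_fps (fps_deriv (legendre_flux_fps \<mu>)) z = - \<mu> * (\<mu> + 1) * legendre_P \<mu> x"
    unfolding legendre_flux_fps_deriv legendre_P_eval z_def[symmetric] using z
    by (subst eval_fps_mult) auto
  ultimately show ?thesis unfolding legendre_flux_def[abs_def] by simp
qed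

lemma legendre_P_ladder:
  assumes "\<bar>x\<bar> < 1" "\<nu> \<noteq> -1"
  shows "legendre_P (\<nu> + 1) x = of_real x * legendre_P \<nu> x - legendre_flux \<nu> x / (\<nu> + 1)"
proof -
  define z where "z = complex_of_real ((1 - x) / 2)"
  have z: "norm z < 1" using norm_half_less_1[OF assms(1)] by (simp add: z_def)
  have x: "of_real x = 1 - 2 * z" by (simp add: z_def field_simps)
  have nu: "\<nu> + 1 \<noteq> 0" using assms(2) by (metis add.commute add_0 add_diff_cancel_left' diff_0 diff_minus_eq_add)
  have *: "fps_const (\<nu> + 1) * (1 - 2 * fps_X) = fps_of_poly [:\<nu> + 1, -2 * (\<nu> + 1):]"
    by (simp add: fps_of_poly_pCons algebra_simps numeral_fps_const flip: fps_const_neg fps_const_add fps_const_mult)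
  have **: "2 * legendre_flux_fps \<nu> = fps_of_poly [:2:] * legendre_flux_fps \<nu>"
    by (simp add: fps_of_poly_pCons numeral_fps_const)
  have "eval_fps (fps_of_poly [:\<nu> + 1:] * legendre_fps (\<nu> + 1)) z
      = eval_fps (fps_of_poly [:\<nu> + 1, -2 * (\<nu> + 1):] * legendre_fps \<nu> + fps_of_poly [:2:] * legendre_flux_fps \<nu>) z"
    using legendre_fps_ladder[of \<nu>] unfolding * ** by (simp add: fps_of_poly_pCons)
  also have "\<dots> = eval_fps (fps_of_poly [:\<nu> + 1, -2 * (\<nu> + 1):] * legendre_fps \<nu>) z + eval_fps (fps_of_poly [:2:] * legendre_flux_fps \<nu>) z"
    by (rule eval_fps_add) (rule less_le_trans[OF _ fps_conv_radius_mult], use z in simp)+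
  finally have "(\<nu> + 1) * eval_fps (legendre_fps (\<nu> + 1)) z
      = (\<nu> + 1) * (1 - 2 * z) * eval_fps (legendre_fps \<nu>) z + 2 * eval_fps (legendre_flux_fps \<nu>) z"
    using z by (simp add: eval_fps_mult algebra_simps)
  thus ?thesis using nu
    unfolding legendre_P_eval legendre_flux_def z_def[symmetric] x by (simp add: field_simps)
qed

text \<open>An even majorant of the logarithmic singularities \<open>- ln((1 \<plusminus> x) / 2)\<close>, so that \<open>P\<^sub>\<mu>(x)\<close> and \<open>P\<^sub>\<mu>(-x)\<close>
obey the same bound.\<close>

definition endpoint_log :: "real \<Rightarrow> real" where "endpoint_log x = ln (4 / (1 - x\<^sup>2))"

lemma endpoint_log_pos: "\<bar>x\<bar> < 1 \<Longrightarrow> endpoint_log x > 0"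
proof -
  assume "\<bar>x\<bar> < 1"
  hence "x\<^sup>2 < 1" by (simp add: abs_square_less_1)
  moreover have "3 + x\<^sup>2 > 0" by (simp add: add_pos_nonneg)
  ultimately show ?thesis unfolding endpoint_log_def by (intro ln_gt_zero) (simp add: field_simps)
qed

lemma endpoint_log_minus [simp]: "endpoint_log (-x) = endpoint_log x" by (simp add: endpoint_log_def)

text \<open>Since \<open>\<bar>n a\<^sub>n\<bar>\<close> is bounded, the series is dominated by that of \<open>- ln(1 - z)\<close>.\<close>

lemma norm_legendre_P_le:
  assumes "\<bar>x\<bar> < 1"
  shows "norm (legendre_P \<mu> x) \<le> 1 + legendre_bound \<mu> * endpoint_log x"
proof -
  define t where "t = (1 - x) / 2"
  have t: "0 < t" "t < 1" using assms by (auto simp: t_def)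
  have "(\<lambda>n. - ((- (-t)) ^ n) / of_nat n) sums ln (1 + (- t))"
    by (rule ln_series') (use t in auto)
  hence s: "(\<lambda>n. legendre_bound \<mu> * (t ^ n / of_nat n)) sums (legendre_bound \<mu> * (- ln (1 - t)))"
    by (intro sums_mult) (use sums_minus in force)
  have "(\<lambda>n. if n = 0 then 1 else 0) sums (1 :: real)"
    using sums_single[of 0 "\<lambda>_. 1 :: real"] by simp
  note s' = sums_add[OF this s]
  have "norm (legendre_P \<mu> x) \<le> (\<Sum>n. (if n = 0 then 1 else 0) + legendre_bound \<mu> * (t ^ n / of_nat n))"
    unfolding legendre_P_eval eval_fps_def
  proof (rule norm_suminf_le)
    fix n
    show "norm (legendre_fps \<mu> $ n * of_real ((1 - x) / 2) ^ n)
        \<le> (if n = 0 then 1 else 0) + legendre_bound \<mu> * (t ^ n / of_nat n)"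
    proof (cases "n = 0")
      case False
      have "norm (legendre_fps \<mu> $ n) \<le> legendre_bound \<mu> / n"
        using norm_legendre_fps[of n \<mu>] False by (simp add: field_simps)
      hence "norm (legendre_fps \<mu> $ n) * t ^ n \<le> legendre_bound \<mu> / n * t ^ n"
        using t by (intro mult_right_mono) auto
      thus ?thesis using t False unfolding t_def[symmetric]
        by (simp add: norm_mult norm_power)
    qed simp
  qed (rule sums_summable[OF s'])
  also have "\<dots> = 1 + legendre_bound \<mu> * (- ln (1 - t))" by (rule sums_unique[OF s', symmetric])
  also have "- ln (1 - t) \<le> endpoint_log x"
  proof -
    have "- ln (1 - t) = ln (1 / (1 - t))" using t by (simp add: ln_div)
    also have "\<dots> \<le> ln (1 / (t * (1 - t)))"
      using t mult_right_mono[of t 1 "1 - t"] by (intro ln_mono frac_le) auto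
    also have "1 / (t * (1 - t)) = 4 / (1 - x\<^sup>2)" by (simp add: t_def field_simps power2_eq_square)
    finally show ?thesis by (simp add: endpoint_log_def)
  qed
  hence "1 + legendre_bound \<mu> * (- ln (1 - t)) \<le> 1 + legendre_bound \<mu> * endpoint_log x"
    by (intro add_left_mono mult_left_mono) auto
  finally show ?thesis .
qed

text \<open>The derivative of the series is dominated by a geometric series, whose pole at \<open>z = 1\<close> is cancelled by the
factor \<open>1 - z\<close> of the flux.\<close>

lemma norm_legendre_flux_le:
  assumes "\<bar>x\<bar> < 1"
  shows "norm (legendre_flux \<mu> x) \<le> 2 * legendre_bound \<mu>"
proof -
  define t where "t = (1 - x) / 2"
  have t: "0 < t" "t < 1" using assms by (auto simp: t_def)
  have z: "norm (complex_of_real t) < 1" using t by simp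
  have "(\<lambda>n. t ^ n) sums (1 / (1 - t))" using t by (intro geometric_sums) auto
  note s = sums_mult[OF this, of "legendre_bound \<mu>"]
  have "norm (eval_fps (fps_deriv (legendre_fps \<mu>)) (of_real t)) \<le> (\<Sum>n. legendre_bound \<mu> * t ^ n)"
    unfolding eval_fps_def
  proof (rule norm_suminf_le)
    fix n
    show "norm (fps_deriv (legendre_fps \<mu>) $ n * of_real t ^ n) \<le> legendre_bound \<mu> * t ^ n"
      using t norm_legendre_fps[of "Suc n" \<mu>]
      by (auto simp: norm_mult norm_power intro!: mult_right_mono simp del: of_nat_Suc)
  qed (rule sums_summable[OF s])
  also have "\<dots> = legendre_bound \<mu> / (1 - t)" by (rule sums_unique[OF s, simplified, symmetric])
  finally have F: "norm (eval_fps (fps_deriv (legendre_fps \<mu>)) (of_real t)) \<le> legendre_bound \<mu> / (1 - t)" .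
  have "norm (legendre_flux \<mu> x) = 2 * (t * (1 - t)) * norm (eval_fps (fps_deriv (legendre_fps \<mu>)) (of_real t))"
  proof -
    have "norm (1 - complex_of_real t) = 1 - t"
      using t norm_of_real[of "1 - t", where 'a = complex] by simp
    thus ?thesis
      using t unfolding legendre_flux_def t_def[symmetric] eval_legendre_flux_fps[OF z] norm_mult by simp
  qed
  also have "\<dots> \<le> 2 * (t * (1 - t)) * (legendre_bound \<mu> / (1 - t))"
    using t F by (intro mult_left_mono) auto
  also have "\<dots> = 2 * legendre_bound \<mu> * t" using t by simp
  also have "\<dots> \<le> 2 * legendre_bound \<mu> * 1" using t by (intro mult_left_mono) auto
  finally show ?thesis by simp
qed

lemma continuous_on_legendre_P: "continuous_on {-1<..<1} (legendre_P \<mu>)"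
  using legendre_P_deriv by (intro continuous_at_imp_continuous_on ballI)
    (auto intro: has_vector_derivative_continuous simp: abs_less_iff)

lemma continuous_on_legendre_flux: "continuous_on {-1<..<1} (legendre_flux \<mu>)"
  using legendre_flux_deriv by (intro continuous_at_imp_continuous_on ballI)
    (auto intro: has_vector_derivative_continuous simp: abs_less_iff)

lemma legendre_fps_holomorphic: "(\<lambda>\<mu>. legendre_fps \<mu> $ n) holomorphic_on A"
  by (induction n) (auto simp: legendre_fps_Suc' simp del: of_nat_Suc intro!: holomorphic_intros)

lemma continuous_on_legendre_bound: "continuous_on A legendre_bound"
  unfolding legendre_bound_def[abs_def] by (intro continuous_intros)

lemma legendre_P_holomorphic:
  assumes "\<bar>x\<bar> < 1"
  shows "(\<lambda>\<mu>. legendre_P \<mu> x) holomorphic_on UNIV"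
proof (rule holomorphic_uniform_sequence)
  define t where "t = (1 - x) / 2"
  have t: "0 < t" "t < 1" using assms by (auto simp: t_def)
  show "(\<lambda>\<mu>. \<Sum>i<n. legendre_fps \<mu> $ i * of_real t ^ i) holomorphic_on UNIV" for n
    by (intro holomorphic_intros legendre_fps_holomorphic)
  fix \<mu> :: complex
  have "compact (legendre_bound ` cball \<mu> 1)"
    by (intro compact_continuous_image continuous_on_legendre_bound) auto
  hence "bounded (legendre_bound ` cball \<mu> 1)" by (rule compact_imp_bounded)
  then obtain B where B: "\<And>w. w \<in> cball \<mu> 1 \<Longrightarrow> norm (legendre_bound w) \<le> B"
    by (metis bounded_iff imageI)
  have "uniform_limit (cball \<mu> 1) (\<lambda>n w. \<Sum>i<n. legendre_fps w $ i * of_real t ^ i)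
          (\<lambda>w. \<Sum>i. legendre_fps w $ i * of_real t ^ i) sequentially"
  proof (rule Weierstrass_m_test)
    show "summable (\<lambda>n. (1 + B) * t ^ n)" using t by (intro summable_mult summable_geometric) auto
    show "norm (legendre_fps w $ n * of_real t ^ n) \<le> (1 + B) * t ^ n" if "w \<in> cball \<mu> 1" for n w
      using t norm_legendre_fps'[of w n] B[OF that] by (simp add: norm_mult norm_power mult_right_mono)
  qed
  moreover have "(\<lambda>w. \<Sum>i. legendre_fps w $ i * of_real t ^ i) = (\<lambda>w. legendre_P w x)"
    by (simp add: legendre_P_eval eval_fps_def t_def)
  ultimately show "\<exists>d>0. cball \<mu> d \<subseteq> UNIV \<and> uniform_limit (cball \<mu> d)
      (\<lambda>n w. \<Sum>i<n. legendre_fps w $ i * of_real t ^ i) (\<lambda>w. legendre_P w x) sequentially"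
    by (intro exI[of _ 1]) auto
qed auto

lemma legendre_P_0 [simp]: "legendre_P 0 x = 1"
proof -
  have "legendre_fps 0 = 1"
  proof (rule fps_ext)
    fix n show "legendre_fps 0 $ n = 1 $ n"
    proof (induction n)
      case (Suc n) thus ?case by (cases n) (auto simp: legendre_fps_Suc')
    qed simp
  qed
  thus ?thesis by (simp add: legendre_P_eval)
qed

section \<open>Integrals against powers of \<open>1 - x\<^sup>2\<close>\<close>

definition endpoint_weight :: "complex \<Rightarrow> real \<Rightarrow> complex" where
  "endpoint_weight s x = complex_of_real (1 - x\<^sup>2) powr s"

lemma one_minus_square_pos: "\<bar>x\<bar> < 1 \<Longrightarrow> 0 < 1 - (x::real)\<^sup>2"
  by (simp add: abs_square_less_1)

lemma norm_endpoint_weight: "\<bar>x\<bar> < 1 \<Longrightarrow> norm (endpoint_weight s x) = (1 - x\<^sup>2) powr Re s"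
  unfolding endpoint_weight_def using one_minus_square_pos[of x]
  by (subst norm_powr_real_powr) (auto simp del: of_real_diff of_real_power)

lemma endpoint_weight_deriv:
  assumes "\<bar>x\<bar> < 1"
  shows "(endpoint_weight s has_vector_derivative - (2 * s * of_real x) * endpoint_weight (s - 1) x) (at x)"
proof -
  have "((\<lambda>z. z powr s) \<circ> (\<lambda>x. complex_of_real (1 - x\<^sup>2)) has_vector_derivative
          of_real (- (2 * x)) * (s * complex_of_real (1 - x\<^sup>2) powr (s - 1))) (at x)"
  proof (rule field_vector_diff_chain_at)
    show "((\<lambda>x. complex_of_real (1 - x\<^sup>2)) has_vector_derivative of_real (- (2 * x))) (at x)"
      by (rule has_vector_derivative_of_real) (auto intro!: derivative_eq_intros)
    show "((\<lambda>z. z powr s) has_field_derivative s * complex_of_real (1 - x\<^sup>2) powr (s - 1))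
            (at (complex_of_real (1 - x\<^sup>2)))"
      using one_minus_square_pos[OF assms]
      by (intro has_field_derivative_powr) (simp only: nonpos_Reals_of_real_iff not_le)
  qed
  thus ?thesis unfolding endpoint_weight_def[abs_def] o_def by (simp add: mult_ac)
qed

lemma continuous_on_endpoint_weight: "continuous_on {-1<..<1} (endpoint_weight s)"
  using endpoint_weight_deriv by (intro continuous_at_imp_continuous_on ballI)
    (auto intro: has_vector_derivative_continuous simp: abs_less_iff)

lemma endpoint_weight_succ: "\<bar>x\<bar> < 1 \<Longrightarrow> endpoint_weight s x = of_real (1 - x\<^sup>2) * endpoint_weight (s - 1) x"
proof -
  assume "\<bar>x\<bar> < 1"
  hence "complex_of_real (1 - x\<^sup>2) \<noteq> 0"
    by (auto simp only: of_real_eq_0_iff dest: one_minus_square_pos)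
  thus ?thesis
    using powr_add[of "complex_of_real (1 - x\<^sup>2)" 1 "s - 1"] unfolding endpoint_weight_def by (simp del: of_real_diff of_real_power)
qed


text \<open>Near each endpoint \<open>(1 - x\<^sup>2)\<^sup>\<delta>\<^sup>-\<^sup>1\<close> is comparable to one of these two powers, which have elementary
antiderivatives. The dependence \<open>4 / \<delta>\<close> as \<open>\<delta> \<rightarrow> 0\<close> is what yields the order of growth of the triple integral
at \<open>\<nu> = -1\<close>.\<close>

lemma
  fixes \<delta> :: real
  assumes "0 < \<delta>" "\<delta> \<le> 1"
  shows set_integrable_endpoint_powr:
      "set_integrable lborel {-1<..<1} (\<lambda>x. (1 - x) powr (\<delta> - 1) + (1 + x) powr (\<delta> - 1))"
    and set_integral_endpoint_powr:
      "(LBINT x:{-1<..<1}. (1 - x) powr (\<delta> - 1) + (1 + x) powr (\<delta> - 1)) \<le> 4 / \<delta>"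
proof -
  define F where "F = (\<lambda>x::real. ((1 + x) powr \<delta> - (1 - x) powr \<delta>) / \<delta>)"
  define f where "f = (\<lambda>x::real. (1 - x) powr (\<delta> - 1) + (1 + x) powr (\<delta> - 1))"
  have e: "einterval (ereal (-1)) (ereal 1) = {-1<..<1}" by auto
  have lim: "((F \<circ> real_of_ereal) \<longlongrightarrow> - (2 powr \<delta> / \<delta>)) (at_right (ereal (-1)))"
            "((F \<circ> real_of_ereal) \<longlongrightarrow> 2 powr \<delta> / \<delta>) (at_left (ereal 1))"
  proof -
    have "continuous_on {-1..1} F"
      unfolding F_def using assms by (intro continuous_intros continuous_on_powr') auto
    hence c: "(F \<longlongrightarrow> F (-1)) (at (-1) within {-1..1})" "(F \<longlongrightarrow> F 1) (at 1 within {-1..1})"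
      by (auto simp: continuous_on_def)
    have "(F \<longlongrightarrow> F (-1)) (at_right (-1))" "(F \<longlongrightarrow> F 1) (at_left 1)"
      using c by (simp_all add: at_within_Icc_at_right at_within_Icc_at_left)
    moreover have "F (-1) = - (2 powr \<delta> / \<delta>)" "F 1 = 2 powr \<delta> / \<delta>"
      using assms by (simp_all add: F_def)
    ultimately show "((F \<circ> real_of_ereal) \<longlongrightarrow> - (2 powr \<delta> / \<delta>)) (at_right (ereal (-1)))"
            "((F \<circ> real_of_ereal) \<longlongrightarrow> 2 powr \<delta> / \<delta>) (at_left (ereal 1))"
      by (simp_all add: ereal_tendsto_simps1)
  qed
  have D: "DERIV F x :> f x" if "ereal (-1) < ereal x" "ereal x < ereal 1" for x
    unfolding F_def f_def using that assms
    by (auto intro!: derivative_eq_intros simp: field_simps)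
  have C: "isCont f x" if "ereal (-1) < ereal x" "ereal x < ereal 1" for x
    unfolding f_def using that by (intro continuous_intros) auto
  have N: "AE x in lborel. ereal (-1) < ereal x \<longrightarrow> ereal x < ereal 1 \<longrightarrow> 0 \<le> f x"
    by (simp add: f_def)
  note FTC = interval_integral_FTC_nonneg[of "ereal (-1)" "ereal 1" F f, OF _ D C N lim]
  show "set_integrable lborel {-1<..<1} (\<lambda>x. (1 - x) powr (\<delta> - 1) + (1 + x) powr (\<delta> - 1))"
    using FTC(1) unfolding e f_def by simp
  have "2 powr \<delta> \<le> 2 powr 1" using assms by (intro powr_mono) auto
  hence "2 powr \<delta> / \<delta> \<le> 2 / \<delta>" using assms by (intro divide_right_mono) auto
  thus "(LBINT x:{-1<..<1}. (1 - x) powr (\<delta> - 1) + (1 + x) powr (\<delta> - 1)) \<le> 4 / \<delta>"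
    using FTC(2) unfolding interval_lebesgue_integral_def e f_def by simp
qed

lemma powr_one_minus_square_le:
  assumes "\<bar>x\<bar> < 1" "\<delta> \<le> (1::real)"
  shows "(1 - x\<^sup>2) powr (\<delta> - 1) \<le> (1 - x) powr (\<delta> - 1) + (1 + x) powr (\<delta> - 1)"
proof (cases "x \<ge> 0")
  case True
  have "(1 - x) * 1 \<le> (1 - x) * (1 + x)" using True assms by (intro mult_left_mono) auto
  hence "1 - x \<le> 1 - x\<^sup>2" by (simp add: power2_eq_square algebra_simps)
  hence "(1 - x\<^sup>2) powr (\<delta> - 1) \<le> (1 - x) powr (\<delta> - 1)"
    using assms by (intro powr_mono2') auto
  thus ?thesis by (simp add: add_increasing2)
next
  case False
  have "(1 + x) * 1 \<le> (1 + x) * (1 - x)" using False assms by (intro mult_left_mono) auto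
  hence "1 + x \<le> 1 - x\<^sup>2" by (simp add: power2_eq_square algebra_simps)
  hence "(1 - x\<^sup>2) powr (\<delta> - 1) \<le> (1 + x) powr (\<delta> - 1)"
    using assms by (intro powr_mono2') auto
  thus ?thesis by (simp add: add_increasing)
qed

lemma
  fixes f :: "real \<Rightarrow> complex"
  assumes cont: "continuous_on {-1<..<1} f"
    and bd: "\<And>x. \<bar>x\<bar> < 1 \<Longrightarrow> norm (f x) \<le> K * (1 - x\<^sup>2) powr (\<delta> - 1)"
    and \<delta>: "0 < \<delta>" "\<delta> \<le> 1" and K: "0 \<le> K"
  shows set_integrable_powr_bound: "set_integrable lborel {-1<..<1} f"
    and norm_set_integral_powr_bound: "norm (LBINT x:{-1<..<1}. f x) \<le> 4 * K / \<delta>"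
proof -
  define g where "g = (\<lambda>x::real. (1 - x) powr (\<delta> - 1) + (1 + x) powr (\<delta> - 1))"
  have g: "set_integrable lborel {-1<..<1} g"
    unfolding g_def by (rule set_integrable_endpoint_powr[OF \<delta>])
  have g': "set_integrable lborel {-1<..<1} (\<lambda>x. K * g x)"
    using g by (rule set_integrable_mult_right)
  have le: "norm (f x) \<le> K * g x" if "x \<in> {-1<..<1}" for x
    using order_trans[OF bd mult_left_mono[OF powr_one_minus_square_le[of x \<delta>] K]] that \<delta>
    by (auto simp: g_def abs_less_iff)
  have meas: "set_borel_measurable lborel {-1<..<1} f"
    unfolding set_borel_measurable_def
    using borel_measurable_continuous_on_indicator[of "{-1<..<1}" f] cont by simp
  show int: "set_integrable lborel {-1<..<1} f"
    by (rule set_integrable_bound[OF g' meas]) (use le in force)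
  have "norm (LBINT x:{-1<..<1}. f x) \<le> (LBINT x:{-1<..<1}. norm (f x))"
    by (rule set_integral_norm_bound[OF int])
  also have "\<dots> \<le> (LBINT x:{-1<..<1}. K * g x)"
    using le by (intro set_integral_mono set_integrable_norm int g')
  also have "\<dots> = K * (LBINT x:{-1<..<1}. g x)" by simp
  also have "\<dots> \<le> K * (4 / \<delta>)"
    unfolding g_def by (intro mult_left_mono set_integral_endpoint_powr \<delta> K)
  finally show "norm (LBINT x:{-1<..<1}. f x) \<le> 4 * K / \<delta>" by (simp add: mult.commute)
qed

lemma exp_endpoint_log: "\<bar>x\<bar> < 1 \<Longrightarrow> exp (a * endpoint_log x) = 4 powr a * (1 - x\<^sup>2) powr (- a)"
  using one_minus_square_pos[of x]
  by (simp add: endpoint_log_def ln_div powr_def algebra_simps flip: exp_add)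

text \<open>Used with \<open>t\<close> a multiple of the endpoint logarithm: a logarithm costs an arbitrarily small power of
\<open>1 - x\<^sup>2\<close>.\<close>

lemma one_plus_le_exp_scaled:
  assumes "0 < a" "0 \<le> (t::real)" 
  shows "1 + t \<le> (1 + 1 / a) * exp (a * t)"
proof -
  have "t \<le> exp (a * t) / a"
    using exp_ge_add_one_self[of "a * t"] assms by (simp add: pos_le_divide_eq mult.commute del: exp_ge_add_one_self)
  moreover have "1 \<le> exp (a * t)" using assms by simp
  moreover have "(1 + 1 / a) * exp (a * t) = exp (a * t) + exp (a * t) / a"
    by (simp add: algebra_simps)
  ultimately show ?thesis by linarith
qed


text \<open>The class of functions with at most a power of a logarithm as singularity at the endpoints. It contains
Legendre functions, their fluxes and polynomials, and it is closed under the ring operations, so every cubic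
form below belongs to it.\<close>

definition log_bounded :: "(real \<Rightarrow> complex) \<Rightarrow> bool" where
  "log_bounded f \<longleftrightarrow> continuous_on {-1<..<1} f \<and>
     (\<exists>C k. \<forall>x. \<bar>x\<bar> < 1 \<longrightarrow> norm (f x) \<le> C * (1 + endpoint_log x) ^ k)"

lemma log_bounded_const: "log_bounded (\<lambda>_. c)"
  unfolding log_bounded_def by (auto intro!: exI[of _ "norm c"] exI[of _ "0::nat"])

lemma log_bounded_of_real: "log_bounded of_real"
  unfolding log_bounded_def by (auto intro!: continuous_intros exI[of _ 1] exI[of _ "0::nat"])

lemma log_bounded_mult:
  assumes "log_bounded f" "log_bounded g"
  shows "log_bounded (\<lambda>x. f x * g x)"
proof -
  from assms obtain C D j k where
    bd: "\<And>x. \<bar>x\<bar> < 1 \<Longrightarrow> norm (f x) \<le> C * (1 + endpoint_log x) ^ j"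
        "\<And>x. \<bar>x\<bar> < 1 \<Longrightarrow> norm (g x) \<le> D * (1 + endpoint_log x) ^ k"
    unfolding log_bounded_def by blast
  have "norm (f x * g x) \<le> (C * D) * (1 + endpoint_log x) ^ (j + k)" if "\<bar>x\<bar> < 1" for x
    using mult_mono[OF bd(1)[OF that] bd(2)[OF that] order_trans[OF norm_ge_zero bd(1)[OF that]] norm_ge_zero]
    by (simp add: norm_mult power_add mult_ac)
  thus ?thesis using assms unfolding log_bounded_def
    by (auto intro!: continuous_intros)
qed

lemma log_bounded_add:
  assumes "log_bounded f" "log_bounded g"
  shows "log_bounded (\<lambda>x. f x + g x)"
proof -
  from assms obtain C D j k where
    bd: "\<And>x. \<bar>x\<bar> < 1 \<Longrightarrow> norm (f x) \<le> C * (1 + endpoint_log x) ^ j"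
        "\<And>x. \<bar>x\<bar> < 1 \<Longrightarrow> norm (g x) \<le> D * (1 + endpoint_log x) ^ k"
    unfolding log_bounded_def by blast
  have "norm (f x + g x) \<le> (\<bar>C\<bar> + \<bar>D\<bar>) * (1 + endpoint_log x) ^ (j + k)" if x: "\<bar>x\<bar> < 1" for x
  proof -
    have L: "1 \<le> 1 + endpoint_log x" using endpoint_log_pos[OF x] by simp
    have "norm (f x) \<le> \<bar>C\<bar> * (1 + endpoint_log x) ^ (j + k)"
      using L by (intro order_trans[OF bd(1)[OF x]] mult_mono power_increasing) auto
    moreover have "norm (g x) \<le> \<bar>D\<bar> * (1 + endpoint_log x) ^ (j + k)"
      using L by (intro order_trans[OF bd(2)[OF x]] mult_mono power_increasing) auto
    ultimately show ?thesis
      using norm_triangle_ineq[of "f x" "g x"] by (simp add: algebra_simps)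
  qed
  thus ?thesis using assms unfolding log_bounded_def
    by (auto intro!: continuous_intros)
qed

lemma log_bounded_minus: "log_bounded f \<Longrightarrow> log_bounded (\<lambda>x. - f x)"
  using log_bounded_mult[OF log_bounded_const[of "-1"], of f] by simp

lemma log_bounded_diff: "log_bounded f \<Longrightarrow> log_bounded g \<Longrightarrow> log_bounded (\<lambda>x. f x - g x)"
  using log_bounded_add[OF _ log_bounded_minus, of f g] by simp

lemma log_bounded_power: "log_bounded f \<Longrightarrow> log_bounded (\<lambda>x. f x ^ k)"
  by (induction k) (auto intro: log_bounded_const log_bounded_mult)

lemma log_bounded_reflect:
  assumes "log_bounded f"
  shows "log_bounded (\<lambda>x. f (- x))"
proof -
  from assms obtain C k where
    bd: "\<And>x. \<bar>x\<bar> < 1 \<Longrightarrow> norm (f x) \<le> C * (1 + endpoint_log x) ^ k"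
    unfolding log_bounded_def by blast
  have "norm (f (- x)) \<le> C * (1 + endpoint_log x) ^ k" if "\<bar>x\<bar> < 1" for x
    using bd[of "-x"] that by simp
  moreover have "continuous_on {-1<..<1} (\<lambda>x. f (- x))"
    using assms unfolding log_bounded_def
    by (intro continuous_on_compose2[of "{-1<..<1}" f "{-1<..<1}" uminus] continuous_intros) auto
  ultimately show ?thesis unfolding log_bounded_def by blast
qed

lemmas log_bounded_intros = log_bounded_const log_bounded_of_real log_bounded_mult log_bounded_add
  log_bounded_minus log_bounded_diff log_bounded_power

lemma log_bounded_legendre_P: "log_bounded (legendre_P \<mu>)"
proof -
  have "norm (legendre_P \<mu> x) \<le> (1 + legendre_bound \<mu>) * (1 + endpoint_log x) ^ 1" if "\<bar>x\<bar> < 1" for x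
  proof -
    have "1 + b * L \<le> (1 + b) * (1 + L) ^ 1" if "b \<ge> 0" "L > 0" for b L :: real
      using that by (simp add: algebra_simps)
    from this[OF legendre_bound_nonneg[of \<mu>] endpoint_log_pos[OF that]]
    show ?thesis using norm_legendre_P_le[OF that, of \<mu>] by (rule order_trans[rotated])
  qed
  thus ?thesis unfolding log_bounded_def using continuous_on_legendre_P by blast
qed

lemma log_bounded_legendre_flux: "log_bounded (legendre_flux \<mu>)"
proof -
  have "norm (legendre_flux \<mu> x) \<le> (2 * legendre_bound \<mu>) * (1 + endpoint_log x) ^ 0" if "\<bar>x\<bar> < 1" for x
    using norm_legendre_flux_le[OF that, of \<mu>] by simp
  thus ?thesis unfolding log_bounded_def using continuous_on_legendre_flux by blast
qed

lemma log_bounded_powr_bound: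
  assumes "log_bounded f" "0 < (\<epsilon>::real)"
  obtains K where "K \<ge> 0" "\<And>x. \<bar>x\<bar> < 1 \<Longrightarrow> norm (f x) \<le> K * (1 - x\<^sup>2) powr (- \<epsilon>)"
proof -
  from assms obtain C k where
    bd: "\<And>x. \<bar>x\<bar> < 1 \<Longrightarrow> norm (f x) \<le> C * (1 + endpoint_log x) ^ k"
    unfolding log_bounded_def by blast
  define a where "a = \<epsilon> / real (Suc k)"
  have a: "a > 0" "real k * a \<le> \<epsilon>" using assms(2) by (auto simp: a_def field_simps)
  define K where "K = \<bar>C\<bar> * (1 + 1 / a) ^ k * 4 powr \<epsilon>"
  show ?thesis
  proof (rule that[of K])
    show "K \<ge> 0" using a by (auto simp: K_def)
    fix x :: real assume x: "\<bar>x\<bar> < 1"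
    have L: "endpoint_log x > 0" using endpoint_log_pos[OF x] .
    have "(1 + endpoint_log x) ^ k \<le> ((1 + 1 / a) * exp (a * endpoint_log x)) ^ k"
      using L a by (intro power_mono one_plus_le_exp_scaled) auto
    also have "\<dots> = (1 + 1 / a) ^ k * exp ((real k * a) * endpoint_log x)"
      by (simp add: power_mult_distrib exp_of_nat_mult[symmetric] mult_ac)
    also have "\<dots> \<le> (1 + 1 / a) ^ k * exp (\<epsilon> * endpoint_log x)"
      using L a by (intro mult_left_mono) auto
    finally have *: "(1 + endpoint_log x) ^ k \<le> (1 + 1 / a) ^ k * exp (\<epsilon> * endpoint_log x)" .
    have "norm (f x) \<le> \<bar>C\<bar> * (1 + endpoint_log x) ^ k"
      using L by (intro order_trans[OF bd[OF x]] mult_right_mono) auto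
    also have "\<dots> \<le> \<bar>C\<bar> * ((1 + 1 / a) ^ k * exp (\<epsilon> * endpoint_log x))"
      using * by (intro mult_left_mono) auto
    finally show "norm (f x) \<le> K * (1 - x\<^sup>2) powr (- \<epsilon>)"
      unfolding K_def exp_endpoint_log[OF x] by (simp add: mult_ac)
  qed
qed

lemma set_integrable_endpoint_weight:
  assumes "log_bounded f" "Re s > -1"
  shows "set_integrable lborel {-1<..<1} (\<lambda>x. endpoint_weight s x * f x)"
proof -
  define \<epsilon> where "\<epsilon> = min 1 ((Re s + 1) / 2)"
  have \<epsilon>: "0 < \<epsilon>" "\<epsilon> \<le> 1" "\<epsilon> \<le> Re s + 1 - \<epsilon>"
    using assms(2) min.cobounded2[of 1 "(Re s + 1) / 2"] by (auto simp: \<epsilon>_def)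
  obtain K where K: "K \<ge> 0" "\<And>x. \<bar>x\<bar> < 1 \<Longrightarrow> norm (f x) \<le> K * (1 - x\<^sup>2) powr (- \<epsilon>)"
    using log_bounded_powr_bound[OF assms(1) \<epsilon>(1)] by blast
  show ?thesis
  proof (rule set_integrable_powr_bound)
    show "continuous_on {-1<..<1} (\<lambda>x. endpoint_weight s x * f x)"
      using assms(1) unfolding log_bounded_def by (intro continuous_intros continuous_on_endpoint_weight) auto
    fix x :: real assume x: "\<bar>x\<bar> < 1"
    note p = one_minus_square_pos[OF x]
    have "norm (endpoint_weight s x * f x) \<le> (1 - x\<^sup>2) powr Re s * (K * (1 - x\<^sup>2) powr (- \<epsilon>))"
      unfolding norm_mult norm_endpoint_weight[OF x] using K(2)[OF x] by (intro mult_left_mono) auto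
    also have "\<dots> = K * (1 - x\<^sup>2) powr (Re s - \<epsilon>)"
      by (simp add: powr_diff powr_minus field_simps)
    also have "\<dots> \<le> K * (1 - x\<^sup>2) powr (\<epsilon> - 1)"
      using p K(1) \<epsilon> by (intro mult_left_mono powr_mono') auto
    finally show "norm (endpoint_weight s x * f x) \<le> K * (1 - x\<^sup>2) powr (\<epsilon> - 1)" .
  qed (use \<epsilon> K in auto)
qed

lemma endpoint_weight_tendsto_0:
  assumes "log_bounded f" "Re s > 0" and F: "F = at_right (-1) \<or> F = at_left (1::real)"
  shows "((\<lambda>x. endpoint_weight s x * f x) \<longlongrightarrow> 0) F"
proof -
  define \<epsilon> where "\<epsilon> = Re s / 2"
  have \<epsilon>: "0 < \<epsilon>" "Re s - \<epsilon> = \<epsilon>" using assms(2) by (auto simp: \<epsilon>_def)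
  obtain K where K: "K \<ge> 0" "\<And>x. \<bar>x\<bar> < 1 \<Longrightarrow> norm (f x) \<le> K * (1 - x\<^sup>2) powr (- \<epsilon>)"
    using log_bounded_powr_bound[OF assms(1) \<epsilon>(1)] by blast
  have le: "norm (endpoint_weight s x * f x) \<le> K * (1 - x\<^sup>2) powr \<epsilon>" if x: "\<bar>x\<bar> < 1" for x
  proof -
    have "norm (endpoint_weight s x * f x) \<le> (1 - x\<^sup>2) powr Re s * (K * (1 - x\<^sup>2) powr (- \<epsilon>))"
      unfolding norm_mult norm_endpoint_weight[OF x] using K(2)[OF x] by (intro mult_left_mono) auto
    also have "\<dots> = K * (1 - x\<^sup>2) powr (Re s - \<epsilon>)"
      by (simp add: powr_diff powr_minus field_simps)
    finally show ?thesis unfolding \<epsilon> .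
  qed
  have "eventually (\<lambda>x. \<bar>x\<bar> < 1) F"
    using F eventually_at_right_real[of "-1" "1::real"] eventually_at_left_real[of "-1" "1::real"]
    by (auto elim: eventually_mono simp: abs_less_iff)
  hence ev: "eventually (\<lambda>x. norm (endpoint_weight s x * f x) \<le> K * (1 - x\<^sup>2) powr \<epsilon>) F"
    by (rule eventually_mono) (rule le)
  have c: "continuous_on {-1..1} (\<lambda>x. K * (1 - x\<^sup>2) powr \<epsilon>)"
    using \<epsilon> by (intro continuous_intros continuous_on_powr') (auto simp: abs_square_le_1 abs_le_iff)
  have "((\<lambda>x. K * (1 - x\<^sup>2) powr \<epsilon>) \<longlongrightarrow> 0) (at_right (-1))"
    using c[unfolded continuous_on_def, rule_format, of "-1"] by (simp add: at_within_Icc_at_right)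
  moreover have "((\<lambda>x. K * (1 - x\<^sup>2) powr \<epsilon>) \<longlongrightarrow> 0) (at_left 1)"
    using c[unfolded continuous_on_def, rule_format, of 1] by (simp add: at_within_Icc_at_left)
  ultimately have "((\<lambda>x. K * (1 - x\<^sup>2) powr \<epsilon>) \<longlongrightarrow> 0) F" using F by auto
  thus ?thesis by (rule Lim_null_comparison[OF ev])
qed

text \<open>The hypothesis says that \<open>p\<^sup>s\<^sup>-\<^sup>1 T\<close> is the derivative of \<open>p\<^sup>s Q\<close>, where \<open>p = 1 - x\<^sup>2\<close>: differentiating \<open>p\<^sup>s\<close>
produces the term \<open>- 2 s x p\<^sup>s\<^sup>-\<^sup>1 Q\<close>. Since \<open>Re s > 0\<close>, the power beats the logarithms in \<open>Q\<close> at both ends.\<close>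

lemma integral_exact_derivative_eq_0:
  assumes s: "Re s > 0" and Q: "log_bounded Q" and T: "log_bounded T"
    and D: "\<And>x. \<bar>x\<bar> < 1 \<Longrightarrow>
       (Q has_vector_derivative (T x + 2 * s * of_real x * Q x) / of_real (1 - x\<^sup>2)) (at x)"
  shows "(LBINT x:{-1<..<1}. endpoint_weight (s - 1) x * T x) = 0"
proof -
  have e: "einterval (ereal (-1)) (ereal 1) = {-1<..<1}" by auto
  have int: "set_integrable lborel {-1<..<1} (\<lambda>x. endpoint_weight (s - 1) x * T x)"
    using s T by (intro set_integrable_endpoint_weight) auto
  have cont: "continuous_on {-1<..<1} (\<lambda>x. endpoint_weight (s - 1) x * T x)"
    using T unfolding log_bounded_def by (intro continuous_intros continuous_on_endpoint_weight) auto
  have "(LBINT x=ereal (-1)..ereal 1. endpoint_weight (s - 1) x * T x) = 0 - 0"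
  proof (rule interval_integral_FTC_integrable)
    fix x :: real assume "ereal (-1) < ereal x" "ereal x < ereal 1"
    hence x: "\<bar>x\<bar> < 1" "x \<in> {-1<..<1}" by auto
    show "isCont (\<lambda>x. endpoint_weight (s - 1) x * T x) x"
      using cont x(2) by (simp add: continuous_on_eq_continuous_at)
    have p: "complex_of_real (1 - x\<^sup>2) \<noteq> 0"
      using one_minus_square_pos[OF x(1)] by (simp only: of_real_eq_0_iff)
    have "((\<lambda>x. endpoint_weight s x * Q x) has_vector_derivative
        endpoint_weight s x * ((T x + 2 * s * of_real x * Q x) / of_real (1 - x\<^sup>2))
        + (- (2 * s * of_real x) * endpoint_weight (s - 1) x) * Q x) (at x)"
      by (rule has_vector_derivative_mult[OF endpoint_weight_deriv[OF x(1)] D[OF x(1)]])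
    moreover have "endpoint_weight s x * ((T x + 2 * s * of_real x * Q x) / of_real (1 - x\<^sup>2))
        + (- (2 * s * of_real x) * endpoint_weight (s - 1) x) * Q x = endpoint_weight (s - 1) x * T x"
      using p unfolding endpoint_weight_succ[OF x(1), of s]
      by (simp only: times_divide_eq_right times_divide_eq_left) (simp add: divide_simps, simp add: algebra_simps)
    ultimately show "((\<lambda>x. endpoint_weight s x * Q x) has_vector_derivative endpoint_weight (s - 1) x * T x) (at x)"
      by simp
  next
    show "set_integrable lborel (einterval (ereal (-1)) (ereal 1)) (\<lambda>x. endpoint_weight (s - 1) x * T x)"
      unfolding e by (rule int)
    show "(((\<lambda>x. endpoint_weight s x * Q x) \<circ> real_of_ereal) \<longlongrightarrow> 0) (at_right (ereal (-1)))"
      using endpoint_weight_tendsto_0[OF Q s, of "at_right (-1)"] by (simp add: ereal_tendsto_simps1)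
    show "(((\<lambda>x. endpoint_weight s x * Q x) \<circ> real_of_ereal) \<longlongrightarrow> 0) (at_left (ereal 1))"
      using endpoint_weight_tendsto_0[OF Q s, of "at_left 1"] by (simp add: ereal_tendsto_simps1)
  qed simp
  thus ?thesis unfolding interval_lebesgue_integral_def e by simp
qed

section \<open>Cubic integrals related by the raising operator\<close>

text \<open>A solution of Legendre's equation together with its flux. The reflected function \<open>x \<mapsto> P\<^sub>\<mu>(-x)\<close>
solves the same equation, which is why the cubic identities are stated for arbitrary pairs.\<close>

definition legendre_pair :: "complex \<Rightarrow> (real \<Rightarrow> complex) \<Rightarrow> (real \<Rightarrow> complex) \<Rightarrow> bool" where
  "legendre_pair \<mu> f g \<longleftrightarrow> log_bounded f \<and> log_bounded g \<and>
     (\<forall>x. \<bar>x\<bar> < 1 \<longrightarrow> (f has_vector_derivative g x / of_real (1 - x\<^sup>2)) (at x) \<and>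
                    (g has_vector_derivative - (\<mu> * (\<mu> + 1)) * f x) (at x))"

lemma legendre_pair_P: "legendre_pair \<mu> (legendre_P \<mu>) (legendre_flux \<mu>)"
  unfolding legendre_pair_def
  using log_bounded_legendre_P log_bounded_legendre_flux legendre_P_deriv legendre_flux_deriv by blast

lemma legendre_pair_reflect:
  assumes "legendre_pair \<mu> f g"
  shows "legendre_pair \<mu> (\<lambda>x. f (- x)) (\<lambda>x. - g (- x))"
  unfolding legendre_pair_def
proof (intro conjI allI impI)
  show "log_bounded (\<lambda>x. f (- x))" "log_bounded (\<lambda>x. - g (- x))"
    using assms unfolding legendre_pair_def by (auto intro!: log_bounded_minus log_bounded_reflect)
  fix x :: real assume "\<bar>x\<bar> < 1"
  hence "\<bar>-x\<bar> < 1" by simp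
  hence D: "(f has_vector_derivative g (-x) / of_real (1 - (-x)\<^sup>2)) (at (-x))"
          "(g has_vector_derivative - (\<mu> * (\<mu> + 1)) * f (-x)) (at (-x))"
    using assms unfolding legendre_pair_def by blast+
  have m: "(uminus has_vector_derivative (-1 :: real)) (at x)"
    by (auto intro!: derivative_eq_intros simp flip: has_real_derivative_iff_has_vector_derivative)
  show "((\<lambda>x. f (- x)) has_vector_derivative - g (- x) / complex_of_real (1 - x\<^sup>2)) (at x)"
    using vector_diff_chain_at[OF m D(1)] by (simp add: o_def)
  show "((\<lambda>x. - g (- x)) has_vector_derivative - (\<mu> * (\<mu> + 1)) * f (- x)) (at x)"
    using has_vector_derivative_minus[OF vector_diff_chain_at[OF m D(2)]] by (simp add: o_def)
qed

text \<open>Here \<open>f\<close> and \<open>h\<close> have degree \<open>m - 1\<close>, and \<open>m x f - g\<close> is \<open>m\<close> times the raised solution of degree \<open>m\<close>. The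
function \<open>Q\<close> in the proof was found by equating coefficients for \<open>f = h\<close>, where the conditions on the four
polynomial coefficients of \<open>f\<^sup>3\<close>, \<open>f\<^sup>2 g\<close>, \<open>f g\<^sup>2\<close>, \<open>g\<^sup>3\<close> form a linear system with solution of degree at most
three; the version with two different solutions is its polarization.\<close>

lemma cubic_form_eq_raised_moment:
  assumes m: "Re m > 0" and fg: "legendre_pair (m - 1) f g" and hk: "legendre_pair (m - 1) h k"
  shows "(LBINT x:{-1<..<1}. endpoint_weight (m / 2 - 1) x *
           (3 * m ^ 4 * (f x ^ 2 * h x)
            - 8 * m * (of_real x * ((m * of_real x * f x - g x) ^ 2 * (m * of_real x * h x - k x))))) = 0"
proof (rule integral_exact_derivative_eq_0)
  let ?X = "complex_of_real"
  note lb = fg[unfolded legendre_pair_def] hk[unfolded legendre_pair_def]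
  define Q where "Q = (\<lambda>x. m ^ 3 * (3 * ?X x + 2 * ?X x ^ 3) * (f x ^ 2 * h x)
      - m ^ 2 * (1 + 2 * ?X x ^ 2) * (2 * (f x * g x * h x) + f x ^ 2 * k x)
      + 2 * m * ?X x * (g x ^ 2 * h x + 2 * (f x * g x * k x)) - 2 * (g x ^ 2 * k x))"
  show "log_bounded Q" unfolding Q_def by (intro log_bounded_intros) (use lb in auto)
  show "log_bounded (\<lambda>x. 3 * m ^ 4 * (f x ^ 2 * h x)
            - 8 * m * (of_real x * ((m * of_real x * f x - g x) ^ 2 * (m * of_real x * h x - k x))))"
    by (intro log_bounded_intros) (use lb in auto)
  fix x :: real assume x: "\<bar>x\<bar> < 1"
  define p where "p = complex_of_real (1 - x\<^sup>2)"
  have p: "p \<noteq> 0" using one_minus_square_pos[OF x] unfolding p_def by (simp only: of_real_eq_0_iff)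
  define F K where "F = g x / p" and "K = k x / p"
  have gk: "g x = (1 - ?X x ^ 2) * F" "k x = (1 - ?X x ^ 2) * K" 
    using p by (simp_all add: F_def K_def p_def)
  have D: "(f has_vector_derivative F) (at x)" "(g has_vector_derivative - ((m - 1) * m) * f x) (at x)"
          "(h has_vector_derivative K) (at x)" "(k has_vector_derivative - ((m - 1) * m) * h x) (at x)"
    using lb x unfolding F_def K_def p_def by auto
  have X: "(?X has_vector_derivative 1) (at x)"
    by (auto intro!: derivative_eq_intros has_vector_derivative_of_real)
  have p': "of_real (1 - x\<^sup>2) = 1 - ?X x ^ 2" by simp
  have "(Q has_vector_derivative (3 * m ^ 4 * (f x ^ 2 * h x)
            - 8 * m * (of_real x * ((m * of_real x * f x - g x) ^ 2 * (m * of_real x * h x - k x)))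
            + m * of_real x * Q x) / p) (at x)"
    unfolding Q_def power2_eq_square power3_eq_cube
    apply (rule has_vector_derivative_eq_rhs)
     apply (rule derivative_intros D X)+
    unfolding nonzero_eq_divide_eq[OF p] unfolding p_def p' gk of_real_1
    apply algebra
    done
  thus "(Q has_vector_derivative (3 * m ^ 4 * (f x ^ 2 * h x)
            - 8 * m * (of_real x * ((m * of_real x * f x - g x) ^ 2 * (m * of_real x * h x - k x)))
            + 2 * (m / 2) * of_real x * Q x) / of_real (1 - x\<^sup>2)) (at x)"
    by (simp add: p_def)
qed (use m in auto)


text \<open>The companion of the previous identity one degree higher: now \<open>f\<close> and \<open>h\<close> have degree \<open>m\<close>, the moment with
the factor \<open>x\<close> is on the side of the lower degree, and the weight on the raised side has gained a factor
\<open>1 - x\<^sup>2\<close>. Again \<open>Q\<close> solves the linear system for its coefficients, and is then polarized.\<close>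

lemma cubic_moment_eq_raised_form:
  assumes m: "Re m > 0" and fg: "legendre_pair m f g" and hk: "legendre_pair m h k"
  shows "(LBINT x:{-1<..<1}. endpoint_weight (m / 2 - 1) x *
           (8 * m ^ 4 * (of_real x * (f x ^ 2 * h x))
            + 192 * (m + 1) * (of_real (1 - x\<^sup>2) * ((((m + 1) * of_real x * f x - g x) ^ 2) * ((m + 1) * of_real x * h x - k x))))) = 0"
proof (rule integral_exact_derivative_eq_0)
  let ?X = "complex_of_real"
  note lb = fg[unfolded legendre_pair_def] hk[unfolded legendre_pair_def]
  define Q where "Q = (\<lambda>x.
      (48 * (m + 1) ^ 3 * ?X x ^ 4 + 3 * (24 * m ^ 3 + 40 * m ^ 2 + 16 * m) * ?X x ^ 2
         - (128 * m ^ 3 + 264 * m ^ 2 + 192 * m + 48)) * (f x ^ 2 * h x)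
      + ((40 * m ^ 2 + 96 * m + 48) * ?X x - 48 * (m + 1) ^ 2 * ?X x ^ 3) * (2 * (f x * g x * h x) + f x ^ 2 * k x)
      + (48 * (m + 1) * ?X x ^ 2 - (64 * m + 48)) * (g x ^ 2 * h x + 2 * (f x * g x * k x))
      - 48 * ?X x * (g x ^ 2 * k x))"
  have pl: "log_bounded (\<lambda>x. of_real (1 - x\<^sup>2))"
    unfolding of_real_diff of_real_power by (intro log_bounded_intros)
  show "log_bounded Q" unfolding Q_def by (intro log_bounded_intros) (use lb in auto)
  show "log_bounded (\<lambda>x. 8 * m ^ 4 * (of_real x * (f x ^ 2 * h x))
            + 192 * (m + 1) * (of_real (1 - x\<^sup>2) * ((((m + 1) * of_real x * f x - g x) ^ 2) * ((m + 1) * of_real x * h x - k x))))"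
    by (intro log_bounded_intros pl) (use lb in auto)
  fix x :: real assume x: "\<bar>x\<bar> < 1"
  define p where "p = complex_of_real (1 - x\<^sup>2)"
  have p: "p \<noteq> 0" using one_minus_square_pos[OF x] unfolding p_def by (simp only: of_real_eq_0_iff)
  define F K where "F = g x / p" and "K = k x / p"
  have gk: "g x = (1 - ?X x ^ 2) * F" "k x = (1 - ?X x ^ 2) * K" 
    using p by (simp_all add: F_def K_def p_def)
  have D: "(f has_vector_derivative F) (at x)" "(g has_vector_derivative - (m * (m + 1)) * f x) (at x)"
          "(h has_vector_derivative K) (at x)" "(k has_vector_derivative - (m * (m + 1)) * h x) (at x)"
    using lb x unfolding F_def K_def p_def by auto
  have X: "(?X has_vector_derivative 1) (at x)"
    by (auto intro!: derivative_eq_intros has_vector_derivative_of_real)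
  have p': "of_real (1 - x\<^sup>2) = 1 - ?X x ^ 2" by simp
  have "(Q has_vector_derivative (8 * m ^ 4 * (of_real x * (f x ^ 2 * h x))
            + 192 * (m + 1) * (of_real (1 - x\<^sup>2) * ((((m + 1) * of_real x * f x - g x) ^ 2) * ((m + 1) * of_real x * h x - k x)))
            + m * of_real x * Q x) / p) (at x)"
    unfolding Q_def power2_eq_square[of "f x" for x] power2_eq_square[of "g x" for x] power2_eq_square[of "?X x" for x]
       power3_eq_cube[of "?X x" for x] power4_eq_xxxx[of "?X x" for x]
    apply (rule has_vector_derivative_eq_rhs)
     apply (rule derivative_intros D X)+
    unfolding nonzero_eq_divide_eq[OF p] unfolding p_def p' gk of_real_1
    apply algebra
    done
  thus "(Q has_vector_derivative (8 * m ^ 4 * (of_real x * (f x ^ 2 * h x))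
            + 192 * (m + 1) * (of_real (1 - x\<^sup>2) * ((((m + 1) * of_real x * f x - g x) ^ 2) * ((m + 1) * of_real x * h x - k x)))
            + 2 * (m / 2) * of_real x * Q x) / of_real (1 - x\<^sup>2)) (at x)"
    by (simp add: p_def)
qed (use m in auto)

text \<open>The sign in the reflected case comes from \<open>x \<mapsto> -x\<close> reversing both terms of the raising operator.
It is the source of the minus signs in the identities for \<open>P\<^sub>\<nu>(x)\<^sup>2 P\<^sub>\<nu>(-x)\<close>.\<close>

lemma legendre_raise:
  assumes "\<bar>x\<bar> < 1" "m \<noteq> 0"
  shows "m * of_real x * legendre_P (m - 1) x - legendre_flux (m - 1) x = m * legendre_P m x"
    and "m * of_real x * legendre_P (m - 1) (- x) - (- legendre_flux (m - 1) (- x)) = - (m * legendre_P m (- x))"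
proof -
  have *: "m * of_real y * legendre_P (m - 1) y - legendre_flux (m - 1) y = m * legendre_P m y" if "\<bar>y\<bar> < 1" for y
    using legendre_P_ladder[OF that, of "m - 1"] assms(2) by (simp add: field_simps)
  show "m * of_real x * legendre_P (m - 1) x - legendre_flux (m - 1) x = m * legendre_P m x"
    by (rule *) (use assms in auto)
  show "m * of_real x * legendre_P (m - 1) (- x) - (- legendre_flux (m - 1) (- x)) = - (m * legendre_P m (- x))"
    using *[of "-x"] assms(1) unfolding abs_minus_cancel of_real_minus by algebra
qed

lemma triple_integral_eq_moment:
  assumes m: "Re m > 0"
  shows "(LBINT x:{-1<..<1}. endpoint_weight (m / 2 - 1) x * ((legendre_P (m - 1) x)\<^sup>2 * legendre_P (m - 1) (- x)))
    = - (8 / 3) * (LBINT x:{-1<..<1}. endpoint_weight (m / 2 - 1) x * (of_real x * ((legendre_P m x)\<^sup>2 * legendre_P m (- x))))"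
    (is "?I = _ * ?J")
proof -
  have m0: "m \<noteq> 0" using m by auto
  have int: "set_integrable lborel {-1<..<1} (\<lambda>x. endpoint_weight (m / 2 - 1) x * ((legendre_P (m - 1) x)\<^sup>2 * legendre_P (m - 1) (- x)))"
            "set_integrable lborel {-1<..<1} (\<lambda>x. endpoint_weight (m / 2 - 1) x * (of_real x * ((legendre_P m x)\<^sup>2 * legendre_P m (- x))))"
    using m by (auto intro!: set_integrable_endpoint_weight log_bounded_intros log_bounded_legendre_P log_bounded_reflect)
  have "0 = (LBINT x:{-1<..<1}. 3 * m ^ 4 * (endpoint_weight (m / 2 - 1) x * ((legendre_P (m - 1) x)\<^sup>2 * legendre_P (m - 1) (- x)))
     + 8 * m ^ 4 * (endpoint_weight (m / 2 - 1) x * (of_real x * ((legendre_P m x)\<^sup>2 * legendre_P m (- x)))))"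
    unfolding cubic_form_eq_raised_moment[OF m legendre_pair_P legendre_pair_reflect[OF legendre_pair_P], symmetric]
  proof (rule set_lebesgue_integral_cong, goal_cases)
    case 2
    show ?case
    proof (intro allI impI)
      fix x :: real assume "x \<in> {-1<..<1}"
      hence x: "\<bar>x\<bar> < 1" by auto
      show "endpoint_weight (m / 2 - 1) x * (3 * m ^ 4 * ((legendre_P (m - 1) x)\<^sup>2 * legendre_P (m - 1) (- x))
            - 8 * m * (of_real x * ((m * of_real x * legendre_P (m - 1) x - legendre_flux (m - 1) x)\<^sup>2
                * (m * of_real x * legendre_P (m - 1) (- x) - (- legendre_flux (m - 1) (- x))))))
         = 3 * m ^ 4 * (endpoint_weight (m / 2 - 1) x * ((legendre_P (m - 1) x)\<^sup>2 * legendre_P (m - 1) (- x)))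
           + 8 * m ^ 4 * (endpoint_weight (m / 2 - 1) x * (of_real x * ((legendre_P m x)\<^sup>2 * legendre_P m (- x))))"
        unfolding legendre_raise[OF x m0] by algebra
    qed
  qed auto
  also have "\<dots> = 3 * m ^ 4 * ?I + 8 * m ^ 4 * ?J"
    using int by (subst set_integral_add) auto
  also have "\<dots> = m ^ 4 * (3 * ?I + 8 * ?J)" by (simp add: algebra_simps)
  finally have "3 * ?I + 8 * ?J = 0" using m0 by simp
  thus ?thesis by (simp add: field_simps add_eq_0_iff)
qed

lemma cube_integral_eq_moment:
  assumes m: "Re m > 0"
  shows "(LBINT x:{-1<..<1}. endpoint_weight (m / 2 - 1) x * (legendre_P (m - 1) x) ^ 3)
    = 8 / 3 * (LBINT x:{-1<..<1}. endpoint_weight (m / 2 - 1) x * (of_real x * (legendre_P m x) ^ 3))"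
    (is "?I = _ * ?J")
proof -
  have m0: "m \<noteq> 0" using m by auto
  have int: "set_integrable lborel {-1<..<1} (\<lambda>x. endpoint_weight (m / 2 - 1) x * (legendre_P (m - 1) x) ^ 3)"
            "set_integrable lborel {-1<..<1} (\<lambda>x. endpoint_weight (m / 2 - 1) x * (of_real x * (legendre_P m x) ^ 3))"
    using m by (auto intro!: set_integrable_endpoint_weight log_bounded_intros log_bounded_legendre_P)
  have "0 = (LBINT x:{-1<..<1}. 3 * m ^ 4 * (endpoint_weight (m / 2 - 1) x * (legendre_P (m - 1) x) ^ 3)
     - 8 * m ^ 4 * (endpoint_weight (m / 2 - 1) x * (of_real x * (legendre_P m x) ^ 3)))"
    unfolding cubic_form_eq_raised_moment[OF m legendre_pair_P legendre_pair_P, symmetric]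
  proof (rule set_lebesgue_integral_cong, goal_cases)
    case 2
    show ?case
    proof (intro allI impI)
      fix x :: real assume "x \<in> {-1<..<1}"
      hence x: "\<bar>x\<bar> < 1" by auto
      show "endpoint_weight (m / 2 - 1) x * (3 * m ^ 4 * ((legendre_P (m - 1) x)\<^sup>2 * legendre_P (m - 1) x)
            - 8 * m * (of_real x * ((m * of_real x * legendre_P (m - 1) x - legendre_flux (m - 1) x)\<^sup>2
                * (m * of_real x * legendre_P (m - 1) x - legendre_flux (m - 1) x))))
         = 3 * m ^ 4 * (endpoint_weight (m / 2 - 1) x * (legendre_P (m - 1) x) ^ 3)
           - 8 * m ^ 4 * (endpoint_weight (m / 2 - 1) x * (of_real x * (legendre_P m x) ^ 3))"
        unfolding legendre_raise[OF x m0] by algebra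
    qed
  qed auto
  also have "\<dots> = 3 * m ^ 4 * ?I - 8 * m ^ 4 * ?J"
    using int by (subst set_integral_diff) auto
  also have "\<dots> = m ^ 4 * (3 * ?I - 8 * ?J)" by (simp add: algebra_simps)
  finally have "3 * ?I - 8 * ?J = 0" using m0 by simp
  thus ?thesis by (simp add: field_simps)
qed

lemma triple_integral_raise_moment:
  assumes m: "Re m > 0"
  shows "m ^ 4 * (LBINT x:{-1<..<1}. endpoint_weight (m / 2 - 1) x * (of_real x * ((legendre_P m x)\<^sup>2 * legendre_P m (- x))))
    = 24 * (m + 1) ^ 4 * (LBINT x:{-1<..<1}. endpoint_weight (m / 2) x * ((legendre_P (m + 1) x)\<^sup>2 * legendre_P (m + 1) (- x)))"
    (is "_ * ?J = _ * ?K")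
proof -
  have m0: "m + 1 \<noteq> 0" using m by (auto simp: complex_eq_iff)
  have int: "set_integrable lborel {-1<..<1} (\<lambda>x. endpoint_weight (m / 2) x * ((legendre_P (m + 1) x)\<^sup>2 * legendre_P (m + 1) (- x)))"
            "set_integrable lborel {-1<..<1} (\<lambda>x. endpoint_weight (m / 2 - 1) x * (of_real x * ((legendre_P m x)\<^sup>2 * legendre_P m (- x))))"
    using m by (auto intro!: set_integrable_endpoint_weight log_bounded_intros log_bounded_legendre_P log_bounded_reflect)
  have "0 = (LBINT x:{-1<..<1}. 8 * m ^ 4 * (endpoint_weight (m / 2 - 1) x * (of_real x * ((legendre_P m x)\<^sup>2 * legendre_P m (- x))))
     - 192 * (m + 1) ^ 4 * (endpoint_weight (m / 2) x * ((legendre_P (m + 1) x)\<^sup>2 * legendre_P (m + 1) (- x))))"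
    unfolding cubic_moment_eq_raised_form[OF m legendre_pair_P legendre_pair_reflect[OF legendre_pair_P], symmetric]
  proof (rule set_lebesgue_integral_cong, goal_cases)
    case 2
    show ?case
    proof (intro allI impI)
      fix x :: real assume "x \<in> {-1<..<1}"
      hence x: "\<bar>x\<bar> < 1" by auto
      note R = legendre_raise[OF x m0, simplified add_diff_cancel_right']
      show "endpoint_weight (m / 2 - 1) x * (8 * m ^ 4 * (of_real x * ((legendre_P m x)\<^sup>2 * legendre_P m (- x)))
            + 192 * (m + 1) * (of_real (1 - x\<^sup>2) * (((m + 1) * of_real x * legendre_P m x - legendre_flux m x)\<^sup>2
                * ((m + 1) * of_real x * legendre_P m (- x) - (- legendre_flux m (- x))))))
         = 8 * m ^ 4 * (endpoint_weight (m / 2 - 1) x * (of_real x * ((legendre_P m x)\<^sup>2 * legendre_P m (- x))))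
           - 192 * (m + 1) ^ 4 * (endpoint_weight (m / 2) x * ((legendre_P (m + 1) x)\<^sup>2 * legendre_P (m + 1) (- x)))"
        unfolding R endpoint_weight_succ[OF x, of "m / 2"] by algebra
    qed
  qed auto
  also have "\<dots> = 8 * m ^ 4 * ?J - 192 * (m + 1) ^ 4 * ?K"
    using int by (subst set_integral_diff) auto
  finally show ?thesis by (simp add: algebra_simps)
qed

section \<open>The triple integral as a holomorphic function of the degree\<close>

text \<open>Differentiation under the integral sign without any hypothesis on the derivative: by Cauchy's inequality on a
smaller disc, the local bound \<open>g\<close> also dominates the difference quotients.\<close>

lemma holomorphic_on_lebesgue_integral:
  fixes f :: "complex \<Rightarrow> 'a \<Rightarrow> complex"
  assumes S: "open S"
    and hol: "\<And>x. x \<in> space M \<Longrightarrow> (\<lambda>z. f z x) holomorphic_on S"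
    and meas: "\<And>z. z \<in> S \<Longrightarrow> f z \<in> borel_measurable M"
    and dom: "\<And>z. z \<in> S \<Longrightarrow> \<exists>r>0. \<exists>g. integrable M g \<and> ball z r \<subseteq> S \<and>
                (\<forall>w\<in>ball z r. \<forall>x\<in>space M. norm (f w x) \<le> g x)"
  shows "(\<lambda>z. integral\<^sup>L M (f z)) holomorphic_on S"
  unfolding holomorphic_on_open[OF S]
proof
  fix z assume z: "z \<in> S"
  from dom[OF z] obtain r g where r: "r > 0" and g: "integrable M g" and sub: "ball z r \<subseteq> S"
    and bd: "\<And>w x. w \<in> ball z r \<Longrightarrow> x \<in> space M \<Longrightarrow> norm (f w x) \<le> g x" by blast
  define B where "B = ball z (r / 2)"
  have zB: "z \<in> B" and B: "open B" "convex B" "B \<subseteq> S" using r sub by (auto simp: B_def)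
  define f' where "f' = (\<lambda>w x. deriv (\<lambda>z. f z x) w)"
  have der: "((\<lambda>z. f z x) has_field_derivative f' w x) (at w)" if "w \<in> S" "x \<in> space M" for w x
    using holomorphic_derivI[OF hol[OF that(2)] S that(1)] by (simp add: f'_def)
  have derbd: "norm (f' w x) \<le> 4 / r * g x" if w: "w \<in> B" and x: "x \<in> space M" for w x
  proof -
    have c: "cball w (r / 4) \<subseteq> ball z r"
    proof
      fix v assume "v \<in> cball w (r / 4)"
      thus "v \<in> ball z r" using w r dist_triangle[of z v w] by (auto simp: B_def)
    qed
    have h: "(\<lambda>z. f z x) holomorphic_on cball w (r / 4)"
      using holomorphic_on_subset[OF hol[OF x]] c sub by blast
    have "norm ((deriv ^^ 1) (\<lambda>z. f z x) w) \<le> fact 1 * g x / (r / 4) ^ 1"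
    proof (rule Cauchy_inequality)
      show "(\<lambda>z. f z x) holomorphic_on ball w (r / 4)"
        by (rule holomorphic_on_subset[OF h]) auto
      show "continuous_on (cball w (r / 4)) (\<lambda>z. f z x)"
        by (rule holomorphic_on_imp_continuous_on[OF h])
      fix v assume "norm (w - v) = r / 4"
      hence "v \<in> ball z r" using c by (auto simp: dist_norm)
      thus "norm (f v x) \<le> g x" using bd x by blast
    qed (use r in auto)
    thus ?thesis by (simp add: f'_def mult_ac)
  qed
  have lip: "norm (f w x - f z x) \<le> 4 / r * g x * norm (w - z)" if "w \<in> B" "x \<in> space M" for w x
  proof (rule field_differentiable_bound[OF B(2)])
    show "((\<lambda>z. f z x) has_field_derivative f' v x) (at v within B)" if "v \<in> B" for v
      using der[of v x] B(3) that \<open>x \<in> space M\<close> has_field_derivative_at_within by blast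
  qed (use derbd that zB in auto)
  have int: "integrable M (f w)" if "w \<in> ball z r" for w
    by (rule Bochner_Integration.integrable_bound[OF g meas]) (use bd that sub in \<open>auto intro!: order_trans[OF _ abs_ge_self]\<close>)
  have Bsub: "B \<subseteq> ball z r" using r by (auto simp: B_def)
  have "((\<lambda>w. (integral\<^sup>L M (f w) - integral\<^sup>L M (f z)) / (w - z)) \<longlongrightarrow> integral\<^sup>L M (f' z)) (at z within B)"
    unfolding tendsto_at_iff_sequentially
  proof (intro allI impI)
    fix X :: "nat \<Rightarrow> complex" assume X: "\<forall>i. X i \<in> B - {z}" "X \<longlonglongrightarrow> z"
    have f'lim: "(\<lambda>i. (f (X i) x - f z x) / (X i - z)) \<longlonglongrightarrow> f' z x" if "x \<in> space M" for x
    proof -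
      have "((\<lambda>w. (f w x - f z x) / (w - z)) \<longlongrightarrow> f' z x) (at z within B)"
        using has_field_derivative_at_within[OF der[OF z that], of B]
        unfolding has_field_derivative_iff .
      thus ?thesis using X unfolding tendsto_at_iff_sequentially by (auto simp: o_def)
    qed
    have quot: "(\<lambda>x. (f (X i) x - f z x) / (X i - z)) \<in> borel_measurable M" for i
      using X(1) B(3) z by (intro borel_measurable_divide borel_measurable_diff meas borel_measurable_const) auto
    have f'meas: "f' z \<in> borel_measurable M"
      by (rule borel_measurable_LIMSEQ_metric[OF quot f'lim])
    have "(\<lambda>i. integral\<^sup>L M (\<lambda>x. (f (X i) x - f z x) / (X i - z))) \<longlonglongrightarrow> integral\<^sup>L M (f' z)"
    proof (rule integral_dominated_convergence)
      show "f' z \<in> borel_measurable M" by fact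
      show "(\<lambda>x. (f (X i) x - f z x) / (X i - z)) \<in> borel_measurable M" for i by fact
      show "integrable M (\<lambda>x. 4 / r * g x)" using g by simp
      show "AE x in M. (\<lambda>i. (f (X i) x - f z x) / (X i - z)) \<longlonglongrightarrow> f' z x"
        using f'lim by (intro AE_I2) auto
      show "AE x in M. norm ((f (X i) x - f z x) / (X i - z)) \<le> 4 / r * g x" for i
      proof (rule AE_I2)
        fix x assume "x \<in> space M"
        with lip[of "X i" x] X(1) show "norm ((f (X i) x - f z x) / (X i - z)) \<le> 4 / r * g x"
          by (auto simp: norm_divide divide_le_eq)
      qed
    qed
    moreover have quot_int: "integral\<^sup>L M (\<lambda>x. (f (X i) x - f z x) / (X i - z))
        = (integral\<^sup>L M (f (X i)) - integral\<^sup>L M (f z)) / (X i - z)" for i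
      using X(1) Bsub r by (subst integral_divide_zero, subst Bochner_Integration.integral_diff) (auto intro!: int)
    ultimately show "((\<lambda>w. (integral\<^sup>L M (f w) - integral\<^sup>L M (f z)) / (w - z)) \<circ> X)
        \<longlonglongrightarrow> integral\<^sup>L M (f' z)" unfolding o_def by (simp only: quot_int)
  qed
  hence "((\<lambda>z. integral\<^sup>L M (f z)) has_field_derivative integral\<^sup>L M (f' z)) (at z within B)"
    unfolding has_field_derivative_iff .
  thus "\<exists>f'. ((\<lambda>z. integral\<^sup>L M (f z)) has_field_derivative f') (at z)"
    unfolding at_within_open[OF zB B(1)] by blast
qed

definition triple_integrand :: "complex \<Rightarrow> real \<Rightarrow> complex" where
  "triple_integrand \<nu> x = endpoint_weight ((\<nu> - 1) / 2) x * ((legendre_P \<nu> x)\<^sup>2 * legendre_P \<nu> (- x))"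

definition triple_integral :: "complex \<Rightarrow> complex" where
  "triple_integral \<nu> = (LBINT x:{-1<..<1}. triple_integrand \<nu> x)"

lemma continuous_on_triple_integrand: "continuous_on {-1<..<1} (triple_integrand \<nu>)"
proof -
  have "continuous_on {-1<..<1} (\<lambda>x. legendre_P \<nu> (- x))"
    by (intro continuous_on_compose2[OF continuous_on_legendre_P] continuous_intros) auto
  thus ?thesis unfolding triple_integrand_def[abs_def]
    by (intro continuous_intros continuous_on_endpoint_weight continuous_on_legendre_P)
qed

text \<open>The bound is uniform as \<open>\<eta> \<rightarrow> 0\<close> provided that the Legendre bound is \<open>O(\<eta>)\<close>: the combination
\<open>1 + \<eta> endpoint_log x\<close> costs only a fixed fraction of the exponent \<open>\<eta> / 2 - 1\<close> available from the weight.
The number 4394 is \<open>2 \<cdot> 13\<^sup>3\<close>.\<close>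

lemma norm_triple_integrand_le:
  assumes x: "\<bar>x\<bar> < 1" and \<eta>: "0 < \<eta>" "\<eta> \<le> 1" "\<eta> \<le> Re \<nu> + 1" and K: "K \<ge> 0" "legendre_bound \<nu> \<le> K * \<eta>"
  shows "norm (triple_integrand \<nu> x) \<le> 4394 * (1 + K) ^ 3 * (1 - x\<^sup>2) powr (\<eta> / 4 - 1)"
proof -
  define L where "L = endpoint_log x"
  note p = one_minus_square_pos[OF x]
  have L: "L > 0" using endpoint_log_pos[OF x] by (simp add: L_def)
  define e where "e = (1 + K) * (13 * exp (\<eta> * L / 12))"
  have P: "norm (legendre_P \<nu> y) \<le> e" if "y = x \<or> y = -x" for y
  proof -
    have y: "\<bar>y\<bar> < 1" "endpoint_log y = L" using x that by (auto simp: L_def)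
    \<comment> \<open>the scale 1/12 is chosen so that the cube of the exponential is \<open>exp (\<eta> L / 4)\<close>, half of what the weight affords\<close>
    have "norm (legendre_P \<nu> y) \<le> 1 + legendre_bound \<nu> * L"
      using norm_legendre_P_le[OF y(1), of \<nu>] y(2) by simp
    also have "\<dots> \<le> 1 + (K * \<eta>) * L" using K L by (intro add_left_mono mult_right_mono) auto
    also have "\<dots> \<le> (1 + K) * (1 + \<eta> * L)" using K L \<eta> by (simp add: algebra_simps)
    also have "\<dots> \<le> (1 + K) * ((1 + 1 / (1/12)) * exp (1/12 * (\<eta> * L)))"
      using K L \<eta> by (intro mult_left_mono one_plus_le_exp_scaled) auto
    finally show ?thesis by (simp add: e_def)
  qed
  have "e ^ 3 = 2197 * (1 + K) ^ 3 * exp (\<eta> / 4 * L)"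
    by (simp add: e_def power_mult_distrib exp_of_nat_mult[symmetric] mult_ac)
  also have "exp (\<eta> / 4 * L) = 4 powr (\<eta> / 4) * (1 - x\<^sup>2) powr (- (\<eta> / 4))"
    unfolding L_def by (rule exp_endpoint_log[OF x])
  also have "4 powr (\<eta> / 4) \<le> (2::real)"
  proof -
    have "4 powr (\<eta> / 4) \<le> 4 powr (1 / 2 :: real)" using \<eta> by (intro powr_mono) auto
    also have "\<dots> = 2" by (simp add: powr_half_sqrt)
    finally show ?thesis .
  qed
  hence "2197 * (1 + K) ^ 3 * (4 powr (\<eta> / 4) * (1 - x\<^sup>2) powr (- (\<eta> / 4)))
      \<le> 2197 * (1 + K) ^ 3 * (2 * (1 - x\<^sup>2) powr (- (\<eta> / 4)))"
    using K by (intro mult_left_mono mult_right_mono) auto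
  finally have e3: "e ^ 3 \<le> 4394 * (1 + K) ^ 3 * (1 - x\<^sup>2) powr (- (\<eta> / 4))" by simp
  have e0: "e \<ge> 0" using K by (simp add: e_def)
  have "norm ((legendre_P \<nu> x)\<^sup>2 * legendre_P \<nu> (- x)) \<le> e ^ 2 * e"
    unfolding norm_mult norm_power using P e0 by (intro mult_mono power_mono) auto
  also have "\<dots> = e ^ 3" by (simp add: power2_eq_square power3_eq_cube)
  also note e3
  finally have A: "norm ((legendre_P \<nu> x)\<^sup>2 * legendre_P \<nu> (- x)) \<le> 4394 * (1 + K) ^ 3 * (1 - x\<^sup>2) powr (- (\<eta> / 4))" .
  have "norm (endpoint_weight ((\<nu> - 1) / 2) x) = (1 - x\<^sup>2) powr ((Re \<nu> - 1) / 2)" by (simp add: norm_endpoint_weight[OF x])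
  also have "\<dots> \<le> (1 - x\<^sup>2) powr (\<eta> / 2 - 1)" using p \<eta> by (intro powr_mono') auto
  finally have "norm (triple_integrand \<nu> x) \<le> (1 - x\<^sup>2) powr (\<eta> / 2 - 1) * (4394 * (1 + K) ^ 3 * (1 - x\<^sup>2) powr (- (\<eta> / 4)))"
    unfolding triple_integrand_def norm_mult[of "endpoint_weight ((\<nu> - 1) / 2) x"] by (intro mult_mono A) auto
  also have "\<dots> = 4394 * (1 + K) ^ 3 * ((1 - x\<^sup>2) powr (\<eta> / 2 - 1) * (1 - x\<^sup>2) powr (- (\<eta> / 4)))"
    by simp
  also have "(1 - x\<^sup>2) powr (\<eta> / 2 - 1) * (1 - x\<^sup>2) powr (- (\<eta> / 4)) = (1 - x\<^sup>2) powr (\<eta> / 4 - 1)"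
    unfolding powr_add[symmetric] by (rule arg_cong2[where f = "(powr)"]) (auto simp: field_simps)
  finally show ?thesis .
qed

lemma triple_integrand_holomorphic:
  assumes x: "\<bar>x\<bar> < 1"
  shows "(\<lambda>\<nu>. triple_integrand \<nu> x) holomorphic_on S"
proof -
  have P: "(\<lambda>\<mu>. legendre_P \<mu> y) holomorphic_on S" if "\<bar>y\<bar> < 1" for y
    using legendre_P_holomorphic[OF that] holomorphic_on_subset by blast
  have "complex_of_real (1 - x\<^sup>2) \<noteq> 0"
    using one_minus_square_pos[OF x] by (simp only: of_real_eq_0_iff)
  thus ?thesis unfolding triple_integrand_def endpoint_weight_def powr_def using x
    by (auto intro!: holomorphic_intros P simp del: of_real_diff of_real_power)
qed

lemma triple_integral_holomorphic: "triple_integral holomorphic_on {\<nu>. Re \<nu> > -1}"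
proof -
  have op: "open {\<nu>. Re \<nu> > -1}" by (simp add: open_halfspace_Re_gt)
  have "(\<lambda>\<nu>. integral\<^sup>L lborel (\<lambda>x. indicator {-1<..<1} x *\<^sub>R triple_integrand \<nu> x))
          holomorphic_on {\<nu>. Re \<nu> > -1}"
  proof (rule holomorphic_on_lebesgue_integral[OF op])
    show "(\<lambda>\<nu>. indicator {-1<..<1} x *\<^sub>R triple_integrand \<nu> x) holomorphic_on {\<nu>. Re \<nu> > -1}" for x :: real
    proof (cases "x \<in> {-1<..<1}")
      case True
      thus ?thesis using triple_integrand_holomorphic[of x] by (auto simp: abs_less_iff)
    qed simp
    show "(\<lambda>x. indicator {-1<..<1} x *\<^sub>R triple_integrand \<nu> x) \<in> borel_measurable lborel" for \<nu>
      using borel_measurable_continuous_on_indicator[OF _ continuous_on_triple_integrand[of \<nu>]] by simp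
    fix \<nu> :: complex assume "\<nu> \<in> {\<nu>. Re \<nu> > -1}"
    hence nu: "Re \<nu> > -1" by simp
    define \<eta> where "\<eta> = min 1 ((Re \<nu> + 1) / 2)"
    have \<eta>: "0 < \<eta>" "\<eta> \<le> 1" "\<eta> \<le> (Re \<nu> + 1) / 2" using nu unfolding \<eta>_def by (auto simp: min_def)
    have "compact (legendre_bound ` cball \<nu> \<eta>)"
      by (intro compact_continuous_image continuous_on_legendre_bound) auto
    hence "bounded (legendre_bound ` cball \<nu> \<eta>)" by (rule compact_imp_bounded)
    then obtain B where B: "\<And>w. w \<in> cball \<nu> \<eta> \<Longrightarrow> norm (legendre_bound w) \<le> B"
      by (metis bounded_iff imageI)
    define K where "K = B / \<eta>"
    have "0 \<le> B" using order_trans[OF norm_ge_zero B[of \<nu>]] \<eta> by simp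
    hence K: "K \<ge> 0" "B = K * \<eta>" using \<eta> by (auto simp: K_def)
    define g where "g = (\<lambda>x::real. indicator {-1<..<1} x *\<^sub>R (4394 * (1 + K) ^ 3 * (1 - x\<^sup>2) powr (\<eta> / 4 - 1)))"
    have R: "Re w \<ge> Re \<nu> - \<eta>" "w \<in> cball \<nu> \<eta>" if "w \<in> ball \<nu> \<eta>" for w
      using that abs_Re_le_cmod[of "\<nu> - w"] by (auto simp: dist_norm)
    have "integrable lborel g"
    proof -
      have "set_integrable lborel {-1<..<1} (\<lambda>x. complex_of_real (4394 * (1 + K) ^ 3 * (1 - x\<^sup>2) powr (\<eta> / 4 - 1)))"
      proof (rule set_integrable_powr_bound[where K = "4394 * (1 + K) ^ 3" and \<delta> = "\<eta> / 4"])
        show "continuous_on {-1<..<1} (\<lambda>x. complex_of_real (4394 * (1 + K) ^ 3 * (1 - x\<^sup>2) powr (\<eta> / 4 - 1)))"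
          by (intro continuous_intros) (auto simp: abs_square_eq_1)
        show "norm (complex_of_real (4394 * (1 + K) ^ 3 * (1 - x\<^sup>2) powr (\<eta> / 4 - 1)))
            \<le> 4394 * (1 + K) ^ 3 * (1 - x\<^sup>2) powr (\<eta> / 4 - 1)" for x
          unfolding norm_of_real using K by simp
      qed (use K \<eta> in auto)
      hence "integrable lborel (\<lambda>x. complex_of_real (g x))"
        unfolding set_integrable_def g_def by (simp add: scaleR_conv_of_real)
      thus ?thesis using integrable_Re by fastforce
    qed
    moreover have "ball \<nu> \<eta> \<subseteq> {\<nu>. Re \<nu> > -1}"
      using R(1) \<eta> nu by force
    moreover have "norm (indicator {-1<..<1} x *\<^sub>R triple_integrand w x) \<le> g x" if "w \<in> ball \<nu> \<eta>" for w x
    proof (cases "x \<in> {-1<..<1}")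
      case True
      have "norm (triple_integrand w x) \<le> 4394 * (1 + K) ^ 3 * (1 - x\<^sup>2) powr (\<eta> / 4 - 1)"
        using True R[OF that] \<eta> K B[OF R(2)[OF that]] by (intro norm_triple_integrand_le) auto
      thus ?thesis using True by (simp add: g_def)
    qed (simp add: g_def)
    ultimately show "\<exists>r>0. \<exists>g. integrable lborel g \<and> ball \<nu> r \<subseteq> {\<nu>. - 1 < Re \<nu>} \<and>
       (\<forall>w\<in>ball \<nu> r. \<forall>x\<in>space lborel. norm (indicat_real {- 1<..<1} x *\<^sub>R triple_integrand w x) \<le> g x)"
      using \<eta>(1) by blast
  qed
  thus ?thesis unfolding triple_integral_def[abs_def] set_lebesgue_integral_def .
qed

text \<open>At \<open>\<nu> = t - 1\<close> the constant \<open>legendre_bound \<nu>\<close> is \<open>O(t)\<close>, so the previous estimate applies with \<open>\<eta> = t\<close> and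
the integral of \<open>(1 - x\<^sup>2)\<^sup>t\<^sup>/\<^sup>4\<^sup>-\<^sup>1\<close> is \<open>O(1/t)\<close>.\<close>

lemma norm_triple_integral_near_minus_1:
  assumes "0 < t" "t \<le> 1"
  shows "norm (triple_integral (of_real t - 1)) \<le> 4500000 / t"
proof -
  have "norm (complex_of_real t - 1) = 1 - t"
    using assms norm_of_real[of "t - 1", where 'a = complex] by simp
  hence l: "norm ((complex_of_real t - 1) * (complex_of_real t - 1 + 1)) = (1 - t) * t"
    using assms by (simp add: norm_mult)
  have "(1 - t) * t \<le> 1 * t" using assms by (intro mult_right_mono) auto
  moreover have "exp ((1 - t) * t) \<le> 3"
  proof -
    have "(1 - t) * t \<le> 1 * 1" using assms by (intro mult_mono) auto
    hence "exp ((1 - t) * t) \<le> exp 1" by simp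
    also have "\<dots> \<le> 3" by (rule exp_le)
    finally show ?thesis .
  qed
  ultimately have "legendre_bound (of_real t - 1) \<le> t * 3"
    unfolding legendre_bound_def l using assms by (intro mult_mono) auto
  hence "norm (LBINT x:{-1<..<1}. triple_integrand (of_real t - 1) x) \<le> 4 * (4394 * (1 + 3) ^ 3) / (t / 4)"
    using assms
    by (intro norm_set_integral_powr_bound continuous_on_triple_integrand norm_triple_integrand_le) auto
  also have "\<dots> \<le> 4500000 / t" using assms by (simp add: field_simps)
  finally show ?thesis by (simp add: triple_integral_def)
qed

section \<open>Exponential growth in the imaginary direction\<close>

text \<open>If \<open>\<mu> (\<mu> + 1) = - \<kappa>\<^sup>2\<close>, the recurrence has positive factors, and it dominates the recurrence of every degree
\<open>\<nu>\<close> with \<open>\<bar>\<nu> (\<nu> + 1)\<bar> \<le> \<kappa>\<^sup>2\<close>. For large \<open>\<kappa>\<close> these \<open>P\<^sub>\<mu>\<close> are the conical functions, of degree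
\<open>-1/2 + \<i> \<tau>\<close>.\<close>

lemma legendre_fps_majorant:
  assumes \<mu>: "\<mu> * (\<mu> + 1) = - of_real (\<kappa>\<^sup>2)"
  shows "Im (legendre_fps \<mu> $ n) = 0" "Re (legendre_fps \<mu> $ n) \<ge> 0"
    and "norm (\<nu> * (\<nu> + 1)) \<le> \<kappa>\<^sup>2 \<Longrightarrow> norm (legendre_fps \<nu> $ n) \<le> Re (legendre_fps \<mu> $ n)"
proof -
  have step: "legendre_fps \<mu> $ Suc n
      = of_real ((real n * real (Suc n) + \<kappa>\<^sup>2) / real (Suc n) ^ 2) * legendre_fps \<mu> $ n" for n
    unfolding legendre_fps_Suc' \<mu> by simp
  have *: "Im (legendre_fps \<mu> $ n) = 0 \<and> Re (legendre_fps \<mu> $ n) \<ge> 0" for n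
    by (induction n) (simp_all add: step del: of_nat_Suc of_real_divide of_real_add of_real_mult)
  show "Im (legendre_fps \<mu> $ n) = 0" "Re (legendre_fps \<mu> $ n) \<ge> 0" using * by auto
  show "norm (legendre_fps \<nu> $ n) \<le> Re (legendre_fps \<mu> $ n)" if le: "norm (\<nu> * (\<nu> + 1)) \<le> \<kappa>\<^sup>2"
  proof (induction n)
    case (Suc n)
    have "norm (of_nat n * of_nat (Suc n) - \<nu> * (\<nu> + 1)) \<le> real n * real (Suc n) + \<kappa>\<^sup>2"
      using le norm_triangle_ineq4[of "of_nat n * of_nat (Suc n)" "\<nu> * (\<nu> + 1)"]
      by (simp add: norm_mult del: of_nat_Suc)
    hence "norm (legendre_fps \<nu> $ Suc n)
        \<le> (real n * real (Suc n) + \<kappa>\<^sup>2) * Re (legendre_fps \<mu> $ n) / real (Suc n) ^ 2"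
      unfolding legendre_fps_Suc' norm_divide norm_mult norm_power norm_of_nat
      using Suc.IH by (intro divide_right_mono mult_mono) auto
    also have "\<dots> = Re (legendre_fps \<mu> $ Suc n)"
      by (simp add: step del: of_nat_Suc of_real_divide of_real_add of_real_mult)
    finally show ?case .
  qed simp
qed

lemma Re_eval_fps_real:
  fixes F :: "complex fps"
  assumes "norm (complex_of_real t) < fps_conv_radius F" "\<And>n. Im (F $ n) = 0"
  shows "(\<lambda>n. Re (F $ n) * t ^ n) sums Re (eval_fps F (of_real t))"
proof -
  have "(\<lambda>n. F $ n * of_real t ^ n) sums eval_fps F (of_real t)"
    by (rule sums_eval_fps) (use assms in auto)
  from sums_Re[OF this] show ?thesis
    using assms(2) by (simp flip: of_real_power)
qed

lemma legendre_P_majorant: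
  assumes \<mu>: "\<mu> * (\<mu> + 1) = - of_real (\<kappa>\<^sup>2)" and le: "norm (\<nu> * (\<nu> + 1)) \<le> \<kappa>\<^sup>2" and x: "\<bar>x\<bar> < 1"
  shows "norm (legendre_P \<nu> x) \<le> Re (legendre_P \<mu> x)"
proof -
  define t where "t = (1 - x) / 2"
  have t: "0 < t" "t < 1" using x by (auto simp: t_def)
  have s: "(\<lambda>n. Re (legendre_fps \<mu> $ n) * t ^ n) sums Re (eval_fps (legendre_fps \<mu>) (of_real t))"
    by (rule Re_eval_fps_real[OF less_legendre_conv_radius]) (use t legendre_fps_majorant(1)[OF \<mu>] in auto)
  have "norm (eval_fps (legendre_fps \<nu>) (of_real t)) \<le> (\<Sum>n. Re (legendre_fps \<mu> $ n) * t ^ n)"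
    unfolding eval_fps_def
    using t legendre_fps_majorant(3)[OF \<mu> le]
    by (intro norm_suminf_le sums_summable[OF s]) (auto simp: norm_mult norm_power mult_right_mono)
  also have "\<dots> = Re (eval_fps (legendre_fps \<mu>) (of_real t))"
    by (rule sums_unique[OF s, symmetric])
  finally show ?thesis by (simp only: legendre_P_eval t_def)
qed

text \<open>Let \<open>\<Phi>(\<theta>) = P\<^sub>\<mu>(cos \<theta>)\<close>, a nonnegative solution of \<open>\<Phi>'' + cot \<theta> \<Phi>' = \<kappa>\<^sup>2 \<Phi>\<close> with
\<open>D = \<Phi>' \<ge> 0\<close>. On \<open>[0, \<pi>/2]\<close> the cotangent is nonnegative, so \<open>\<Phi>'' \<le> \<kappa>\<^sup>2 \<Phi>\<close> and \<open>\<Phi>\<close> grows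
no faster than \<open>exp(\<kappa> \<theta>)\<close>. On \<open>[\<pi>/2, \<pi>)\<close> the cotangent is negative, but \<open>Z = sin \<theta> \<Phi>\<close> satisfies
\<open>Z'' = \<kappa>\<^sup>2 Z - sin \<theta> \<Phi> + cos \<theta> \<Phi>' \<le> \<kappa>\<^sup>2 Z\<close>. A differential inequality \<open>y'' \<le> \<kappa>\<^sup>2 y\<close> is used in the form
that \<open>exp(- \<kappa> \<theta>) (y' + \<kappa> y)\<close> is nonincreasing.\<close>

lemma conical_bound:
  assumes \<mu>: "\<mu> * (\<mu> + 1) = - of_real (\<kappa>\<^sup>2)" and \<kappa>: "\<kappa> > 0" and \<theta>: "0 < \<theta>" "\<theta> < pi"
  shows "Re (legendre_P \<mu> (cos \<theta>)) * sin \<theta> \<le> exp (\<kappa> * \<theta>)"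
proof -
  define z where "z = (\<lambda>\<theta>. complex_of_real ((1 - cos \<theta>) / 2))"
  define \<Phi> where "\<Phi> = (\<lambda>\<theta>. Re (eval_fps (legendre_fps \<mu>) (z \<theta>)))"
  define D where "D = (\<lambda>\<theta>. sin \<theta> / 2 * Re (eval_fps (fps_deriv (legendre_fps \<mu>)) (z \<theta>)))"
  define S where "S = (\<lambda>\<theta>. - Re (legendre_flux \<mu> (cos \<theta>)))"
  have cos1: "\<bar>cos t\<bar> < 1" if "0 < t" "t < pi" for t
    using that sin_gt_zero[of t] sin_cos_squared_add[of t]
    by (metis abs_square_less_1 less_add_same_cancel2 zero_less_power)
  have z1: "norm (z t) < 1" if "0 \<le> t" "t < pi" for t
  proof -
    have "cos pi < cos t" using that by (intro cos_monotone_0_pi) auto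
    hence "\<bar>(1 - cos t) / 2\<bar> < 1" using cos_le_one[of t] by auto
    thus ?thesis unfolding z_def norm_of_real .
  qed
  have \<Phi>P: "\<Phi> t = Re (legendre_P \<mu> (cos t))" for t
    by (simp add: \<Phi>_def z_def legendre_P_eval)
  have S_eq: "S t = sin t * D t" if "0 < t" "t < pi" for t
  proof -
    have zt: "z t * (1 - z t) = of_real ((sin t)\<^sup>2 / 4)"
    proof -
      have "z t * (1 - z t) = of_real ((1 - cos t) / 2 * (1 - (1 - cos t) / 2))"
        by (simp add: z_def)
      also have "(1 - cos t) / 2 * (1 - (1 - cos t) / 2) = (sin t)\<^sup>2 / 4"
        unfolding sin_squared_eq by (simp add: field_simps power2_eq_square)
      finally show ?thesis .
    qed
    have "legendre_flux \<mu> (cos t) = - 2 * eval_fps (legendre_flux_fps \<mu>) (z t)"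
      by (simp only: legendre_flux_def z_def)
    also have "eval_fps (legendre_flux_fps \<mu>) (z t) = z t * (1 - z t) * eval_fps (fps_deriv (legendre_fps \<mu>)) (z t)"
      using that by (intro eval_legendre_flux_fps z1) auto
    finally have "legendre_flux \<mu> (cos t) = of_real (- (sin t)\<^sup>2 / 2) * eval_fps (fps_deriv (legendre_fps \<mu>)) (z t)"
      unfolding zt by simp
    thus ?thesis unfolding S_def D_def
      by (simp add: power2_eq_square del: of_real_mult of_real_divide of_real_minus)
  qed
  have D0: "D t \<ge> 0" and \<Phi>0: "\<Phi> t \<ge> 0" if "0 \<le> t" "t < pi" for t
  proof -
    have nn: "(1 - cos t) / 2 \<ge> 0" by simp
    have "(\<lambda>n. Re (fps_deriv (legendre_fps \<mu>) $ n) * ((1 - cos t) / 2) ^ n) sums Re (eval_fps (fps_deriv (legendre_fps \<mu>)) (z t))"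
      unfolding z_def
      by (rule Re_eval_fps_real[OF less_legendre_deriv_conv_radius[OF z1[OF that, unfolded z_def]]])
        (use legendre_fps_majorant(1)[OF \<mu>] in \<open>auto simp del: of_nat_Suc\<close>)
    hence "Re (eval_fps (fps_deriv (legendre_fps \<mu>)) (z t)) \<ge> 0"
      by (rule sums_le[OF _ sums_zero, rotated])
        (use legendre_fps_majorant(2)[OF \<mu>] nn in \<open>auto simp del: of_nat_Suc\<close>)
    thus "D t \<ge> 0" using that by (auto simp: D_def intro!: mult_nonneg_nonneg sin_ge_zero)
    have "(\<lambda>n. Re (legendre_fps \<mu> $ n) * ((1 - cos t) / 2) ^ n) sums \<Phi> t"
      unfolding z_def \<Phi>_def
      by (rule Re_eval_fps_real[OF less_legendre_conv_radius[OF z1[OF that, unfolded z_def]]])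
        (use legendre_fps_majorant(1)[OF \<mu>] in auto)
    thus "\<Phi> t \<ge> 0"
      by (rule sums_le[OF _ sums_zero, rotated])
        (use legendre_fps_majorant(2)[OF \<mu>] nn in auto)
  qed
  have d\<Phi>: "(\<Phi> has_real_derivative D t) (at t)" if t: "0 < t" "t < pi" for t
  proof -
    have "((\<lambda>x. Re (legendre_P \<mu> x)) has_real_derivative Re (legendre_flux \<mu> (cos t) / of_real (1 - (cos t)\<^sup>2))) (at (cos t))"
      using bounded_linear.has_vector_derivative[OF bounded_linear_Re legendre_P_deriv[OF cos1[OF t], of \<mu>]]
      by (simp add: has_real_derivative_iff_has_vector_derivative)
    from DERIV_chain2[OF this DERIV_cos]
    have "(\<Phi> has_real_derivative Re (legendre_flux \<mu> (cos t) / of_real (1 - (cos t)\<^sup>2)) * - sin t) (at t)"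
      unfolding \<Phi>P[abs_def] .
    moreover have "Re (legendre_flux \<mu> (cos t) / of_real (1 - (cos t)\<^sup>2)) * - sin t = S t * sin t / (sin t)\<^sup>2"
      by (simp add: S_def sin_squared_eq Re_divide_of_real del: of_real_diff of_real_power)
    moreover have "\<dots> = D t"
      using S_eq[OF t] sin_gt_zero[OF t] by (simp add: power2_eq_square)
    ultimately show ?thesis by simp
  qed
  have dS: "(S has_real_derivative \<kappa>\<^sup>2 * sin t * \<Phi> t) (at t)" if t: "0 < t" "t < pi" for t
  proof -
    have "((\<lambda>x. Re (legendre_flux \<mu> x)) has_real_derivative \<kappa>\<^sup>2 * Re (legendre_P \<mu> (cos t))) (at (cos t))"
      using bounded_linear.has_vector_derivative[OF bounded_linear_Re legendre_flux_deriv[OF cos1[OF t], of \<mu>]] \<mu>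
      by (simp add: has_real_derivative_iff_has_vector_derivative del: of_real_power)
    from DERIV_minus[OF DERIV_chain2[OF this DERIV_cos]] show ?thesis
      unfolding S_def[symmetric] \<Phi>P by (simp add: mult_ac)
  qed
  have dD: "(D has_real_derivative \<kappa>\<^sup>2 * \<Phi> t - cos t / sin t * D t) (at t)" if t: "0 < t" "t < pi" for t
  proof -
    have sn: "sin t > 0" using sin_gt_zero[OF t] .
    have "((\<lambda>t. S t / sin t) has_real_derivative (\<kappa>\<^sup>2 * sin t * \<Phi> t * sin t - S t * cos t) / (sin t * sin t)) (at t)"
      by (rule DERIV_divide[OF dS[OF t] DERIV_sin]) (use sn in auto)
    moreover have "(\<kappa>\<^sup>2 * sin t * \<Phi> t * sin t - S t * cos t) / (sin t * sin t) = \<kappa>\<^sup>2 * \<Phi> t - cos t / sin t * D t"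
      using sn by (simp add: S_eq[OF t] field_simps)
    moreover have "eventually (\<lambda>t. S t / sin t = D t) (nhds t)"
    proof -
      have "eventually (\<lambda>t. t \<in> {0<..<pi}) (nhds t)"
        using t by (intro eventually_nhds_in_open) auto
      thus ?thesis by eventually_elim (use S_eq in \<open>auto simp: sin_gt_zero less_imp_neq[OF sin_gt_zero, symmetric]\<close>)
    qed
    ultimately show ?thesis by (simp add: DERIV_cong_ev)
  qed
  have cont: "continuous_on {0..pi/2} \<Phi>" "continuous_on {0..pi/2} D"
  proof -
    have zc: "continuous_on {0..pi/2} z" unfolding z_def by (intro continuous_intros) auto
    have sub1: "z ` {0..pi/2} \<subseteq> eball 0 (fps_conv_radius (legendre_fps \<mu>))"
    proof safe
      fix t :: real assume "t \<in> {0..pi/2}"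
      hence "0 \<le> t" "t < pi" using pi_gt_zero unfolding atLeastAtMost_iff by linarith+
      hence "norm (z t) < 1" by (rule z1)
      thus "z t \<in> eball 0 (fps_conv_radius (legendre_fps \<mu>))" by (simp add: in_eball_iff)
    qed
    have sub2: "z ` {0..pi/2} \<subseteq> eball 0 (fps_conv_radius (fps_deriv (legendre_fps \<mu>)))"
    proof safe
      fix t :: real assume "t \<in> {0..pi/2}"
      hence "0 \<le> t" "t < pi" using pi_gt_zero unfolding atLeastAtMost_iff by linarith+
      hence "norm (z t) < 1" by (rule z1)
      thus "z t \<in> eball 0 (fps_conv_radius (fps_deriv (legendre_fps \<mu>)))" by (simp add: in_eball_iff)
    qed
    show "continuous_on {0..pi/2} \<Phi>" unfolding \<Phi>_def
      by (intro continuous_intros continuous_on_eval_fps'[OF zc] sub1)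
    show "continuous_on {0..pi/2} D" unfolding D_def
      by (intro continuous_intros continuous_on_eval_fps'[OF zc] sub2) auto
  qed
  \<comment> \<open>\<open>N\<close> is the monotone quantity on \<open>[0, \<pi>/2]\<close>; at 0 it equals \<open>\<kappa>\<close>\<close>
  have first: "D t + \<kappa> * \<Phi> t \<le> \<kappa> * exp (\<kappa> * t)" if t: "0 \<le> t" "t \<le> pi / 2" for t
  proof -
    define N where "N = (\<lambda>t. exp (- (\<kappa> * t)) * (D t + \<kappa> * \<Phi> t))"
    have "N t \<le> N 0"
    proof (rule DERIV_nonpos_imp_decreasing_open[OF t(1)])
      fix u assume u: "0 < u" "u < t"
      hence u': "0 < u" "u < pi" "u < pi / 2" using t by auto
      have "(N has_real_derivative exp (- (\<kappa> * u)) * (\<kappa>\<^sup>2 * \<Phi> u - cos u / sin u * D u + \<kappa> * D u)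
              + - \<kappa> * exp (- (\<kappa> * u)) * (D u + \<kappa> * \<Phi> u)) (at u)"
        unfolding N_def
        by (auto intro!: derivative_eq_intros dD d\<Phi> u' simp: algebra_simps)
      moreover have "exp (- (\<kappa> * u)) * (\<kappa>\<^sup>2 * \<Phi> u - cos u / sin u * D u + \<kappa> * D u)
              + - \<kappa> * exp (- (\<kappa> * u)) * (D u + \<kappa> * \<Phi> u) = - (exp (- (\<kappa> * u)) * (cos u / sin u * D u))"
        by (simp add: algebra_simps power2_eq_square)
      moreover have "exp (- (\<kappa> * u)) * (cos u / sin u * D u) \<ge> 0"
        using u' D0[of u] by (intro mult_nonneg_nonneg divide_nonneg_pos cos_ge_zero sin_gt_zero) auto
      ultimately show "\<exists>y. DERIV N u :> y \<and> y \<le> 0" by (metis neg_le_0_iff_le)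
    next
      have "continuous_on {0..pi/2} N" unfolding N_def by (intro continuous_intros cont)
      thus "continuous_on {0..t} N" by (rule continuous_on_subset) (use t in auto)
    qed
    also have "N 0 = \<kappa>" by (simp add: N_def D_def \<Phi>_def z_def eval_fps_at_0)
    finally show ?thesis by (simp add: N_def exp_minus field_simps)
  qed
  have \<Phi>_le: "\<Phi> t \<le> exp (\<kappa> * t)" if t: "0 \<le> t" "t \<le> pi / 2" for t
  proof -
    have "t < pi" using t pi_gt_zero by linarith
    hence "D t \<ge> 0" using t by (intro D0) auto
    hence "\<kappa> * \<Phi> t \<le> \<kappa> * exp (\<kappa> * t)" using first[OF t] by simp
    thus ?thesis using \<kappa> by simp
  qed
  show ?thesis
  proof (cases "\<theta> \<le> pi / 2")
    case True
    have "\<Phi> \<theta> * sin \<theta> \<le> \<Phi> \<theta> * 1" using \<theta> \<Phi>0[of \<theta>] by (intro mult_left_mono) auto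
    also have "\<dots> \<le> exp (\<kappa> * \<theta>)" using \<Phi>_le[of \<theta>] True \<theta> by simp
    finally show ?thesis by (simp add: \<Phi>P)
  next
    case False
    define Z where "Z = (\<lambda>t. sin t * \<Phi> t)"
    define Z' where "Z' = (\<lambda>t. cos t * \<Phi> t + S t)"
    have dZ: "(Z has_real_derivative Z' t) (at t)" if t: "0 < t" "t < pi" for t
      unfolding Z_def Z'_def S_eq[OF t]
      by (auto intro!: derivative_eq_intros d\<Phi> t simp: algebra_simps)
    have dZ': "(Z' has_real_derivative \<kappa>\<^sup>2 * Z t - sin t * \<Phi> t + cos t * D t) (at t)" if t: "0 < t" "t < pi" for t
      unfolding Z_def Z'_def
      by (auto intro!: derivative_eq_intros d\<Phi> dS t simp: algebra_simps)
    have second: "Z' t + \<kappa> * Z t \<le> \<kappa> * exp (\<kappa> * t)" if t: "pi / 2 \<le> t" "t < pi" for t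
    proof -
      define Y where "Y = (\<lambda>t. exp (- (\<kappa> * t)) * (Z' t + \<kappa> * Z t))"
      have dY: "(Y has_real_derivative exp (- (\<kappa> * u)) * (cos u * D u - sin u * \<Phi> u)) (at u)"
        if u: "0 < u" "u < pi" for u
        unfolding Y_def
        by (auto intro!: derivative_eq_intros dZ dZ' u simp: algebra_simps power2_eq_square)
      have "Y t \<le> Y (pi / 2)"
      proof (rule DERIV_nonpos_imp_nonincreasing[OF t(1)])
        fix u assume u: "pi / 2 \<le> u" "u \<le> t"
        have u': "0 < u" "u < pi" using u t pi_gt_zero by linarith+
        have "cos u \<le> 0" using cos_monotone_0_pi_le[of "pi / 2" u] u u' by simp
        hence "cos u * D u \<le> 0" using D0[of u] u' by (intro mult_nonpos_nonneg) auto
        moreover have "sin u * \<Phi> u \<ge> 0" using \<Phi>0[of u] u' sin_gt_zero[of u] by simp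
        ultimately have "exp (- (\<kappa> * u)) * (cos u * D u - sin u * \<Phi> u) \<le> 0"
          by (intro mult_nonneg_nonpos) auto
        with dY[OF u'] show "\<exists>y. DERIV Y u :> y \<and> y \<le> 0" by blast
      qed
      also have "Y (pi / 2) = exp (- (\<kappa> * (pi / 2))) * (D (pi / 2) + \<kappa> * \<Phi> (pi / 2))"
        using S_eq[of "pi / 2"] pi_gt_zero by (simp add: Y_def Z_def Z'_def)
      also have "\<dots> \<le> exp (- (\<kappa> * (pi / 2))) * (\<kappa> * exp (\<kappa> * (pi / 2)))"
        using pi_gt_zero by (intro mult_left_mono first) auto
      also have "\<dots> = \<kappa>" by (simp add: exp_minus)
      finally show ?thesis by (simp add: Y_def exp_minus field_simps)
    qed
    \<comment> \<open>integrates the first-order inequality for \<open>Z\<close>: the derivative of \<open>exp(\<kappa> t) Z\<close> is at most \<open>\<kappa> exp(2 \<kappa> t)\<close>\<close>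
    define V where "V = (\<lambda>t. exp (\<kappa> * t) * Z t - exp (2 * (\<kappa> * t)) / 2)"
    have dV: "(V has_real_derivative exp (\<kappa> * u) * (Z' u + \<kappa> * Z u) - \<kappa> * exp (2 * (\<kappa> * u))) (at u)"
      if u: "0 < u" "u < pi" for u
      unfolding V_def by (auto intro!: derivative_eq_intros dZ u simp: algebra_simps)
    have "V \<theta> \<le> V (pi / 2)"
    proof (rule DERIV_nonpos_imp_nonincreasing[of "pi / 2" \<theta> V])
      fix u assume u: "pi / 2 \<le> u" "u \<le> \<theta>"
      have u': "0 < u" "u < pi" using u \<theta> pi_gt_zero by linarith+
      have "exp (\<kappa> * u) * (Z' u + \<kappa> * Z u) \<le> exp (\<kappa> * u) * (\<kappa> * exp (\<kappa> * u))"
        using u u' by (intro mult_left_mono second) auto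
      also have "\<dots> = \<kappa> * exp (2 * (\<kappa> * u))" by (simp add: exp_add[symmetric] mult_ac)
      finally show "\<exists>y. DERIV V u :> y \<and> y \<le> 0" using dV[OF u'] by (intro exI conjI) auto
    qed (use False in auto)
    also have "V (pi / 2) \<le> exp (2 * (\<kappa> * (pi / 2))) / 2"
    proof -
      have "exp (\<kappa> * (pi / 2)) * \<Phi> (pi / 2) \<le> exp (\<kappa> * (pi / 2)) * exp (\<kappa> * (pi / 2))"
        by (intro mult_left_mono \<Phi>_le) auto
      also have "\<dots> = exp (2 * (\<kappa> * (pi / 2)))" by (simp add: exp_add[symmetric])
      finally show ?thesis by (simp add: V_def Z_def)
    qed
    also have "\<dots> \<le> exp (2 * (\<kappa> * \<theta>)) / 2" using False \<kappa> by simp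
    finally have "exp (\<kappa> * \<theta>) * Z \<theta> \<le> exp (2 * (\<kappa> * \<theta>))" by (simp add: V_def)
    also have "\<dots> = exp (\<kappa> * \<theta>) * exp (\<kappa> * \<theta>)" by (simp add: exp_add[symmetric])
    finally have "Z \<theta> \<le> exp (\<kappa> * \<theta>)" by simp
    thus ?thesis by (simp add: Z_def \<Phi>P mult.commute)
  qed
qed

text \<open>The choice \<open>\<kappa> = \<bar>\<nu>\<bar> + 1\<close> is crude but satisfies \<open>\<bar>\<nu> (\<nu> + 1)\<bar> \<le> \<kappa>\<^sup>2\<close> and differs from \<open>\<bar>Im \<nu>\<bar>\<close> by a
bounded amount on vertical strips, so the exponential type is not affected.\<close>

lemma norm_legendre_P_cos_le:
  assumes \<theta>: "0 < \<theta>" "\<theta> < pi"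
  shows "norm (legendre_P \<nu> (cos \<theta>)) * sin \<theta> \<le> exp ((norm \<nu> + 1) * \<theta>)"
proof -
  define \<kappa> where "\<kappa> = norm \<nu> + 1"
  have \<kappa>: "\<kappa> > 0" unfolding \<kappa>_def by (simp add: add_nonneg_pos)
  define \<mu> where "\<mu> = csqrt (1 / 4 - of_real (\<kappa>\<^sup>2)) - 1 / 2"
  have "\<mu> * (\<mu> + 1) = (csqrt (1 / 4 - of_real (\<kappa>\<^sup>2)))\<^sup>2 - 1 / 4"
    unfolding \<mu>_def by (simp add: algebra_simps power2_eq_square)
  also have "\<dots> = - of_real (\<kappa>\<^sup>2)" unfolding power2_csqrt by simp
  finally have \<mu>: "\<mu> * (\<mu> + 1) = - of_real (\<kappa>\<^sup>2)" .
  have le: "norm (\<nu> * (\<nu> + 1)) \<le> \<kappa>\<^sup>2"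
    unfolding norm_mult power2_eq_square \<kappa>_def
    using norm_triangle_ineq[of \<nu> 1] by (intro mult_mono) auto
  have sn: "sin \<theta> > 0" using \<theta> by (rule sin_gt_zero)
  have "\<bar>cos \<theta>\<bar> < 1"
    using sn sin_cos_squared_add[of \<theta>]
    by (metis abs_square_less_1 less_add_same_cancel2 zero_less_power)
  hence "norm (legendre_P \<nu> (cos \<theta>)) * sin \<theta> \<le> Re (legendre_P \<mu> (cos \<theta>)) * sin \<theta>"
    using sn by (intro mult_right_mono legendre_P_majorant[OF \<mu> le]) auto
  also have "\<dots> \<le> exp (\<kappa> * \<theta>)" by (rule conical_bound[OF \<mu> \<kappa> \<theta>])
  finally show ?thesis by (simp add: \<kappa>_def)
qed

text \<open>The restriction \<open>Re \<nu> \<ge> 4\<close> makes the weight absorb the factor \<open>1 / sin\<^sup>3 \<theta>\<close> that comes from the three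
Legendre functions; the recursion later makes a bound on one strip of width 2 sufficient.\<close>

lemma norm_triple_integral_growth:
  assumes "Re \<nu> \<ge> 4"
  shows "norm (triple_integral \<nu>) \<le> 4 * exp (2 * pi * (norm \<nu> + 1))"
proof -
  define \<kappa> where "\<kappa> = norm \<nu> + 1"
  have \<kappa>: "\<kappa> > 0" unfolding \<kappa>_def by (simp add: add_nonneg_pos)
  have "norm (triple_integrand \<nu> x) \<le> exp (2 * pi * \<kappa>) * (1 - x\<^sup>2) powr (1 - 1)" if x: "\<bar>x\<bar> < 1" for x
  proof -
    define \<theta> where "\<theta> = arccos x"
    have \<theta>: "0 < \<theta>" "\<theta> < pi" "cos \<theta> = x" using x by (auto simp: \<theta>_def arccos_lt_bounded abs_less_iff)
    define p where "p = 1 - x\<^sup>2"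
    have p: "0 < p" "p \<le> 1" using one_minus_square_pos[OF x] by (auto simp: p_def)
    define s where "s = sin \<theta>"
    have s: "s > 0" "s\<^sup>2 = p" using sin_gt_zero[OF \<theta>(1,2)] by (auto simp: s_def p_def sin_squared_eq \<theta>(3))
    have "norm (legendre_P \<nu> x) * s \<le> exp (\<kappa> * \<theta>)"
      using norm_legendre_P_cos_le[OF \<theta>(1,2), of \<nu>] by (simp add: \<theta>(3) s_def \<kappa>_def)
    hence A: "(norm (legendre_P \<nu> x) * s)\<^sup>2 \<le> exp (\<kappa> * \<theta>) ^ 2" using s by (intro power_mono) auto
    have B: "norm (legendre_P \<nu> (- x)) * s \<le> exp (\<kappa> * (pi - \<theta>))"
      using norm_legendre_P_cos_le[of "pi - \<theta>" \<nu>] \<theta> by (simp add: s_def \<kappa>_def)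
    have "s ^ 3 * norm ((legendre_P \<nu> x)\<^sup>2 * legendre_P \<nu> (- x)) = (norm (legendre_P \<nu> x) * s)\<^sup>2 * (norm (legendre_P \<nu> (- x)) * s)"
      by (simp add: norm_mult norm_power power2_eq_square power3_eq_cube)
    also have "\<dots> \<le> exp (\<kappa> * \<theta>) ^ 2 * exp (\<kappa> * (pi - \<theta>))"
      using s by (intro mult_mono A B) auto
    also have "\<dots> = exp (\<kappa> * (pi + \<theta>))"
      by (simp add: exp_of_nat_mult[symmetric] exp_add[symmetric] algebra_simps)
    also have "\<dots> \<le> exp (\<kappa> * (2 * pi))" using \<kappa> \<theta> by simp
    finally have C: "s ^ 3 * norm ((legendre_P \<nu> x)\<^sup>2 * legendre_P \<nu> (- x)) \<le> exp (2 * pi * \<kappa>)"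
      by (simp add: mult_ac)
    have "norm (endpoint_weight ((\<nu> - 1) / 2) x) = p powr ((Re \<nu> - 1) / 2)" by (simp add: norm_endpoint_weight[OF x] p_def)
    also have "\<dots> \<le> p powr (3 / 2)" using p assms by (intro powr_mono') auto
    also have "p powr (3 / 2) = s ^ 3"
    proof -
      have "p powr (3 / 2) = (s powr 2) powr (3 / 2)" using s by (simp add: powr_numeral)
      also have "\<dots> = s powr 3" by (simp add: powr_powr)
      also have "\<dots> = s ^ 3" using s by (simp add: powr_numeral)
      finally show ?thesis .
    qed
    finally have "norm (triple_integrand \<nu> x) \<le> s ^ 3 * norm ((legendre_P \<nu> x)\<^sup>2 * legendre_P \<nu> (- x))"
      unfolding triple_integrand_def norm_mult[of "endpoint_weight ((\<nu> - 1) / 2) x"] by (intro mult_right_mono) auto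
    also note C
    finally show ?thesis using p by (simp add: p_def)
  qed
  hence "norm (LBINT x:{-1<..<1}. triple_integrand \<nu> x) \<le> 4 * exp (2 * pi * \<kappa>) / 1"
    by (intro norm_set_integral_powr_bound continuous_on_triple_integrand) auto
  thus ?thesis by (simp add: triple_integral_def \<kappa>_def)
qed

text \<open>By Gauss's product the quotient is a limit of products of \<open>(z + a + k) / (z + k) = 1 + a / (z + k)\<close> times a
positive factor independent of \<open>z\<close>, and \<open>\<bar>z + k\<bar> \<ge> x + k\<close>.\<close>

lemma norm_Gamma_quotient_le:
  assumes z: "Re z \<ge> x" and x: "x > 0" and a: "a > 0"
  shows "norm (Gamma z / Gamma (z + of_real a)) \<le> Gamma x / Gamma (x + a)"
proof -
  have lim1: "(\<lambda>n. norm (Gamma_series z n / Gamma_series (z + of_real a) n)) \<longlonglongrightarrow> norm (Gamma z / Gamma (z + of_real a))"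
  proof (intro tendsto_norm tendsto_divide Gamma_series_LIMSEQ)
    show "Gamma (z + of_real a) \<noteq> 0"
      using z x a by (subst Gamma_eq_zero_iff) (auto elim!: nonpos_Ints_cases simp: complex_eq_iff)
  qed
  have lim2: "(\<lambda>n. Gamma_series x n / Gamma_series (x + a) n) \<longlonglongrightarrow> Gamma x / Gamma (x + a)"
  proof (intro tendsto_divide Gamma_series_LIMSEQ)
    show "Gamma (x + a) \<noteq> 0" using x a Gamma_real_pos[of "x + a"] by linarith
  qed
  have "norm (Gamma_series z n / Gamma_series (z + of_real a) n) \<le> Gamma_series x n / Gamma_series (x + a) n"
    if n: "n > 0" for n
  proof -
    have zk: "norm (z + of_nat k) \<ge> x + real k" for k
      using complex_Re_le_cmod[of "z + of_nat k"] z by simp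
    have zk0: "z + of_nat k \<noteq> 0" for k using zk[of k] x by (intro notI) auto
    have fac: "norm ((z + of_real a + of_nat k) / (z + of_nat k)) \<le> (x + a + real k) / (x + real k)" for k
    proof -
      have "(z + of_real a + of_nat k) / (z + of_nat k) = 1 + of_real a / (z + of_nat k)"
        using zk0[of k] by (simp add: field_simps)
      also have "norm \<dots> \<le> 1 + a / norm (z + of_nat k)"
        using norm_triangle_ineq[of 1 "of_real a / (z + of_nat k)"] a by (simp add: norm_divide)
      also have "\<dots> \<le> 1 + a / (x + real k)"
        using zk[of k] a x by (intro add_left_mono divide_left_mono mult_pos_pos) auto
      also have "\<dots> = (x + a + real k) / (x + real k)"
        using x by (simp add: field_simps)
      finally show ?thesis .
    qed
    have poch: "norm (pochhammer (z + of_real a) (n + 1) / pochhammer z (n + 1))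
        \<le> pochhammer (x + a) (n + 1) / pochhammer x (n + 1)"
      unfolding pochhammer_prod prod_dividef[symmetric] prod_norm[symmetric]
      using fac by (intro prod_mono) auto
    have e: "norm (exp (- of_real a * of_real (ln (real n)) :: complex)) = exp (- a * ln (real n))"
      by simp
    have q: "Gamma_series z n / Gamma_series (z + of_real a) n
       = exp (- of_real a * of_real (ln (real n))) * (pochhammer (z + of_real a) (n + 1) / pochhammer z (n + 1))"
      by (simp add: Gamma_series_def exp_diff exp_minus exp_add algebra_simps divide_simps del: of_nat_Suc)
    have r: "Gamma_series x n / Gamma_series (x + a) n
       = exp (- a * ln (real n)) * (pochhammer (x + a) (n + 1) / pochhammer x (n + 1))"
      by (simp add: Gamma_series_def exp_diff exp_minus exp_add algebra_simps divide_simps del: of_nat_Suc)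
    show ?thesis unfolding q r norm_mult e by (intro mult_left_mono poch) auto
  qed
  hence "eventually (\<lambda>n. norm (Gamma_series z n / Gamma_series (z + of_real a) n) \<le> Gamma_series x n / Gamma_series (x + a) n) sequentially"
    by (intro eventually_mono[OF eventually_gt_at_top[of 0]])
  thus ?thesis by (rule tendsto_le[OF _ lim2 lim1, rotated]) simp
qed

section \<open>Antiperiodic entire functions\<close>

lemma antiperiodic_shift:
  fixes f :: "complex \<Rightarrow> complex"
  assumes "\<And>z. f (z + 2) = - f z"
  shows "norm (f (z + 2 * of_int k)) = norm (f z)"
proof (induction k rule: int_induct[of _ 0])
  case (step1 k)
  have "f (z + 2 * of_int (k + 1)) = - f (z + 2 * of_int k)"
    using assms[of "z + 2 * of_int k"] by (simp add: algebra_simps)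
  thus ?case using step1 by simp
next
  case (step2 k)
  have "f (z + 2 * of_int k) = - f (z + 2 * of_int (k - 1))"
    using assms[of "z + 2 * of_int (k - 1)"] by (simp add: algebra_simps)
  thus ?case using step2 by simp
qed simp

text \<open>The values \<open>(-1)\<^sup>k C(z + 2 k)\<close> agree for all \<open>k\<close> large enough for \<open>z + 2 k\<close> to lie in the half-plane.\<close>

lemma antiperiodic_extension:
  fixes C :: "complex \<Rightarrow> complex"
  assumes hol: "C holomorphic_on {z. Re z > -1}"
    and per: "\<And>z. Re z > -1 \<Longrightarrow> C (z + 2) = - C z"
  obtains E where "E holomorphic_on UNIV" "\<And>z. E (z + 2) = - E z" "\<And>z. Re z > -1 \<Longrightarrow> E z = C z"
proof -
  define E where "E = (\<lambda>z. let k = nat \<lceil>\<bar>Re z\<bar>\<rceil> in (-1) ^ k * C (z + 2 * of_nat k))"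
  have C_shift: "C (z + 2 * of_nat k) = (-1) ^ k * C z" if "Re z > -1" for z k
  proof (induction k)
    case (Suc k)
    have "z + 2 * of_nat (Suc k) = (z + 2 * of_nat k) + 2" by simp
    moreover have "Re (z + 2 * of_nat k) > -1" using that by (simp add: add_strict_increasing2)
    note per[OF this]
    ultimately have "C (z + 2 * of_nat (Suc k)) = - C (z + 2 * of_nat k)" by (simp only:)
    also have "\<dots> = (-1) ^ Suc k * C z" unfolding Suc by simp
    finally show ?case .
  qed simp
  have indep: "(-1) ^ k * C (z + 2 * of_nat k) = (-1) ^ l * C (z + 2 * of_nat l)"
    if "Re z + 2 * real k > -1" "k \<le> l" for z k l
  proof -
    from \<open>k \<le> l\<close> obtain j where l: "l = k + j" using le_Suc_ex by metis
    have "C (z + 2 * of_nat l) = (-1) ^ j * C (z + 2 * of_nat k)"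
    proof -
      have "z + 2 * of_nat l = (z + 2 * of_nat k) + 2 * of_nat j" by (simp add: l ring_distribs)
      moreover have "Re (z + 2 * of_nat k) > -1" using that by simp
      note C_shift[OF this, of j]
      ultimately show ?thesis by (simp only:)
    qed
    moreover have "(-1) ^ j * (-1) ^ j = (1 :: complex)" by (simp flip: power_mult_distrib)
    ultimately show ?thesis by (simp add: l power_add)
  qed
  have E_eq: "E z = (-1) ^ k * C (z + 2 * of_nat k)" if "Re z + 2 * real k > -1" for z k
  proof -
    define l where "l = nat \<lceil>\<bar>Re z\<bar>\<rceil>"
    have "real l \<ge> \<bar>Re z\<bar>" unfolding l_def by linarith
    hence "Re z + 2 * real l > -1" by (simp add: abs_if split: if_splits)
    hence "(-1) ^ l * C (z + 2 * of_nat l) = (-1) ^ k * C (z + 2 * of_nat k)"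
      using indep[of z k l] indep[of z l k] that by (metis nat_le_linear)
    thus ?thesis by (simp add: E_def l_def Let_def)
  qed
  have "E holomorphic_on (\<Union>k\<in>UNIV. {z. Re z > -1 - 2 * real k})"
  proof (rule holomorphic_on_UN_open)
    fix k :: nat
    have "(\<lambda>z. (-1) ^ k * C (z + 2 * of_nat k)) holomorphic_on {z. Re z > -1 - 2 * real k}"
      by (intro holomorphic_intros holomorphic_on_compose_gen[OF _ hol, unfolded o_def]) auto
    thus "E holomorphic_on {z. Re z > -1 - 2 * real k}"
      by (rule holomorphic_transform) (rule E_eq[symmetric], simp)
  qed (auto intro: open_halfspace_Re_gt)
  also have "(\<Union>k\<in>UNIV. {z. Re z > -1 - 2 * real k}) = UNIV"
  proof (intro equalityI subsetI UNIV_I)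
    fix z :: complex
    obtain k :: nat where "real k > - Re z" using reals_Archimedean2 by blast
    thus "z \<in> (\<Union>k\<in>UNIV. {z. Re z > -1 - 2 * real k})" by (intro UN_I[of k]) auto
  qed
  finally have 1: "E holomorphic_on UNIV" .
  have 2: "E (z + 2) = - E z" for z
  proof -
    obtain k :: nat where k: "real k > - Re z" using reals_Archimedean2 by blast
    have "Re (z + 2) + 2 * real k > -1" "Re (z + 2 * of_nat k) > -1" "Re z + 2 * real k > -1"
      using k by simp_all
    note eqs = E_eq[OF this(1)] per[OF this(2)] E_eq[OF this(3)]
    have "z + 2 + 2 * of_nat k = (z + 2 * of_nat k) + 2" by simp
    thus ?thesis unfolding eqs by (simp only: eqs mult_minus_right)
  qed
  have 3: "E z = C z" if "Re z > -1" for z using E_eq[of z 0] that by simp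
  show ?thesis using that[OF 1 2 3] .
qed

text \<open>A pole tends to infinity from every direction, so boundedness along one ray excludes it. Thus a bound for
real \<open>\<nu>\<close> above \<open>-1\<close>, where the integral converges, suffices at \<open>-1\<close>.\<close>

lemma not_pole_if_bounded_right:
  fixes f :: "complex \<Rightarrow> complex"
  assumes "eventually (\<lambda>t::real. norm (f (a + of_real t)) \<le> M) (at_right 0)"
  shows "\<not> is_pole f a"
proof
  assume "is_pole f a"
  hence "filterlim f at_infinity (at a)" by (simp add: is_pole_def)
  moreover have "filterlim (\<lambda>t::real. a + of_real t) (at a) (at_right 0)"
    unfolding filterlim_at
    by (auto intro!: tendsto_eq_intros eventually_at_right_less[THEN eventually_mono])
  ultimately have "filterlim (\<lambda>t::real. f (a + of_real t)) at_infinity (at_right 0)"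
    by (rule filterlim_compose)
  hence "eventually (\<lambda>t::real. norm (f (a + of_real t)) \<ge> \<bar>M\<bar> + 1) (at_right 0)"
    unfolding filterlim_at_infinity[OF order_refl] by (auto dest!: spec[of _ "\<bar>M\<bar> + 1"] )
  with assms have "eventually (\<lambda>t::real. False) (at_right 0)"
    by eventually_elim auto
  thus False by simp
qed

lemma norm_cos_le_exp_Im: "norm (cos (z::complex)) \<le> exp \<bar>Im z\<bar>"
proof -
  have "cos z = (exp (\<i> * z) + exp (- (\<i> * z))) / 2" by (simp add: cos_exp_eq)
  also have "norm \<dots> \<le> (norm (exp (\<i> * z)) + norm (exp (- (\<i> * z)))) / 2"
    using norm_triangle_ineq[of "exp (\<i> * z)" "exp (- (\<i> * z))"] by (simp add: norm_divide del: norm_exp_eq_Re)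
  also have "\<dots> = (exp (- Im z) + exp (Im z)) / 2" by simp
  also have "\<dots> \<le> (exp \<bar>Im z\<bar> + exp \<bar>Im z\<bar>) / 2"
    by (intro divide_right_mono add_mono) auto
  finally show ?thesis by simp
qed

lemma norm_cos_ge_exp_Im:
  assumes "\<bar>Im z\<bar> \<ge> 1"
  shows "norm (cos z) \<ge> exp \<bar>Im z\<bar> / 4"
proof -
  define y where "y = \<bar>Im z\<bar>"
  have y: "y \<ge> 1" using assms by (simp add: y_def)
  have "inverse (exp y) \<le> 1" using y by (simp add: inverse_eq_divide)
  moreover have "exp y \<ge> 2" using exp_ge_add_one_self[of y] y by linarith
  ultimately have le: "exp y / 2 \<le> exp y - inverse (exp y)" by simp
  have "(exp y / 4)\<^sup>2 = (exp y / 2)\<^sup>2 / 4" by (simp add: power_divide)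
  also have "\<dots> \<le> (exp y - inverse (exp y))\<^sup>2 / 4"
    using le by (intro divide_right_mono power_mono) auto
  also have "(exp y - inverse (exp y))\<^sup>2 = (exp (Im z) - inverse (exp (Im z)))\<^sup>2"
    by (cases "Im z \<ge> 0") (auto simp: y_def exp_minus power2_commute)
  also have "\<dots> / 4 \<le> (norm (cos z))\<^sup>2" unfolding norm_cos_squared by simp
  finally show ?thesis unfolding y_def by (rule power2_le_imp_le) simp
qed

lemma norm_sin_ge_exp_Im:
  assumes "\<bar>Im z\<bar> \<ge> 1"
  shows "norm (sin z) \<ge> exp \<bar>Im z\<bar> / 4"
proof -
  have "sin z = cos (of_real (pi / 2) - z)" by (simp add: sin_cos_eq)
  thus ?thesis using norm_cos_ge_exp_Im[of "of_real (pi / 2) - z"] assms by simp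
qed

text \<open>By Liouville's theorem \<open>Q\<close> is a polynomial; being constant on the multiples of 4 it is constant, and then
antiperiodicity makes it 0.\<close>

lemma antiperiodic_polynomial_growth_eq_0:
  fixes Q :: "complex \<Rightarrow> complex"
  assumes hol: "Q holomorphic_on UNIV" and per: "\<And>z. Q (z + 2) = - Q z"
    and bd: "\<And>z. norm z \<ge> 1 \<Longrightarrow> norm (Q z) \<le> B * norm z ^ n"
  shows "Q z = 0"
proof -
  define p where "p = (\<Sum>k\<le>n. monom ((deriv ^^ k) Q 0 / fact k) k)"
  have Qp: "Q w = poly p w" for w
    using Liouville_polynomial[OF hol bd, of 1 w] by (simp add: p_def poly_sum poly_monom)
  have per4: "Q (4 * of_nat k) = Q 0" for k :: nat
  proof (induction k)
    case (Suc k)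
    have "Q (4 * of_nat (Suc k)) = Q (4 * of_nat k + 2 + 2)" by (simp add: algebra_simps)
    also have "\<dots> = Q (4 * of_nat k)" by (simp only: per minus_minus)
    finally show ?case using Suc by simp
  qed simp
  have "p - [:Q 0:] = 0"
  proof (rule ccontr)
    assume "p - [:Q 0:] \<noteq> 0"
    hence "finite {w. poly (p - [:Q 0:]) w = 0}" by (rule poly_roots_finite)
    moreover have "range (\<lambda>k::nat. 4 * of_nat k :: complex) \<subseteq> {w. poly (p - [:Q 0:]) w = 0}"
      using per4 by (auto simp flip: Qp)
    ultimately have "finite (range (\<lambda>k::nat. 4 * of_nat k :: complex))" by (rule rev_finite_subset)
    moreover have "inj (\<lambda>k::nat. 4 * of_nat k :: complex)" by (auto simp: inj_on_def)
    ultimately show False using finite_imageD infinite_UNIV_nat by blast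
  qed
  hence c: "Q w = Q 0" for w using Qp[of w] by simp
  with per[of 0] have "Q 0 = - Q 0" by (metis)
  hence "Q 0 = 0" by simp
  with c show ?thesis by simp
qed

text \<open>The difference \<open>D = E - cos\<^sup>3\<close> vanishes to third order at the odd integers and at least to first order at the
even ones, so it is divisible by \<open>B = cos\<^sup>3 sin\<close>. For \<open>\<bar>Im z\<bar> \<ge> 1\<close> it is at least a constant times
\<open>exp(2 \<pi> \<bar>Im z\<bar>)\<close>, so the quotient grows only polynomially. A growth bound on one strip of width 2 is
enough because of antiperiodicity.\<close>

lemma cos_cube_rigidity:
  fixes E :: "complex \<Rightarrow> complex"
  assumes hol: "E holomorphic_on UNIV" and per: "\<And>z. E (z + 2) = - E z"
    and E0: "E 0 = 1"
    and E1: "\<And>t::real. 0 < t \<Longrightarrow> t \<le> 1 \<Longrightarrow> norm (E (of_real t - 1)) \<le> K * t ^ 3"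
    and growth: "\<And>z. 4 \<le> Re z \<Longrightarrow> Re z \<le> 6 \<Longrightarrow> norm (E z) \<le> L * (1 + norm z) ^ d * exp (2 * pi * \<bar>Im z\<bar>)"
    and L: "L \<ge> 0"
  shows "E z = cos (z * of_real pi / 2) ^ 3"
proof -
  define c where "c = (\<lambda>z::complex. cos (z * of_real pi / 2))"
  define s where "s = (\<lambda>z::complex. sin (z * of_real pi / 2))"
  define D where "D = (\<lambda>z. E z - c z ^ 3)"
  define B where "B = (\<lambda>z. c z ^ 3 * s z)"
  have arg: "(z + 2) * of_real pi / 2 = z * of_real pi / 2 + of_real pi" for z :: complex
    by (simp add: algebra_simps add_divide_distrib)
  have cper: "c (z + 2) = - c z" and sper: "s (z + 2) = - s z" for z
    unfolding c_def s_def arg by (simp_all add: cos_add sin_add)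
  have Dper: "D (z + 2) = - D z" for z by (simp add: D_def per cper)
  have Bper: "B (z + 2) = B z" for z by (simp add: B_def cper sper)
  have chol: "c holomorphic_on UNIV" and shol: "s holomorphic_on UNIV"
    unfolding c_def s_def by (auto intro!: holomorphic_intros)
  have Dhol: "D holomorphic_on UNIV" unfolding D_def by (intro holomorphic_intros hol chol)
  have Bhol: "B holomorphic_on UNIV" unfolding B_def by (intro holomorphic_intros chol shol)
  define q where "q = (\<lambda>z. D z / B z)"
  have qper: "q (z + 2) = - q z" for z by (simp add: q_def Dper Bper)
  have B0: "\<exists>k::int. z = of_int k" if "B z = 0" for z
  proof -
    have "c z = 0 \<or> s z = 0" using that by (auto simp: B_def)
    thus ?thesis
    proof
      assume "c z = 0"
      then obtain n :: int where "z * of_real pi / 2 = of_real (real_of_int n * pi) + of_real pi / 2"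
        unfolding c_def cos_eq_0 by auto
      hence "z * of_real pi = of_int (2 * n + 1) * of_real pi" by (simp add: field_simps)
      thus ?thesis by (intro exI[of _ "2 * n + 1"]) simp
    next
      assume "s z = 0"
      then obtain n :: int where "z * of_real pi / 2 = of_real (real_of_int n * pi)"
        unfolding s_def sin_eq_0 by auto
      hence "z * of_real pi = of_int (2 * n) * of_real pi" by (simp add: field_simps)
      thus ?thesis by (intro exI[of _ "2 * n"]) simp
    qed
  qed
  have qmero: "q meromorphic_on UNIV"
    unfolding q_def using Dhol Bhol
    by (intro meromorphic_intros analytic_on_imp_meromorphic_on) (auto simp: analytic_on_open)
  have iso: "isolated_singularity_at q a" "not_essential q a" for a
    using meromorphic_on_subset[OF qmero, of "{a}"]
    by (auto intro: meromorphic_on_isolated_singularity meromorphic_on_not_essential)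
  have cr: "norm (c (of_real t)) = \<bar>cos (t * pi / 2)\<bar>" "norm (s (of_real t)) = \<bar>sin (t * pi / 2)\<bar>" for t
  proof -
    have "of_real t * complex_of_real pi / 2 = of_real (t * pi / 2)" by simp
    thus "norm (c (of_real t)) = \<bar>cos (t * pi / 2)\<bar>" "norm (s (of_real t)) = \<bar>sin (t * pi / 2)\<bar>"
      unfolding c_def s_def by (simp_all only: cos_of_real sin_of_real norm_of_real)
  qed
  \<comment> \<open>at even integers: \<open>D\<close> has a zero and \<open>B\<close> a simple zero\<close>
  have bnd0: "\<exists>M. eventually (\<lambda>t::real. norm (q (of_real t)) \<le> M) (at_right 0)"
  proof -
    obtain D' where "(D has_field_derivative D') (at 0)"
      using Dhol by (auto simp: holomorphic_on_open)
    moreover have "D 0 = 0" by (simp add: D_def E0 c_def)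
    ultimately have "((\<lambda>z. D z / z) \<longlongrightarrow> D') (at 0)" by (simp add: has_field_derivative_iff)
    moreover have "filterlim (\<lambda>t::real. complex_of_real t) (at 0) (at_right 0)"
      unfolding filterlim_at
      by (auto intro!: tendsto_eq_intros eventually_at_right_less[THEN eventually_mono])
    ultimately have "((\<lambda>t::real. D (of_real t) / of_real t) \<longlongrightarrow> D') (at_right 0)"
      by (rule filterlim_compose)
    hence "((\<lambda>t::real. norm (D (of_real t) / of_real t)) \<longlongrightarrow> norm D') (at_right 0)"
      by (rule tendsto_norm)
    hence "eventually (\<lambda>t::real. norm (D (of_real t) / of_real t) < norm D' + 1) (at_right 0)"
      by (rule order_tendstoD) simp
    moreover have "((\<lambda>t::real. cos (t * pi / 2) ^ 3 * sin (t * pi / 2) / t) \<longlongrightarrow> pi / 2) (at_right 0)"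
      by real_asymp
    hence "eventually (\<lambda>t::real. 1 < cos (t * pi / 2) ^ 3 * sin (t * pi / 2) / t) (at_right 0)"
      by (rule order_tendstoD) (use pi_gt3 in simp)
    moreover have "eventually (\<lambda>t::real. t > 0) (at_right 0)" by (rule eventually_at_right_less)
    ultimately have "eventually (\<lambda>t::real. norm (q (of_real t)) \<le> norm D' + 1) (at_right 0)"
    proof eventually_elim
      case (elim t)
      have "t \<le> cos (t * pi / 2) ^ 3 * sin (t * pi / 2)" using elim(2,3) by (simp add: pos_less_divide_eq)
      hence "t \<le> \<bar>cos (t * pi / 2) ^ 3 * sin (t * pi / 2)\<bar>" by linarith
      hence "t \<le> norm (B (of_real t))" by (simp add: B_def norm_mult norm_power cr abs_mult power_abs)
      hence "norm (D (of_real t)) / norm (B (of_real t)) \<le> norm (D (of_real t)) / t"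
        using elim(3) by (intro divide_left_mono mult_pos_pos) auto
      thus ?case using elim(1,3) by (simp add: q_def norm_divide)
    qed
    thus ?thesis by blast
  qed
  \<comment> \<open>at odd integers: \<open>D = O(t\<^sup>3)\<close> from the right, and \<open>\<bar>B\<bar> \<ge> t\<^sup>3\<close>\<close>
  have bnd1: "\<exists>M. eventually (\<lambda>t::real. norm (q (-1 + of_real t)) \<le> M) (at_right 0)"
  proof -
    have "((\<lambda>t::real. sin (t * pi / 2) ^ 3 * cos (t * pi / 2) / t ^ 3) \<longlongrightarrow> (pi / 2) ^ 3) (at_right 0)"
      by real_asymp
    moreover have "1 < (pi / 2) ^ 3" by (rule one_less_power) (use pi_gt3 in auto)
    ultimately have "eventually (\<lambda>t::real. 1 < sin (t * pi / 2) ^ 3 * cos (t * pi / 2) / t ^ 3) (at_right 0)"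
      by (rule order_tendstoD)
    moreover have "eventually (\<lambda>t::real. t > 0) (at_right 0)" by (rule eventually_at_right_less)
    moreover have "eventually (\<lambda>t::real. t < 1) (at_right 0)"
      by (rule eventually_at_right_real[of 0 1, THEN eventually_mono]) auto
    ultimately have "eventually (\<lambda>t::real. norm (q (-1 + of_real t)) \<le> K + 8) (at_right 0)"
    proof eventually_elim
      case (elim t)
      have eq: "-1 + complex_of_real t = of_real (t - 1)" by simp
      have arg1: "(t - 1) * pi / 2 = t * pi / 2 - pi / 2" by (simp add: field_simps)
      have cc: "norm (c (-1 + of_real t)) = \<bar>sin (t * pi / 2)\<bar>"
        and ss: "norm (s (-1 + of_real t)) = \<bar>cos (t * pi / 2)\<bar>"
        unfolding eq cr arg1 by (simp_all add: cos_diff sin_diff)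
      have "t ^ 3 \<le> sin (t * pi / 2) ^ 3 * cos (t * pi / 2)" using elim(1,2) by (simp add: pos_less_divide_eq)
      hence "t ^ 3 \<le> \<bar>sin (t * pi / 2) ^ 3 * cos (t * pi / 2)\<bar>" by linarith
      hence BB: "t ^ 3 \<le> norm (B (-1 + of_real t))"
        unfolding B_def norm_mult norm_power cc ss by (simp add: abs_mult power_abs)
      have "\<bar>sin (t * pi / 2)\<bar> \<le> \<bar>t * pi / 2\<bar>" by (rule abs_sin_x_le_abs_x)
      also have "\<dots> \<le> t * 2" using elim pi_less_4 by simp
      finally have "\<bar>sin (t * pi / 2)\<bar> ^ 3 \<le> (t * 2) ^ 3" by (intro power_mono) auto
      hence sin3: "\<bar>sin (t * pi / 2)\<bar> ^ 3 \<le> 8 * t ^ 3" by (simp add: power_mult_distrib)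
      have "norm (D (-1 + of_real t)) \<le> norm (E (-1 + of_real t)) + norm (c (-1 + of_real t)) ^ 3"
        unfolding D_def using norm_triangle_ineq4 by (metis norm_power)
      also have "\<dots> \<le> K * t ^ 3 + 8 * t ^ 3"
        using E1[of t] elim sin3 unfolding cc by (intro add_mono) auto
      finally have DD: "norm (D (-1 + of_real t)) \<le> (K + 8) * t ^ 3" by (simp add: algebra_simps)
      have "norm (D (-1 + of_real t)) / norm (B (-1 + of_real t)) \<le> ((K + 8) * t ^ 3) / t ^ 3"
        using DD BB elim(2) by (intro frac_le) (auto intro: order_trans[OF norm_ge_zero])
      thus ?case using elim(2) by (simp add: q_def norm_divide)
    qed
    thus ?thesis by blast
  qed
  have nopole: "\<not> is_pole q a" for a
  proof (cases "B a = 0")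
    case False
    have "isCont D a" "isCont B a"
      using Dhol Bhol holomorphic_on_imp_continuous_on continuous_on_eq_continuous_at by blast+
    hence "isCont q a" unfolding q_def using False by (intro continuous_intros) auto
    hence "q \<midarrow>a\<rightarrow> q a" by (simp add: isCont_def)
    thus ?thesis unfolding is_pole_def
      by (meson at_neq_bot not_tendsto_and_filterlim_at_infinity)
  next
    case True
    then obtain k :: int where k: "a = of_int k" using B0 by blast
    show ?thesis
    proof (cases "even k")
      case True
      then obtain j where j: "k = 2 * j" by blast
      from bnd0 obtain M where "eventually (\<lambda>t::real. norm (q (of_real t)) \<le> M) (at_right 0)" by blast
      moreover have "norm (q (a + of_real t)) = norm (q (of_real t))" for t
        using antiperiodic_shift[of q "of_real t" j, OF qper] by (simp add: k j add_ac)
      ultimately show ?thesis by (intro not_pole_if_bounded_right[of _ _ M]) simp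
    next
      case False
      then obtain j where j: "k = 2 * j + 1" by (elim oddE)
      from bnd1 obtain M where "eventually (\<lambda>t::real. norm (q (-1 + of_real t)) \<le> M) (at_right 0)" by blast
      moreover have "norm (q (a + of_real t)) = norm (q (-1 + of_real t))" for t
        using antiperiodic_shift[of q "-1 + of_real t" "j + 1", OF qper] by (simp add: k j algebra_simps)
      ultimately show ?thesis by (intro not_pole_if_bounded_right[of _ _ M]) simp
    qed
  qed
  define Q where "Q = remove_sings q"
  have lim: "q \<midarrow>a\<rightarrow> Q a" for a
  proof -
    obtain l where "q \<midarrow>a\<rightarrow> l" using iso(2)[of a] nopole[of a] by (auto simp: not_essential_def)
    thus ?thesis unfolding Q_def using remove_sings_eqI by blast
  qed
  have Qana: "Q analytic_on {a}" for a
    unfolding Q_def using remove_sings_analytic_at[OF iso(1) lim] .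
  have Qhol: "Q holomorphic_on UNIV"
    using Qana analytic_on_analytic_at analytic_imp_holomorphic by blast
  have Qq: "Q z = q z" if "B z \<noteq> 0" for z
  proof -
    have "isCont D z" "isCont B z"
      using Dhol Bhol holomorphic_on_imp_continuous_on continuous_on_eq_continuous_at by blast+
    hence "isCont q z" unfolding q_def using that by (intro continuous_intros) auto
    hence "q \<midarrow>z\<rightarrow> q z" by (simp add: isCont_def)
    thus ?thesis using lim LIM_unique by blast
  qed
  have Qper: "Q (z + 2) = - Q z" for z
  proof -
    have "(\<lambda>w. q (w + 2)) \<midarrow>(z + 2) - 2\<rightarrow> Q (z + 2)" by (rule LIM_offset[OF lim])
    hence "(\<lambda>w. - q w) \<midarrow>z\<rightarrow> Q (z + 2)" by (simp add: qper)
    moreover have "(\<lambda>w. - q w) \<midarrow>z\<rightarrow> - Q z" by (intro tendsto_minus lim)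
    ultimately show ?thesis by (rule LIM_unique)
  qed
  have Bge: "exp (2 * pi * \<bar>Im z\<bar>) / 256 \<le> norm (B z)" if "\<bar>Im z\<bar> \<ge> 1" for z
  proof -
    define e where "e = exp \<bar>Im z * pi / 2\<bar>"
    have "1 * 1 \<le> \<bar>Im z\<bar> * (pi / 2)" using that pi_ge_two by (intro mult_mono) auto
    hence i: "\<bar>Im (z * of_real pi / 2)\<bar> \<ge> 1" by (simp add: abs_mult)
    have "e / 4 \<le> norm (c z)" "e / 4 \<le> norm (s z)"
      using norm_cos_ge_exp_Im[OF i] norm_sin_ge_exp_Im[OF i] by (simp_all add: c_def s_def e_def)
    hence "(e / 4) ^ 3 * (e / 4) \<le> norm (c z) ^ 3 * norm (s z)"
      by (intro mult_mono power_mono) (auto simp: e_def)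
    moreover have "(e / 4) ^ 3 * (e / 4) = e ^ 4 / 256" by (simp add: power_divide eval_nat_numeral)
    moreover have "e ^ 4 = exp (2 * pi * \<bar>Im z\<bar>)"
      by (simp add: e_def exp_of_nat_mult[symmetric] abs_mult mult_ac)
    ultimately have "exp (2 * pi * \<bar>Im z\<bar>) / 256 \<le> norm (c z) ^ 3 * norm (s z)"
      by (simp only:)
    thus ?thesis by (simp only: B_def norm_mult norm_power)
  qed
  have Dle: "norm (D z) \<le> (L + 1) * (1 + norm z) ^ d * exp (2 * pi * \<bar>Im z\<bar>)" if "4 \<le> Re z" "Re z \<le> 6" for z
  proof -
    define e where "e = exp (2 * pi * \<bar>Im z\<bar>)"
    have "norm (c z) \<le> exp \<bar>Im z * pi / 2\<bar>"
      unfolding c_def using norm_cos_le_exp_Im[of "z * of_real pi / 2"] by simp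
    hence "norm (c z) ^ 3 \<le> exp \<bar>Im z * pi / 2\<bar> ^ 3" by (intro power_mono) auto
    also have "\<dots> = exp (3 * (\<bar>Im z\<bar> * pi / 2))" by (simp add: exp_of_nat_mult[symmetric] abs_mult)
    also have "\<dots> \<le> e" by (simp add: e_def)
    also have "e \<le> (1 + norm z) ^ d * e" by (simp add: e_def)
    finally have "norm (c z) ^ 3 \<le> (1 + norm z) ^ d * e" .
    moreover have "norm (E z) \<le> L * (1 + norm z) ^ d * e" using growth[OF that] by (simp add: e_def)
    moreover have "norm (D z) \<le> norm (E z) + norm (c z) ^ 3"
      unfolding D_def using norm_triangle_ineq4 by (metis norm_power)
    ultimately show ?thesis unfolding e_def[symmetric] by (simp add: algebra_simps)
  qed
  obtain M where M: "\<And>z. 4 \<le> Re z \<Longrightarrow> Re z \<le> 6 \<Longrightarrow> \<bar>Im z\<bar> \<le> 1 \<Longrightarrow> norm (Q z) \<le> M"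
  proof -
    \<comment> \<open>near the real axis \<open>B\<close> has zeros, and compactness replaces the quotient estimate\<close>
    have "compact (Q ` cbox (Complex 4 (-1)) (Complex 6 1))"
      by (intro compact_continuous_image holomorphic_on_imp_continuous_on holomorphic_on_subset[OF Qhol]) auto
    hence "bounded (Q ` cbox (Complex 4 (-1)) (Complex 6 1))" by (rule compact_imp_bounded)
    then obtain M where "\<And>z. z \<in> cbox (Complex 4 (-1)) (Complex 6 1) \<Longrightarrow> norm (Q z) \<le> M"
      by (metis bounded_iff imageI)
    thus ?thesis by (intro that[of M]) (auto simp: in_cbox_complex_iff abs_le_iff)
  qed
  define R where "R = \<bar>M\<bar> + 256 * (L + 1)"
  have R0: "R \<ge> 0" using L by (simp add: R_def)
  have strip: "norm (Q z) \<le> R * (1 + norm z) ^ d" if z: "4 \<le> Re z" "Re z \<le> 6" for z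
  proof (cases "\<bar>Im z\<bar> \<le> 1")
    case True
    have "norm (Q z) \<le> R * 1" using M[OF z True] L by (simp add: R_def)
    also have "\<dots> \<le> R * (1 + norm z) ^ d" using R0 by (intro mult_left_mono) auto
    finally show ?thesis .
  next
    case False
    define e where "e = exp (2 * pi * \<bar>Im z\<bar>)"
    have e: "e > 0" by (simp add: e_def)
    have B: "e / 256 \<le> norm (B z)" using Bge[of z] False by (simp add: e_def)
    hence "B z \<noteq> 0" using e by auto
    hence "norm (Q z) = norm (D z) / norm (B z)" by (simp add: Qq q_def norm_divide)
    also have "\<dots> \<le> ((L + 1) * (1 + norm z) ^ d * e) / (e / 256)"
      using Dle[OF z] B e by (intro frac_le) (auto simp: e_def intro: order_trans[OF norm_ge_zero])
    also have "\<dots> = 256 * (L + 1) * (1 + norm z) ^ d" using e by simp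
    also have "\<dots> \<le> R * (1 + norm z) ^ d" by (intro mult_right_mono) (auto simp: R_def)
    finally show ?thesis .
  qed
  have "norm (Q z) \<le> (R * 8 ^ d) * norm z ^ d" if z: "norm z \<ge> 1" for z
  proof -
    \<comment> \<open>translate \<open>z\<close> into the strip \<open>4 \<le> Re w \<le> 6\<close>\<close>
    define k where "k = \<lfloor>(Re z - 4) / 2\<rfloor>"
    define w where "w = z + 2 * of_int (- k)"
    have k: "real_of_int k \<le> (Re z - 4) / 2" "(Re z - 4) / 2 < real_of_int k + 1"
      unfolding k_def by linarith+
    have w: "4 \<le> Re w" "Re w \<le> 6" "Im w = Im z" using k by (auto simp: w_def)
    have "norm w \<le> \<bar>Re w\<bar> + \<bar>Im w\<bar>" by (rule cmod_le)
    also have "\<dots> \<le> 6 + norm z" using w abs_Im_le_cmod[of z] by auto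
    finally have "1 + norm w \<le> 8 * norm z" using z by simp
    have "norm (Q z) = norm (Q w)" unfolding w_def by (rule antiperiodic_shift[of Q z "- k", OF Qper, symmetric])
    also have "\<dots> \<le> R * (1 + norm w) ^ d" using strip w by blast
    also have "\<dots> \<le> R * (8 * norm z) ^ d"
      using \<open>1 + norm w \<le> 8 * norm z\<close> R0 by (intro mult_left_mono power_mono) auto
    finally show ?thesis by (simp add: power_mult_distrib)
  qed
  hence Q0: "Q z = 0" for z by (rule antiperiodic_polynomial_growth_eq_0[OF Qhol Qper])
  have "D z = 0"
  proof (rule analytic_continuation_open[of "{z. Im z > 0}" UNIV D "\<lambda>_. 0"])
    show "{z. Im z > 0} \<noteq> {}" by (auto intro!: exI[of _ "\<i>"])
    fix z assume "z \<in> {z. Im z > 0}"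
    hence "B z \<noteq> 0" using B0 by force
    thus "D z = 0" using Qq[of z] Q0[of z] by (simp add: q_def)
  qed (use Dhol in \<open>auto simp: open_halfspace_Im_gt\<close>)
  thus ?thesis by (simp add: D_def c_def)
qed

section \<open>Closed form of the triple integral\<close>

lemma triple_integral_recursion:
  assumes "Re \<nu> > -1"
  shows "triple_integral \<nu> = - (64 * (\<nu> + 2) ^ 4 / (\<nu> + 1) ^ 4) * triple_integral (\<nu> + 2)"
proof -
  define m where "m = \<nu> + 1"
  have m: "Re m > 0" using assms by (simp add: m_def)
  hence m0: "m ^ 4 \<noteq> 0" by auto
  have e: "(\<nu> - 1) / 2 = m / 2 - 1" "\<nu> = m - 1" "(\<nu> + 2 - 1) / 2 = m / 2" "\<nu> + 2 = m + 1"
    by (simp_all add: m_def field_simps)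
  define J where "J = (LBINT x:{-1<..<1}. endpoint_weight (m / 2 - 1) x * (of_real x * ((legendre_P m x)\<^sup>2 * legendre_P m (- x))))"
  have "triple_integral \<nu> = - (8 / 3) * J"
    using triple_integral_eq_moment[OF m] unfolding triple_integral_def triple_integrand_def e(1) J_def
    unfolding e(2) .
  moreover have "m ^ 4 * J = 24 * (m + 1) ^ 4 * triple_integral (m + 1)"
    using triple_integral_raise_moment[OF m] unfolding triple_integral_def triple_integrand_def J_def by simp
  hence "J = 24 * (m + 1) ^ 4 * triple_integral (m + 1) / m ^ 4"
    using m0 by (simp add: field_simps)
  ultimately show ?thesis unfolding e(4) m_def[symmetric] by simp
qed

text \<open>Here the Legendre functions are constant and the integrand is the derivative of the arcsine.\<close>

lemma triple_integral_0: "triple_integral 0 = of_real pi"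
proof -
  have e: "einterval (ereal (-1)) (ereal 1) = {-1<..<1}" by auto
  define f where "f = (\<lambda>x::real. (1 - x\<^sup>2) powr (-1/2))"
  have c: "continuous_on {-1..1} arcsin" by (rule continuous_on_arcsin')
  have lim: "((arcsin \<circ> real_of_ereal) \<longlongrightarrow> - (pi / 2)) (at_right (ereal (-1)))"
            "((arcsin \<circ> real_of_ereal) \<longlongrightarrow> pi / 2) (at_left (ereal 1))"
  proof -
    have "(arcsin \<longlongrightarrow> arcsin (-1)) (at_right (-1))" "(arcsin \<longlongrightarrow> arcsin 1) (at_left 1)"
      using c[unfolded continuous_on_def, rule_format, of "-1"] c[unfolded continuous_on_def, rule_format, of 1]
      by (simp_all add: at_within_Icc_at_right at_within_Icc_at_left)
    thus "((arcsin \<circ> real_of_ereal) \<longlongrightarrow> - (pi / 2)) (at_right (ereal (-1)))"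
            "((arcsin \<circ> real_of_ereal) \<longlongrightarrow> pi / 2) (at_left (ereal 1))"
      by (simp_all add: ereal_tendsto_simps1)
  qed
  have D: "DERIV arcsin x :> f x" if "ereal (-1) < ereal x" "ereal x < ereal 1" for x
  proof -
    have "\<bar>x\<bar> < 1" using that by auto
    hence "f x = inverse (sqrt (1 - x\<^sup>2))"
      using one_minus_square_pos[of x] by (simp add: f_def powr_minus powr_half_sqrt)
    thus ?thesis using DERIV_arcsin[of x] that by simp
  qed
  have C: "isCont f x" if "ereal (-1) < ereal x" "ereal x < ereal 1" for x
  proof -
    have "\<bar>x\<bar> < 1" using that by auto
    from one_minus_square_pos[OF this] show ?thesis
      unfolding f_def by (intro continuous_intros) auto
  qed
  have "(LBINT x=ereal (-1)..ereal 1. f x) = pi / 2 - (- (pi / 2))"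
    by (rule interval_integral_FTC_nonneg(2)[OF _ D C _ lim]) (auto simp: f_def)
  hence "(LBINT x:{-1<..<1}. f x) = pi"
    unfolding interval_lebesgue_integral_def e by simp
  moreover have "triple_integral 0 = (LBINT x:{-1<..<1}. complex_of_real (f x))"
    unfolding triple_integral_def
  proof (rule set_lebesgue_integral_cong, goal_cases)
    case 2
    show ?case
    proof (intro allI impI)
      fix x :: real assume "x \<in> {-1<..<1}"
      hence x: "\<bar>x\<bar> < 1" by auto
      show "triple_integrand 0 x = complex_of_real (f x)"
        using one_minus_square_pos[OF x] powr_of_real[of "1 - x\<^sup>2" "-1/2"]
        by (simp add: triple_integrand_def endpoint_weight_def f_def)
    qed
  qed auto
  ultimately show ?thesis by (simp add: set_integral_complex_of_real)
qed

lemma Gamma_complex_nonzero: "Re z > 0 \<Longrightarrow> Gamma z \<noteq> (0 :: complex)"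
  by (subst Gamma_eq_zero_iff) (auto elim!: nonpos_Ints_cases)

lemma Gamma_add_one: "Re z > 0 \<Longrightarrow> Gamma (z + 1) = z * Gamma (z :: complex)"
  by (rule Gamma_plus1) (auto elim!: nonpos_Ints_cases)

definition gamma_ratio :: "complex \<Rightarrow> complex" where
  "gamma_ratio \<nu> = Gamma (1 + \<nu> / 2) / Gamma ((1 + \<nu>) / 2)"

lemma gamma_ratio_holomorphic: "gamma_ratio holomorphic_on {\<nu>. Re \<nu> > -1}"
  unfolding gamma_ratio_def
  by (intro holomorphic_intros Gamma_complex_nonzero) (auto elim!: nonpos_Ints_cases simp: complex_eq_iff)

lemma gamma_ratio_shift:
  assumes "Re \<nu> > -1"
  shows "gamma_ratio (\<nu> + 2) = (\<nu> + 2) / (\<nu> + 1) * gamma_ratio \<nu>"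
proof -
  have "Gamma (1 + (\<nu> + 2) / 2) = (1 + \<nu> / 2) * Gamma (1 + \<nu> / 2)"
    using Gamma_add_one[of "1 + \<nu> / 2"] assms by (simp add: add_divide_distrib add_ac)
  moreover have "Gamma ((1 + (\<nu> + 2)) / 2) = (1 + \<nu>) / 2 * Gamma ((1 + \<nu>) / 2)"
    using Gamma_add_one[of "(1 + \<nu>) / 2"] assms by (simp add: add_divide_distrib add_ac)
  moreover have "((1 + \<nu> / 2) * A) / ((1 + \<nu>) / 2 * B) = (\<nu> + 2) / (\<nu> + 1) * (A / B)" if "B \<noteq> 0" for A B
  proof -
    have "1 + \<nu> / 2 = (\<nu> + 2) / 2" "\<nu> + 1 \<noteq> 0" using assms by (auto simp: field_simps complex_eq_iff)
    thus ?thesis using that by (simp add: add.commute)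
  qed
  moreover have "Gamma ((1 + \<nu>) / 2) \<noteq> 0" using assms by (intro Gamma_complex_nonzero) simp
  ultimately show ?thesis
    unfolding gamma_ratio_def by presburger
qed

text \<open>Writing \<open>\<Gamma>((1 + \<nu>) / 2) = \<Gamma>((3 + \<nu>) / 2) / ((1 + \<nu>) / 2)\<close> exposes the zero at \<open>\<nu> = -1\<close> and leaves a
quotient \<open>\<Gamma>(z) / \<Gamma>(z + 1/2)\<close> with \<open>Re z \<ge> 1/2\<close>, which is at most \<open>\<Gamma>(1/2) = \<surd>\<pi> < 2\<close>.\<close>

lemma norm_gamma_ratio_le:
  assumes "Re \<nu> > -1"
  shows "norm (gamma_ratio \<nu>) \<le> norm (\<nu> + 1)"
proof -
  define z where "z = 1 + \<nu> / 2"
  have z: "Re z \<ge> 1 / 2" using assms by (simp add: z_def)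
  have "z + of_real (1 / 2) = (1 + \<nu>) / 2 + 1" by (simp add: z_def field_simps)
  hence G: "Gamma (z + of_real (1 / 2)) = (1 + \<nu>) / 2 * Gamma ((1 + \<nu>) / 2)"
    using Gamma_add_one[of "(1 + \<nu>) / 2"] assms by simp
  have nz: "1 + \<nu> \<noteq> 0" using assms by (auto simp: complex_eq_iff)
  have "gamma_ratio \<nu> = (1 + \<nu>) / 2 * (Gamma z / Gamma (z + of_real (1 / 2)))"
    unfolding G gamma_ratio_def using nz by (simp add: z_def)
  also have "norm \<dots> \<le> norm ((1 + \<nu>) / 2) * (Gamma (1 / 2) / Gamma (1 / 2 + 1 / 2))"
    unfolding norm_mult using z by (intro mult_left_mono norm_Gamma_quotient_le) auto
  also have "\<dots> \<le> norm ((1 + \<nu>) / 2) * 2"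
  proof -
    have "sqrt pi \<le> sqrt 4" using pi_less_4 by (subst real_sqrt_le_iff) simp
    thus ?thesis by (intro mult_left_mono) (simp_all add: Gamma_one_half_real)
  qed
  also have "\<dots> = norm (\<nu> + 1)" by (simp add: norm_divide add.commute)
  finally show ?thesis .
qed

text \<open>The quotient of the triple integral by the claimed closed form, with \<open>cos\<^sup>3(\<pi>\<nu>/2)\<close> left out of the latter.\<close>

definition normalized_triple_integral :: "complex \<Rightarrow> complex" where
  "normalized_triple_integral \<nu> = of_real pi * (2 powr \<nu>) ^ 3 * gamma_ratio \<nu> ^ 4 * triple_integral \<nu>"

text \<open>The recursion turns into antiperiodicity because \<open>2\<^sup>3\<^sup>\<nu>\<close> contributes \<open>64\<close> and the Gamma ratio
contributes \<open>(\<nu> + 2)\<^sup>4 / (\<nu> + 1)\<^sup>4\<close> when \<open>\<nu>\<close> increases by 2.\<close>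

lemma normalized_triple_integral_eq_cos_cube:
  assumes "Re \<nu> > -1"
  shows "normalized_triple_integral \<nu> = cos (\<nu> * of_real pi / 2) ^ 3"
proof -
  have hol: "normalized_triple_integral holomorphic_on {\<nu>. Re \<nu> > -1}"
    unfolding normalized_triple_integral_def[abs_def]
    by (intro holomorphic_intros gamma_ratio_holomorphic triple_integral_holomorphic) auto
  have per: "normalized_triple_integral (\<nu> + 2) = - normalized_triple_integral \<nu>" if nu: "Re \<nu> > -1" for \<nu>
  proof -
    have nz: "\<nu> + 1 \<noteq> 0" "\<nu> + 2 \<noteq> 0" using nu by (auto simp: complex_eq_iff)
    have "(2 :: complex) powr (\<nu> + 2) = 2 powr \<nu> * 4" by (simp add: powr_add)
    thus ?thesis
      unfolding normalized_triple_integral_def gamma_ratio_shift[OF nu] triple_integral_recursion[OF nu]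
      using nz by (simp add: power_mult_distrib power_divide)
  qed
  have small: "norm (normalized_triple_integral (of_real t - 1)) \<le> 18000000 * t ^ 3" if t: "0 < t" "t \<le> 1" for t :: real
  proof -
    have g: "norm (gamma_ratio (of_real t - 1)) \<le> t"
      using norm_gamma_ratio_le[of "of_real t - 1"] t by simp
    have "norm ((2::complex) powr (of_real t - 1)) = 2 powr (t - 1)"
      by (subst norm_powr_real_powr) auto
    also have "\<dots> \<le> 2 powr 0" using t by (intro powr_mono) auto
    finally have p: "norm ((2::complex) powr (of_real t - 1)) \<le> 1" by simp
    have "norm (normalized_triple_integral (of_real t - 1)) \<le> 4 * 1 ^ 3 * t ^ 4 * (4500000 / t)"
      unfolding normalized_triple_integral_def norm_mult norm_power using t p g pi_less_4
      by (intro mult_mono power_mono norm_triple_integral_near_minus_1) auto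
    also have "\<dots> = 18000000 * t ^ 3" using t by (simp add: eval_nat_numeral)
    finally show ?thesis .
  qed
  have growth: "norm (normalized_triple_integral z) \<le> (4 * (2 powr 6) ^ 3 * (4 * exp (14 * pi))) * (1 + norm z) ^ 4 * exp (2 * pi * \<bar>Im z\<bar>)"
    if z: "4 \<le> Re z" "Re z \<le> 6" for z
  proof -
    have g: "norm (gamma_ratio z) \<le> 1 + norm z"
      using norm_gamma_ratio_le[of z] z norm_triangle_ineq[of z 1] by simp
    have "norm ((2::complex) powr z) = 2 powr (Re z)"
      by (subst norm_powr_real_powr) auto
    also have "\<dots> \<le> 2 powr 6" using z by (intro powr_mono) auto
    finally have p: "norm ((2::complex) powr z) \<le> 2 powr 6" .
    have "norm z + 1 \<le> 7 + \<bar>Im z\<bar>" using cmod_le[of z] z by simp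
    hence "2 * pi * (norm z + 1) \<le> 2 * pi * (7 + \<bar>Im z\<bar>)" by (intro mult_left_mono) auto
    also have "\<dots> = 14 * pi + 2 * pi * \<bar>Im z\<bar>" by (simp add: algebra_simps)
    finally have "exp (2 * pi * (norm z + 1)) \<le> exp (14 * pi) * exp (2 * pi * \<bar>Im z\<bar>)"
      by (simp flip: exp_add)
    hence I: "norm (triple_integral z) \<le> 4 * (exp (14 * pi) * exp (2 * pi * \<bar>Im z\<bar>))"
      using norm_triple_integral_growth[OF z(1)] by linarith
    have "norm (normalized_triple_integral z) \<le> 4 * (2 powr 6) ^ 3 * (1 + norm z) ^ 4 * (4 * (exp (14 * pi) * exp (2 * pi * \<bar>Im z\<bar>)))"
      unfolding normalized_triple_integral_def norm_mult norm_power using p g pi_less_4 I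
      by (intro mult_mono power_mono) auto
    thus ?thesis by (simp add: mult_ac)
  qed
  have C0: "normalized_triple_integral 0 = 1"
  proof -
    have "gamma_ratio 0 = 1 / of_real (sqrt pi)"
      by (simp add: gamma_ratio_def Gamma_one_half_complex)
    moreover have "complex_of_real (sqrt pi) ^ 4 = of_real pi ^ 2"
    proof -
      have "sqrt pi ^ 4 = (sqrt pi ^ 2) ^ 2" by (simp only: power_mult[symmetric]) simp
      also have "\<dots> = pi ^ 2" by simp
      finally show ?thesis by (metis of_real_power)
    qed
    ultimately show ?thesis
      by (simp add: normalized_triple_integral_def triple_integral_0 power_divide power2_eq_square)
  qed
  obtain E where E: "E holomorphic_on UNIV" "\<And>z. E (z + 2) = - E z" "\<And>z. Re z > -1 \<Longrightarrow> E z = normalized_triple_integral z"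
    using antiperiodic_extension[OF hol per] by blast
  have "E \<nu> = cos (\<nu> * of_real pi / 2) ^ 3"
  proof (rule cos_cube_rigidity[OF E(1,2)])
    show "E 0 = 1" using E(3)[of 0] C0 by simp
    show "norm (E (of_real t - 1)) \<le> 18000000 * t ^ 3" if "0 < t" "t \<le> 1" for t :: real
      using E(3)[of "of_real t - 1"] small[OF that] that by simp
    show "norm (E z) \<le> (4 * (2 powr 6) ^ 3 * (4 * exp (14 * pi))) * (1 + norm z) ^ 4 * exp (2 * pi * \<bar>Im z\<bar>)"
      if "4 \<le> Re z" "Re z \<le> 6" for z
      using E(3)[of z] growth[OF that] that by simp
  qed auto
  with E(3)[OF assms] show ?thesis by simp
qed

lemma divide_powr_eq_weight:
  "y / complex_of_real (1 - x\<^sup>2) powr a = endpoint_weight (- a) x * y"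
  by (simp add: endpoint_weight_def powr_minus divide_inverse mult.commute)

theorem proposition3p1:
  fixes \<nu> :: complex
  assumes "Re \<nu> > -1"
  shows "set_integrable lborel {-1<..<1} (\<lambda>x::real. (legendre_P \<nu> x)\<^sup>2 * legendre_P \<nu> (- x) / complex_of_real (1 - x\<^sup>2) powr ((1 - \<nu>) / 2)) \<and>
      set_integrable lborel {-1<..<1} (\<lambda>x::real. of_real x * (legendre_P (\<nu> + 1) x)\<^sup>2 * legendre_P (\<nu> + 1) (- x) / complex_of_real (1 - x\<^sup>2) powr ((1 - \<nu>) / 2)) \<and>
      set_integrable lborel {-1<..<1} (\<lambda>x::real. (legendre_P \<nu> x) ^ 3 / complex_of_real (1 - x\<^sup>2) powr ((1 - \<nu>) / 2)) \<and>
      set_integrable lborel {-1<..<1} (\<lambda>x::real. of_real x * (legendre_P (\<nu> + 1) x) ^ 3 / complex_of_real (1 - x\<^sup>2) powr ((1 - \<nu>) / 2)) \<and>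
      set_integrable lborel {-1<..<1} (\<lambda>x::real. (legendre_P (\<nu> + 2) x)\<^sup>2 * legendre_P (\<nu> + 2) (- x) / complex_of_real (1 - x\<^sup>2) powr (- (1 + \<nu>) / 2)) \<and>
      (LBINT x:{-1<..<1}. (legendre_P \<nu> x)\<^sup>2 * legendre_P \<nu> (- x) / complex_of_real (1 - x\<^sup>2) powr ((1 - \<nu>) / 2))
        = - (8 / 3) * (LBINT x:{-1<..<1}. of_real x * (legendre_P (\<nu> + 1) x)\<^sup>2 * legendre_P (\<nu> + 1) (- x) / complex_of_real (1 - x\<^sup>2) powr ((1 - \<nu>) / 2)) \<and>
      (LBINT x:{-1<..<1}. (legendre_P \<nu> x) ^ 3 / complex_of_real (1 - x\<^sup>2) powr ((1 - \<nu>) / 2))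
        = (8 / 3) * (LBINT x:{-1<..<1}. of_real x * (legendre_P (\<nu> + 1) x) ^ 3 / complex_of_real (1 - x\<^sup>2) powr ((1 - \<nu>) / 2)) \<and>
      (LBINT x:{-1<..<1}. (legendre_P \<nu> x)\<^sup>2 * legendre_P \<nu> (- x) / complex_of_real (1 - x\<^sup>2) powr ((1 - \<nu>) / 2))
        = - (64 * (\<nu> + 2) ^ 4 / (\<nu> + 1) ^ 4)
          * (LBINT x:{-1<..<1}. (legendre_P (\<nu> + 2) x)\<^sup>2 * legendre_P (\<nu> + 2) (- x) / complex_of_real (1 - x\<^sup>2) powr (- (1 + \<nu>) / 2)) \<and>
      (LBINT x:{-1<..<1}. (legendre_P \<nu> x)\<^sup>2 * legendre_P \<nu> (- x) / complex_of_real (1 - x\<^sup>2) powr ((1 - \<nu>) / 2))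
        = 1 / of_real pi * (cos (\<nu> * of_real pi / 2) / 2 powr \<nu>) ^ 3
          * (Gamma ((1 + \<nu>) / 2) / Gamma (1 + \<nu> / 2)) ^ 4"
proof -
  define m where "m = \<nu> + 1"
  have m: "Re m > 0" using assms by (simp add: m_def)
  have w: "- ((1 - \<nu>) / 2) = m / 2 - 1" "- (- (1 + \<nu>) / 2) = m / 2"
    by (simp_all add: m_def field_simps)
  have trip: "triple_integral \<nu> = (LBINT x:{-1<..<1}. endpoint_weight (m / 2 - 1) x * ((legendre_P \<nu> x)\<^sup>2 * legendre_P \<nu> (- x)))"
    "triple_integral (\<nu> + 2) = (LBINT x:{-1<..<1}. endpoint_weight (m / 2) x * ((legendre_P (\<nu> + 2) x)\<^sup>2 * legendre_P (\<nu> + 2) (- x)))"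
  proof -
    have "(\<nu> - 1) / 2 = m / 2 - 1" "(\<nu> + 2 - 1) / 2 = m / 2" by (simp_all add: m_def field_simps)
    thus "triple_integral \<nu> = (LBINT x:{-1<..<1}. endpoint_weight (m / 2 - 1) x * ((legendre_P \<nu> x)\<^sup>2 * legendre_P \<nu> (- x)))"
      "triple_integral (\<nu> + 2) = (LBINT x:{-1<..<1}. endpoint_weight (m / 2) x * ((legendre_P (\<nu> + 2) x)\<^sup>2 * legendre_P (\<nu> + 2) (- x)))"
      by (simp_all only: triple_integral_def triple_integrand_def)
  qed
  have int: "set_integrable lborel {-1<..<1} (\<lambda>x. endpoint_weight s x * f x)"
    if "log_bounded f" "s = m / 2 - 1 \<or> s = m / 2" for s f
    using that m by (auto intro!: set_integrable_endpoint_weight)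
  note lb = log_bounded_intros log_bounded_legendre_P log_bounded_reflect
  have closed_form: "triple_integral \<nu> = 1 / of_real pi * (cos (\<nu> * of_real pi / 2) / 2 powr \<nu>) ^ 3
          * (Gamma ((1 + \<nu>) / 2) / Gamma (1 + \<nu> / 2)) ^ 4"
  proof -
    have nz: "Gamma ((1 + \<nu>) / 2) \<noteq> 0" "Gamma (1 + \<nu> / 2) \<noteq> 0"
      using assms by (auto intro!: Gamma_complex_nonzero)
    show ?thesis
      unfolding power_divide normalized_triple_integral_eq_cos_cube[OF assms, symmetric] normalized_triple_integral_def gamma_ratio_def
      using nz by (simp add: power_divide)
  qed
  show ?thesis
    unfolding divide_powr_eq_weight w mult.assoc[of "of_real x" for x]
  proof (intro conjI)
    show "(LBINT x:{-1<..<1}. endpoint_weight (m / 2 - 1) x * ((legendre_P \<nu> x)\<^sup>2 * legendre_P \<nu> (- x)))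
        = - (8 / 3) * (LBINT x:{-1<..<1}. endpoint_weight (m / 2 - 1) x * (of_real x * ((legendre_P (\<nu> + 1) x)\<^sup>2 * legendre_P (\<nu> + 1) (- x))))"
      using triple_integral_eq_moment[OF m] by (simp add: m_def)
    show "(LBINT x:{-1<..<1}. endpoint_weight (m / 2 - 1) x * legendre_P \<nu> x ^ 3)
        = 8 / 3 * (LBINT x:{-1<..<1}. endpoint_weight (m / 2 - 1) x * (of_real x * legendre_P (\<nu> + 1) x ^ 3))"
      using cube_integral_eq_moment[OF m] by (simp add: m_def)
  qed (use closed_form triple_integral_recursion[OF assms] in \<open>auto simp only: trip intro!: int lb\<close>)
qed

end
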